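(* Let $X=(X(t))_{t\in\mathbb{R}^d}$ be the volatility modulated mixed moving average field $X(t)=\int_{\mathcal{X}\times\mathbb{R}^d}g(x,t-s)\sigma(s)W(dx,ds)$ with $\sigma^2$ a mixed moving average, under all assumptions listed in the context. Let $H=(H_1,\dots,H_d)^\top\in\mathbb{R}^d_+$ and define $Y(t)=\big(\prod_{j=1}^dt_j^{H_j}\big)X(\log(t_1),\dots,\log(t_d))$ for $t\in\mathbb{R}^d_+$. Then for every $t\in\mathbb{R}^d_+$ the law of $Y(t)$ is of type G.
   Context: $\mathbb{R}_+=(0,\infty)$ and $\mathbb{R}^d_+$ is its $d$-fold product. A distribution is of type G if it is the law of $\sqrt{v}\,\varepsilon$ with $\varepsilon$ standard normal and $v\ge0$ an infinitely divisible random variable independent of $\varepsilon$. Let $d\in\mathbb{N}$, let $\mathcal{X}$ and $\mathcal{X}^{\sigma}$ be Borel subsets of Euclidean spaces, $p$ a probability measure on $\mathcal{X}$, $p^{\sigma}$ a probability measure on $\mathcal{X}^{\sigma}$, and $g:\mathcal{X}\times\mathbb{R}^d\to\mathbb{R}$ a measurable deterministic function. Gaussian basis and the field $X$. $W$ is a Gaussian independently scattered random measure on $\mathcal{X}\times\mathbb{R}^d$ with $\mathbb{E}(e^{i\theta W(A)})=\exp(-\frac12\theta^2c(A))$, $c(dx,ds)=p(dx)\,ds$. The volatility field $\sigma:\mathbb{R}^d\times\Omega\to\mathbb{R}$ is strictly stationary and independent of $W$. The integral defining $X$ is Walsh's stochastic integral, the first coordinate being time; standing assumption for its existence: $\sigma$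 is predictable in its first coordinate $s_1$ with respect to a right-continuous complete filtration $(\mathcal{F}_r)_{r\in\mathbb{R}}$ such that $W$ on $\mathcal{X}\times(-\infty,r]\times\mathbb{R}^{d-1}$ is $\mathcal{F}_r$-measurable and $W$ on $\mathcal{X}\times(r,\infty)\times\mathbb{R}^{d-1}$ is independent of $\mathcal{F}_r$, and $\int_{\mathcal{X}\times\mathbb{R}^d}g^2(x,t-s)\mathbb{E}(\sigma^2(s))p(dx)ds<\infty$. Since $\sigma$ is independent of $W$, this is the Wiener integral with respect to $W$ with $\sigma$ frozen. L\'evy basis. $\nu^{\sigma}$ is a measure on $(0,\infty)$ with $\int_0^\infty\min(1,w)\,\nu^{\sigma}(dw)<\infty$ and $\int_1^\infty w^2\,\nu^{\sigma}(dw)<\infty$, and $a^{\sigma}=\int_{|w|\le 1}w\,\nu^{\sigma}(dw)$ (zero drift). $L^{\sigma}$ is the L\'evy basis on $\mathcal{X}^{\sigma}\times\mathbb{R}^d$ with, for every measurable $A$ with $(p^{\sigma}\otimes Leb)(A)<\infty$, $\mathbb{E}(e^{i\theta L^{\sigma}(A)})=\exp\big((p^{\sigma}\otimes Leb)(A)\int_0^\infty(e^{i\theta w}-1)\nu^{\sigma}(dw)\big)$. Integrals of deterministic functions with respect to $L^{\sigma}$ are in the sense of Rajput and Rosinski. Integrability conditions. A nonnegative measurable $\varphi$ on $\mathcal{X}^{\sigma}\times\mathbb{R}^d$ satisfies the integrability conditions if $$\int_{\mathcal{X}^{\sigma}\times\mathbb{R}^d}\Big|\varphi(y,z)a^{\sigma}+\int_0^\infty\big(w\varphi(y,z)\mathbb{I}_{[-1,1]}(w\varphi(y,z))-\varphi(y,z)\,w\,\mathbb{I}_{[-1,1]}(w)\big)\nu^{\sigma}(dw)\Big|\,p^{\sigma}(dy)\,dz<\infty$$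 and $\int_{\mathcal{X}^{\sigma}\times\mathbb{R}^d}\int_0^\infty\min(1,|\varphi(y,z)w|^2)\,\nu^{\sigma}(dw)\,p^{\sigma}(dy)\,dz<\infty$. Assumptions on volatility. $\sigma^2(s)=\int_{\mathcal{X}^{\sigma}\times\mathbb{R}^d}h(y,s-u)L^{\sigma}(dy,du)$, where $h$ is positive, measurable and satisfies the integrability conditions. For all $y\in\mathcal{X}^{\sigma}$ and $t,u\in\mathbb{R}^d$, $k(y,t-u):=\int_{\mathcal{X}\times\mathbb{R}^d}g^2(x,t-s)h(y,s-u)p(dx)ds<\infty$, and $k$ also satisfies the integrability conditions. *)

theory Defs
  imports "HOL-Probability.Probability"
begin

definition infinitely_divisible :: "real measure \<Rightarrow> bool" where
  "infinitely_divisible \<mu> \<longleftrightarrow>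
     (\<forall>n::nat. 1 \<le> n \<longrightarrow> (\<exists>\<rho>. prob_space \<rho> \<and> sets \<rho> = sets borel \<and>
        \<mu> = distr (\<Pi>\<^sub>M i\<in>{..<n}. \<rho>) borel (\<lambda>x. \<Sum>i<n. x i)))"

text \<open>
  The auxiliary probability space may live on \<open>real \<times> real\<close> without loss of generality, since only
  the joint law of \<open>(v, \<epsilon>)\<close> matters.
\<close>

definition type_G :: "real measure \<Rightarrow> bool" where
  "type_G \<mu> \<longleftrightarrow>
     (\<exists>(P :: (real \<times> real) measure) v \<epsilon>.
        prob_space P \<and>
        prob_space.indep_var P borel v borel \<epsilon> \<and>
        (AE \<omega> in P. 0 \<le> v \<omega>) \<and>
        infinitely_divisible (distr P borel v) \<and>
        distributed P lborel \<epsilon> (\<lambda>x. ennreal (std_normal_density x)) \<and>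
        \<mu> = distr P borel (\<lambda>\<omega>. sqrt (v \<omega>) * \<epsilon> \<omega>))"

definition generated_events :: "'w measure \<Rightarrow> 'i set \<Rightarrow> ('i \<Rightarrow> 'w \<Rightarrow> real) \<Rightarrow> 'w set set" where
  "generated_events M I Z =
     sigma_sets (space M) {Z i -` B \<inter> space M | i B. i \<in> I \<and> B \<in> sets borel}"

definition strictly_stationary ::
    "'w measure \<Rightarrow> ('a::euclidean_space \<Rightarrow> 'w \<Rightarrow> real) \<Rightarrow> bool" where
  "strictly_stationary M Z \<longleftrightarrow>
     (\<forall>s. Z s \<in> borel_measurable M) \<and>
     (\<forall>J r. finite J \<longrightarrow>
        distr M (\<Pi>\<^sub>M s\<in>J. borel) (\<lambda>\<omega>. \<lambda>s\<in>J. Z (s + r) \<omega>) =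
        distr M (\<Pi>\<^sub>M s\<in>J. borel) (\<lambda>\<omega>. \<lambda>s\<in>J. Z s \<omega>))"

definition independently_scattered ::
    "'w measure \<Rightarrow> 'z measure \<Rightarrow> ('z set \<Rightarrow> 'w \<Rightarrow> real) \<Rightarrow> bool" where
  "independently_scattered M N \<Lambda> \<longleftrightarrow>
     (\<forall>A\<in>fmeasurable N. \<Lambda> A \<in> borel_measurable M) \<and>
     (\<forall>A :: nat \<Rightarrow> 'z set. range A \<subseteq> fmeasurable N \<longrightarrow> disjoint_family A \<longrightarrow>
        prob_space.indep_vars M (\<lambda>_. borel) (\<lambda>n. \<Lambda> (A n)) UNIV \<and>
        ((\<Union>n. A n) \<in> fmeasurable N \<longrightarrow>
           (AE \<omega> in M. (\<lambda>n. \<Lambda> (A n) \<omega>) sums \<Lambda> (\<Union>n. A n) \<omega>)))"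

definition gaussian_basis ::
    "'w measure \<Rightarrow> 'z measure \<Rightarrow> ('z set \<Rightarrow> 'w \<Rightarrow> real) \<Rightarrow> bool" where
  "gaussian_basis M N W \<longleftrightarrow>
     independently_scattered M N W \<and>
     (\<forall>A\<in>fmeasurable N. \<forall>\<theta>.
        char (distr M borel (W A)) \<theta> = exp (complex_of_real (- (\<theta>\<^sup>2 / 2) * measure N A)))"

definition levy_basis ::
    "'w measure \<Rightarrow> 'z measure \<Rightarrow> real measure \<Rightarrow> ('z set \<Rightarrow> 'w \<Rightarrow> real) \<Rightarrow> bool" where
  "levy_basis M N \<nu> L \<longleftrightarrow>
     independently_scattered M N L \<and>
     (\<forall>A\<in>fmeasurable N. \<forall>\<theta>.
        char (distr M borel (L A)) \<theta> =
          exp (complex_of_real (measure N A) * (CLINT w|\<nu>. iexp (\<theta> * w) - 1)))"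

text \<open>
  Time is the coordinate \<open>i\<close> of \<open>real ^ 'd\<close>.  A Borel subset of the product of the remaining
  coordinate axes is encoded by a Borel set \<open>B\<close> that is only tested at points whose time coordinate
  has been set to \<open>0\<close>.
\<close>

definition space_part :: "'d::finite \<Rightarrow> real ^ 'd \<Rightarrow> real ^ 'd" where
  "space_part i s = (\<chi> j. if j = i then 0 else s $ j)"

definition time_rectangle ::
    "'d::finite \<Rightarrow> ('x \<times> (real ^ 'd)) measure \<Rightarrow> real \<Rightarrow> real \<Rightarrow> ('x \<times> (real ^ 'd)) set \<Rightarrow>
     ('x \<times> (real ^ 'd)) set" where
  "time_rectangle i N a b B =
     {(x, s) \<in> space N. a < s $ i \<and> s $ i \<le> b \<and> (x, space_part i s) \<in> B}"

definition predictable_algebra ::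
    "'d::finite \<Rightarrow> 'w measure \<Rightarrow> (real \<Rightarrow> 'w measure) \<Rightarrow> ((real ^ 'd) \<times> 'w) measure" where
  "predictable_algebra i M F =
     sigma (UNIV \<times> space M)
       {{(s, \<omega>). a < s $ i \<and> s $ i \<le> b \<and> space_part i s \<in> B \<and> \<omega> \<in> G} | a b B G.
          B \<in> sets borel \<and> G \<in> sets (F a)}"

definition walsh_filtration ::
    "'d::finite \<Rightarrow> 'w measure \<Rightarrow> ('x \<times> (real ^ 'd)) measure \<Rightarrow>
     (('x \<times> (real ^ 'd)) set \<Rightarrow> 'w \<Rightarrow> real) \<Rightarrow> (real \<Rightarrow> 'w measure) \<Rightarrow> bool" where
  "walsh_filtration i M N W F \<longleftrightarrow>
     filtration (space M) F \<and>
     (\<forall>r. subalgebra M (F r)) \<and>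
     (\<forall>r. sets (F r) = (\<Inter>q\<in>{r<..}. sets (F q))) \<and>
     (\<forall>r. \<forall>Z\<in>null_sets M. \<forall>A\<subseteq>Z. A \<in> sets (F r)) \<and>
     (\<forall>r. \<forall>A\<in>fmeasurable N. A \<subseteq> {(x, s). s $ i \<le> r} \<longrightarrow> W A \<in> borel_measurable (F r)) \<and>
     (\<forall>r. prob_space.indep_set M (sets (F r))
            (generated_events M {A \<in> fmeasurable N. A \<subseteq> {(x, s). r < s $ i}} W))"

definition walsh_simple ::
    "'d::finite \<Rightarrow> ('x \<times> (real ^ 'd)) measure \<Rightarrow> (real \<Rightarrow> 'w measure) \<Rightarrow> nat \<Rightarrow>
     (nat \<Rightarrow> 'w \<Rightarrow> real) \<Rightarrow> (nat \<Rightarrow> real) \<Rightarrow> (nat \<Rightarrow> real) \<Rightarrow> (nat \<Rightarrow> ('x \<times> (real ^ 'd)) set) \<Rightarrow> bool"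
  where
  "walsh_simple i N F n \<xi> a b B \<longleftrightarrow>
     (\<forall>j<n. \<xi> j \<in> borel_measurable (F (a j)) \<and> bounded (\<xi> j ` space (F (a j))) \<and>
        B j \<in> sets N \<and> time_rectangle i N (a j) (b j) (B j) \<in> fmeasurable N)"

definition walsh_simple_fun ::
    "'d::finite \<Rightarrow> ('x \<times> (real ^ 'd)) measure \<Rightarrow> nat \<Rightarrow>
     (nat \<Rightarrow> 'w \<Rightarrow> real) \<Rightarrow> (nat \<Rightarrow> real) \<Rightarrow> (nat \<Rightarrow> real) \<Rightarrow> (nat \<Rightarrow> ('x \<times> (real ^ 'd)) set) \<Rightarrow>
     'x \<times> (real ^ 'd) \<Rightarrow> 'w \<Rightarrow> real" where
  "walsh_simple_fun i N n \<xi> a b B z \<omega> =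
     (\<Sum>j<n. \<xi> j \<omega> * indicator (time_rectangle i N (a j) (b j) (B j)) z)"

definition walsh_simple_integral ::
    "'d::finite \<Rightarrow> ('x \<times> (real ^ 'd)) measure \<Rightarrow> (('x \<times> (real ^ 'd)) set \<Rightarrow> 'w \<Rightarrow> real) \<Rightarrow> nat \<Rightarrow>
     (nat \<Rightarrow> 'w \<Rightarrow> real) \<Rightarrow> (nat \<Rightarrow> real) \<Rightarrow> (nat \<Rightarrow> real) \<Rightarrow> (nat \<Rightarrow> ('x \<times> (real ^ 'd)) set) \<Rightarrow>
     'w \<Rightarrow> real" where
  "walsh_simple_integral i N W n \<xi> a b B \<omega> =
     (\<Sum>j<n. \<xi> j \<omega> * W (time_rectangle i N (a j) (b j) (B j)) \<omega>)"

text \<open>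
  By the isometry of simple integrals, the integral is determined only almost surely by \<open>f\<close>; hence
  it is rendered as a relation between \<open>f\<close> and the versions \<open>I\<close> of its integral.
\<close>

definition walsh_integral ::
    "'d::finite \<Rightarrow> 'w measure \<Rightarrow> ('x \<times> (real ^ 'd)) measure \<Rightarrow>
     (('x \<times> (real ^ 'd)) set \<Rightarrow> 'w \<Rightarrow> real) \<Rightarrow> (real \<Rightarrow> 'w measure) \<Rightarrow>
     ('x \<times> (real ^ 'd) \<Rightarrow> 'w \<Rightarrow> real) \<Rightarrow> ('w \<Rightarrow> real) \<Rightarrow> bool" where
  "walsh_integral i M N W F f I \<longleftrightarrow>
     I \<in> borel_measurable M \<and>
     (\<exists>n \<xi> a b B.
        (\<forall>m. walsh_simple i N F (n m) (\<xi> m) (a m) (b m) (B m)) \<and>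
        (\<lambda>m. \<integral>\<^sup>+(z, \<omega>).
            ennreal ((f z \<omega> - walsh_simple_fun i N (n m) (\<xi> m) (a m) (b m) (B m) z \<omega>)\<^sup>2)
          \<partial>(N \<Otimes>\<^sub>M M)) \<longlonglongrightarrow> 0 \<and>
        (\<lambda>m. \<integral>\<^sup>+\<omega>.
            ennreal ((I \<omega> - walsh_simple_integral i N W (n m) (\<xi> m) (a m) (b m) (B m) \<omega>)\<^sup>2)
          \<partial>M) \<longlonglongrightarrow> 0)"

definition tendsto_in_probability ::
    "'w measure \<Rightarrow> (nat \<Rightarrow> 'w \<Rightarrow> real) \<Rightarrow> ('w \<Rightarrow> real) \<Rightarrow> bool" where
  "tendsto_in_probability M Z Y \<longleftrightarrow>
     (\<forall>e>0. (\<lambda>n. measure M {\<omega> \<in> space M. e < \<bar>Z n \<omega> - Y \<omega>\<bar>}) \<longlonglongrightarrow> 0)"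

text \<open>
  The convergence of the simple functions is required almost everywhere with respect to \<open>N\<close>.  For a
  homogeneous basis with nonzero Levy measure, \<open>N\<close> has the same null sets as the control measure of
  \<open>\<Lambda>\<close>; for zero Levy measure all integrals vanish.
\<close>

definition rr_integral ::
    "'w measure \<Rightarrow> 'z measure \<Rightarrow> ('z set \<Rightarrow> 'w \<Rightarrow> real) \<Rightarrow> ('z \<Rightarrow> real) \<Rightarrow> ('w \<Rightarrow> real) \<Rightarrow> bool" where
  "rr_integral M N \<Lambda> f I \<longleftrightarrow>
     I \<in> borel_measurable M \<and>
     (\<exists>(n :: nat \<Rightarrow> nat) (c :: nat \<Rightarrow> nat \<Rightarrow> real) (A :: nat \<Rightarrow> nat \<Rightarrow> 'z set).
        (\<forall>m. disjoint_family_on (A m) {..<n m} \<and> (\<forall>j<n m. A m j \<in> fmeasurable N)) \<and>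
        (AE z in N. (\<lambda>m. \<Sum>j<n m. c m j * indicator (A m j) z) \<longlonglongrightarrow> f z) \<and>
        (\<forall>D\<in>sets N. \<exists>J\<in>borel_measurable M.
           tendsto_in_probability M (\<lambda>m \<omega>. \<Sum>j<n m. c m j * \<Lambda> (D \<inter> A m j) \<omega>) J) \<and>
        tendsto_in_probability M (\<lambda>m \<omega>. \<Sum>j<n m. c m j * \<Lambda> (A m j) \<omega>) I)"

definition levy_drift :: "real measure \<Rightarrow> real" where
  "levy_drift \<nu> = (LINT w|\<nu>. w * indicator {-1..1} w)"

definition integrability_conditions ::
    "'z measure \<Rightarrow> real measure \<Rightarrow> ('z \<Rightarrow> real) \<Rightarrow> bool" where
  "integrability_conditions N \<nu> \<phi> \<longleftrightarrow>
     (\<integral>\<^sup>+z. ennreal \<bar>\<phi> z * levy_drift \<nu> +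
        (LINT w|\<nu>. w * \<phi> z * indicator {-1..1} (w * \<phi> z) - \<phi> z * w * indicator {-1..1} w)\<bar> \<partial>N) < \<infinity> \<and>
     (\<integral>\<^sup>+z. (\<integral>\<^sup>+w. ennreal (min 1 (\<bar>\<phi> z * w\<bar>\<^sup>2)) \<partial>\<nu>) \<partial>N) < \<infinity>"

definition lamperti ::
    "real ^ 'd::finite \<Rightarrow> (real ^ 'd \<Rightarrow> 'w \<Rightarrow> real) \<Rightarrow> real ^ 'd \<Rightarrow> 'w \<Rightarrow> real" where
  "lamperti H X t \<omega> = (\<Prod>j\<in>UNIV. (t $ j) powr (H $ j)) * X (\<chi> j. ln (t $ j)) \<omega>"

end

theory Submission
  imports Defs
begin

text \<open>
  Given the volatility, \<open>X \<tau>\<close> with \<open>\<tau> = ln t\<close> is a Wiener integral, hence centred Gaussian with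
  variance \<open>V = \<integral> f\<^sup>2 dN\<close>, where \<open>f (x, s) = g x (\<tau> - s) * \<sigma> s\<close>.  So \<open>Y t = c * X \<tau>\<close>, with \<open>c\<close> the
  product of the powers of the coordinates of \<open>t\<close>, has the law of \<open>sqrt (c\<^sup>2 * V) * \<epsilon>\<close> with \<open>\<epsilon>\<close>
  standard normal and independent of \<open>V\<close>.  Two things have to be shown: the Gaussian formula for the
  characteristic function of \<open>X \<tau>\<close> (lemma \<open>walsh_integral_char\<close>), and infinite divisibility of
  \<open>c\<^sup>2 * V\<close>.

  Both rest on one approximation (\<open>walsh_integral_sampled\<close>).  The simple functions that define
  the integral have coefficients adapted to a filtration that knows the past of \<open>W\<close>; these cannot be
  frozen.  On each cell where such a simple function is constant in space and time, its coefficient is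
  close, on average, to the values of \<open>f\<close> in that cell, so it may be replaced by a sampled value
  \<open>f z\<close>.  A small delay in time makes the sampled coefficients adapted, and the isometry of adapted
  simple integrals (\<open>adapted_isometry\<close>) shows that the integrals of the sampled functions still
  converge to \<open>X \<tau>\<close>.  Their coefficients are multiples of values of \<open>\<sigma>\<close>, thus independent of \<open>W\<close>, and
  conditioning on them is elementary (\<open>gaussian_basis_conditional_char\<close>).

  The same approximation shows that \<open>V\<close> is a limit in mean of finite nonnegative combinations of
  values \<open>(\<sigma> s)\<^sup>2\<close>.  Each \<open>(\<sigma> s)\<^sup>2\<close> is a limit in probability of linear combinations of values of the
  Levy basis, hence so is \<open>V\<close> (\<open>conditional_variance_approx_linear\<close>).  A finite linear combination of
  values of \<open>L\<close> has convolution roots of every order \<open>n\<close>: over the atoms of the sets involved the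
  values are independent, and replacing every atom by a set of one \<open>n\<close>-th of its measure yields the
  root (\<open>levy_basis_conv_root\<close>).  Convolution roots of a tight family are tight, so they survive the
  passage to the limit (\<open>conv_root_limit\<close>).
\<close>

section \<open>Independently scattered random measures\<close>

lemma scattered_measurable:
  assumes "independently_scattered M N \<Lambda>" "A \<in> fmeasurable N"
  shows "\<Lambda> A \<in> borel_measurable M"
  using assms by (auto simp: independently_scattered_def)

text \<open>Countable additivity over infinitely many copies of the empty set makes the constant series with
  term \<open>\<Lambda> {}\<close> converge.\<close>

lemma scattered_empty:
  assumes "independently_scattered M N \<Lambda>"
  shows "AE \<omega> in M. \<Lambda> {} \<omega> = 0"
proof -
  have "AE \<omega> in M. (\<lambda>n. \<Lambda> {} \<omega>) sums \<Lambda> (\<Union>n::nat. {}) \<omega>"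
    using assms[unfolded independently_scattered_def, THEN conjunct2, rule_format, of "\<lambda>_. {}"]
    by (auto simp: disjoint_family_on_def)
  then show ?thesis
    by eventually_elim (auto dest!: sums_summable summable_LIMSEQ_zero simp: LIMSEQ_const_iff)
qed

lemma (in prob_space) indep_vars_reindex:
  assumes ind: "indep_vars M' X (f ` K)" and inj: "inj_on f K"
  shows "indep_vars (\<lambda>k. M' (f k)) (\<lambda>k. X (f k)) K"
proof -
  define G where "G i = {X i -` A \<inter> space M |A. A \<in> sets (M' i)}" for i
  have G: "\<And>i. i \<in> f ` K \<Longrightarrow> random_variable (M' i) (X i)" "indep_sets G (f ` K)"
    using ind unfolding indep_vars_def2 G_def[abs_def] by auto
  have "indep_sets (\<lambda>k. G (f k)) K"
  proof (rule indep_setsI)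
    show "G (f i) \<subseteq> events" if "i \<in> K" for i
      using G(1)[of "f i"] that by (auto simp: G_def)
    fix A J assume J: "J \<noteq> {}" "J \<subseteq> K" "finite J" "\<forall>j\<in>J. A j \<in> G (f j)"
    define g where "g = inv_into K f"
    have g: "k \<in> K \<Longrightarrow> g (f k) = k" for k using inj by (simp add: g_def)
    have injJ: "inj_on f J" using inj J(2) by (rule inj_on_subset)
    have "prob (\<Inter>i\<in>f ` J. A (g i)) = (\<Prod>i\<in>f ` J. prob (A (g i)))"
      using J g by (intro indep_setsD[OF G(2)]) (auto simp: subset_eq)
    moreover have "(\<Inter>i\<in>f ` J. A (g i)) = (\<Inter>j\<in>J. A j)" using J(2) g by (auto simp: subset_eq)
    moreover have "(\<Prod>i\<in>f ` J. prob (A (g i))) = (\<Prod>j\<in>J. prob (A j))"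
      using J(2) g by (subst prod.reindex[OF injJ]) (auto intro!: prod.cong)
    ultimately show "prob (\<Inter>j\<in>J. A j) = (\<Prod>j\<in>J. prob (A j))" by simp
  qed
  then show ?thesis using G(1) by (auto simp: indep_vars_def2 G_def)
qed

text \<open>Independent scattering speaks of infinite disjoint sequences; a finite family is padded with
  empty sets, which contribute \<open>0\<close>.\<close>

lemma scattered_finite_disjoint:
  fixes C :: "'k \<Rightarrow> 'z set"
  assumes M: "prob_space M" and \<Lambda>: "independently_scattered M N \<Lambda>"
    and fin: "finite K" and C: "\<And>k. k \<in> K \<Longrightarrow> C k \<in> fmeasurable N" and dis: "disjoint_family_on C K"
  shows scattered_indep_vars: "prob_space.indep_vars M (\<lambda>_. borel) (\<lambda>k. \<Lambda> (C k)) K"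
    and scattered_UN: "AE \<omega> in M. \<Lambda> (\<Union>k\<in>K. C k) \<omega> = (\<Sum>k\<in>K. \<Lambda> (C k) \<omega>)"
proof -
  interpret prob_space M by fact
  obtain e where e: "bij_betw e {..<card K} K"
    using bij_betw_from_nat_into_finite[OF fin] by blast
  define A where "A n = (if n < card K then C (e n) else {})" for n
  have eK: "n < card K \<Longrightarrow> e n \<in> K" for n using e by (auto simp: bij_betw_def)
  have inj: "inj_on e {..<card K}" using e by (auto simp: bij_betw_def)
  have A1: "range A \<subseteq> fmeasurable N" using C eK by (auto simp: A_def)
  have A2: "disjoint_family A"
    unfolding disjoint_family_on_def
  proof (intro ballI impI)
    fix m n assume "m \<noteq> (n::nat)"
    then show "A m \<inter> A n = {}"
      using dis inj_onD[OF inj, of m n] eK[of m] eK[of n] by (auto simp: A_def disjoint_family_on_def)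
  qed
  have UN: "(\<Union>n. A n) = (\<Union>k\<in>K. C k)"
  proof -
    have "(\<Union>n. A n) = (\<Union>n\<in>{..<card K}. C (e n))" by (auto simp: A_def split: if_splits)
    also have "\<dots> = (\<Union>k\<in>e ` {..<card K}. C k)" by simp
    also have "e ` {..<card K} = K" using e by (simp add: bij_betw_def)
    finally show ?thesis .
  qed
  have UNf: "(\<Union>n. A n) \<in> fmeasurable N" unfolding UN using fin C by (intro fmeasurable.finite_UN) auto
  have ind: "indep_vars (\<lambda>_. borel) (\<lambda>n. \<Lambda> (A n)) UNIV"
    and sums: "AE \<omega> in M. (\<lambda>n. \<Lambda> (A n) \<omega>) sums \<Lambda> (\<Union>n. A n) \<omega>"
    using \<Lambda> A1 A2 UNf by (auto simp: independently_scattered_def)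
  define e' where "e' = inv_into {..<card K} e"
  have e': "e' k < card K \<and> e (e' k) = k" if "k \<in> K" for k
  proof -
    have "k \<in> e ` {..<card K}" using e that by (simp add: bij_betw_def)
    from inv_into_into[OF this] f_inv_into_f[OF this] show ?thesis by (simp add: e'_def)
  qed
  have "indep_vars (\<lambda>_. borel) (\<lambda>n. \<Lambda> (A n)) (e' ` K)"
    using ind by (rule indep_vars_subset) auto
  moreover have "inj_on e' K" using e' by (intro inj_on_inverseI[of _ e]) auto
  ultimately have "indep_vars (\<lambda>k. borel) (\<lambda>k. \<Lambda> (A (e' k))) K"
    by (rule indep_vars_reindex)
  then show "indep_vars (\<lambda>_. borel) (\<lambda>k. \<Lambda> (C k)) K"
    by (subst (asm) indep_vars_cong[OF refl]) (auto simp: A_def e' comp_def)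
  show "AE \<omega> in M. \<Lambda> (\<Union>k\<in>K. C k) \<omega> = (\<Sum>k\<in>K. \<Lambda> (C k) \<omega>)"
    using sums scattered_empty[OF \<Lambda>]
  proof eventually_elim
    case (elim \<omega>)
    have "(\<lambda>n. \<Lambda> (A n) \<omega>) sums (\<Sum>n<card K. \<Lambda> (A n) \<omega>)"
      using elim(2) by (intro sums_finite) (auto simp: A_def)
    then have "\<Lambda> (\<Union>n. A n) \<omega> = (\<Sum>n<card K. \<Lambda> (A n) \<omega>)" using elim(1) sums_unique2 by blast
    also have "\<dots> = (\<Sum>n<card K. \<Lambda> (C (e n)) \<omega>)" by (intro sum.cong) (auto simp: A_def)
    also have "\<dots> = (\<Sum>k\<in>K. \<Lambda> (C k) \<omega>)" by (rule sum.reindex_bij_betw[OF e])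
    finally show ?case by (simp add: UN)
  qed
qed

lemma scattered_Un:
  assumes M: "prob_space M" and \<Lambda>: "independently_scattered M N \<Lambda>"
    and A: "A \<in> fmeasurable N" and B: "B \<in> fmeasurable N" and dis: "A \<inter> B = {}"
  shows scattered_indep_var: "prob_space.indep_var M borel (\<Lambda> A) borel (\<Lambda> B)"
    and scattered_add: "AE \<omega> in M. \<Lambda> (A \<union> B) \<omega> = \<Lambda> A \<omega> + \<Lambda> B \<omega>"
proof -
  interpret prob_space M by fact
  define C where "C = case_bool A B"
  have C: "\<And>k. k \<in> UNIV \<Longrightarrow> C k \<in> fmeasurable N" "disjoint_family_on C UNIV"
    using A B dis by (auto simp: C_def disjoint_family_on_def split: bool.split)
  have "indep_vars (\<lambda>_. borel) (\<lambda>k. \<Lambda> (C k)) UNIV" 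
    by (rule scattered_indep_vars[OF M \<Lambda> _ C]) auto
  moreover have "case_bool borel borel = (\<lambda>_. borel :: real measure)" "(\<lambda>k. \<Lambda> (C k)) = case_bool (\<Lambda> A) (\<Lambda> B)"
    by (auto simp: fun_eq_iff C_def split: bool.split)
  ultimately show "indep_var borel (\<Lambda> A) borel (\<Lambda> B)" unfolding indep_var_def by (simp only:)
  have "AE \<omega> in M. \<Lambda> (\<Union>k\<in>UNIV. C k) \<omega> = (\<Sum>k\<in>UNIV. \<Lambda> (C k) \<omega>)"
    by (rule scattered_UN[OF M \<Lambda> _ C]) auto
  moreover have "(\<Union>k\<in>UNIV. C k) = A \<union> B" by (auto simp: C_def split: bool.splits)
  ultimately show "AE \<omega> in M. \<Lambda> (A \<union> B) \<omega> = \<Lambda> A \<omega> + \<Lambda> B \<omega>"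
    by (simp add: UNIV_bool C_def add.commute)
qed

text \<open>The values of a random measure are independent over disjoint sets only.  Linear combinations
  over overlapping sets are therefore rewritten over the atoms of the finite algebra generated by the
  family; an atom is indexed by the subfamily of the sets that contain its points.\<close>

definition atom :: "'z set set \<Rightarrow> 'z set set \<Rightarrow> 'z set" where
  "atom \<A> S = {z \<in> \<Union>\<A>. {A \<in> \<A>. z \<in> A} = S}"

lemma atom_disjoint: "disjoint_family_on (atom \<A>) K"
  by (auto simp: disjoint_family_on_def atom_def)

lemma atom_fmeasurable:
  assumes "finite \<A>" "\<A> \<subseteq> fmeasurable N" "S \<subseteq> \<A>"
  shows "atom \<A> S \<in> fmeasurable N"
proof (rule fmeasurableI2[of "\<Union>\<A>"])
  show "\<Union>\<A> \<in> fmeasurable N" using assms(1,2) by (induction \<A>) auto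
  have sets: "\<A> \<subseteq> sets N" "S \<subseteq> sets N" "finite S" "finite (\<A> - S)"
    using assms finite_subset by auto
  have sp: "\<Union>\<A> \<subseteq> space N" using sets(1) sets.sets_into_space by blast
  have "atom \<A> S = (\<Union>\<A>) - \<Union>(\<A> - S) - (\<Union>A\<in>S. space N - A)"
  proof (rule set_eqI)
    fix z
    show "z \<in> atom \<A> S \<longleftrightarrow> z \<in> (\<Union>\<A>) - \<Union>(\<A> - S) - (\<Union>A\<in>S. space N - A)"
    proof (cases "z \<in> \<Union>\<A>")
      case True
      then have "z \<in> space N" using sp by auto
      then show ?thesis using True assms(3) by (auto simp: atom_def set_eq_iff)
    qed (simp add: atom_def)
  qed
  moreover have "\<Union>\<A> \<in> sets N" using sets assms(1) by (intro sets.finite_Union) auto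
  moreover have "\<Union>(\<A> - S) \<in> sets N" using sets assms(1) by (intro sets.finite_Union) auto
  moreover have "(\<Union>A\<in>S. space N - A) \<in> sets N" using sets by (intro sets.finite_UN) auto
  ultimately show "atom \<A> S \<in> sets N" by (simp only: sets.Diff)
qed (auto simp: atom_def)

lemma atom_UN:
  assumes "A \<in> \<A>" shows "A = (\<Union>S\<in>{S\<in>Pow \<A>. A \<in> S}. atom \<A> S)"
proof (intro equalityI subsetI)
  fix z assume "z \<in> A"
  then show "z \<in> (\<Union>S\<in>{S\<in>Pow \<A>. A \<in> S}. atom \<A> S)"
    using assms by (intro UN_I[of "{B \<in> \<A>. z \<in> B}"]) (auto simp: atom_def)
next
  fix z assume "z \<in> (\<Union>S\<in>{S\<in>Pow \<A>. A \<in> S}. atom \<A> S)"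
  then obtain S where "A \<in> S" "z \<in> atom \<A> S" by blast
  then show "z \<in> A" unfolding atom_def by blast
qed

lemma scattered_linear_combination_atoms:
  assumes M: "prob_space M" and \<Lambda>: "independently_scattered M N \<Lambda>"
    and fin: "finite \<A>" and A: "\<A> \<subseteq> fmeasurable N"
  shows "AE \<omega> in M. (\<Sum>A\<in>\<A>. c A * \<Lambda> A \<omega>) = (\<Sum>S\<in>Pow \<A>. (\<Sum>A\<in>S. c A) * \<Lambda> (atom \<A> S) \<omega>)"
proof -
  have "AE \<omega> in M. \<forall>A\<in>\<A>. \<Lambda> A \<omega> = (\<Sum>S\<in>{S\<in>Pow \<A>. A \<in> S}. \<Lambda> (atom \<A> S) \<omega>)"
  proof (intro AE_finite_allI fin)
    fix B assume B: "B \<in> \<A>"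
    have "AE \<omega> in M. \<Lambda> (\<Union>S\<in>{S\<in>Pow \<A>. B \<in> S}. atom \<A> S) \<omega> = (\<Sum>S\<in>{S\<in>Pow \<A>. B \<in> S}. \<Lambda> (atom \<A> S) \<omega>)"
      using fin A by (intro scattered_UN[OF M \<Lambda>] atom_disjoint atom_fmeasurable) auto
    then show "AE \<omega> in M. \<Lambda> B \<omega> = (\<Sum>S\<in>{S\<in>Pow \<A>. B \<in> S}. \<Lambda> (atom \<A> S) \<omega>)"
      using atom_UN[OF B] by simp
  qed
  then show ?thesis
  proof eventually_elim
    case (elim \<omega>)
    have "(\<Sum>A\<in>\<A>. c A * \<Lambda> A \<omega>) = (\<Sum>A\<in>\<A>. \<Sum>S\<in>{S\<in>Pow \<A>. A \<in> S}. c A * \<Lambda> (atom \<A> S) \<omega>)"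
      using elim by (auto simp: sum_distrib_left intro!: sum.cong)
    also have "\<dots> = (\<Sum>S\<in>Pow \<A>. \<Sum>A\<in>{A\<in>\<A>. A \<in> S}. c A * \<Lambda> (atom \<A> S) \<omega>)"
      using fin by (intro sum.swap_restrict) auto
    also have "\<dots> = (\<Sum>S\<in>Pow \<A>. (\<Sum>A\<in>S. c A) * \<Lambda> (atom \<A> S) \<omega>)"
      unfolding sum_distrib_right by (intro sum.cong refl) auto
    finally show ?case .
  qed
qed

section \<open>Infinite divisibility through characteristic functions\<close>

lemma char_distr_scale:
  assumes "Z \<in> borel_measurable M"
  shows "char (distr M borel (\<lambda>\<omega>. e * Z \<omega>)) \<theta> = char (distr M borel Z) (e * \<theta>)"
  using assms by (simp add: char_def integral_distr mult_ac)

lemma sum_PiM_real_distribution: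
  fixes \<rho> :: "'k \<Rightarrow> real measure"
  assumes fin: "finite K" and \<rho>: "\<And>k. real_distribution (\<rho> k)"
  shows real_distribution_sum_PiM: "real_distribution (distr (PiM K \<rho>) borel (\<lambda>x. \<Sum>k\<in>K. x k))"
    and char_sum_PiM: "char (distr (PiM K \<rho>) borel (\<lambda>x. \<Sum>k\<in>K. x k)) \<theta> = (\<Prod>k\<in>K. char (\<rho> k) \<theta>)"
proof -
  have prob: "prob_space (\<rho> k)" for k using \<rho> by (simp add: real_distribution_def)
  have [measurable_cong]: "sets (\<rho> k) = sets borel" for k
    using \<rho>[of k] by (simp add: real_distribution_def real_distribution_axioms_def)
  interpret product_prob_space \<rho> K
    using prob by (simp add: product_prob_space_def product_prob_space_axioms_def product_sigma_finite_def
        prob_space_imp_sigma_finite)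
  have PP: "prob_space (PiM K \<rho>)" by (rule prob_space_PiM) (rule prob)
  have meas: "(\<lambda>x. \<Sum>k\<in>K. x k) \<in> borel_measurable (PiM K \<rho>)" by measurable
  show "real_distribution (distr (PiM K \<rho>) borel (\<lambda>x. \<Sum>k\<in>K. x k))"
    using PP meas by (rule prob_space.real_distribution_distr)
  have "char (distr (PiM K \<rho>) borel (\<lambda>x. \<Sum>k\<in>K. x k)) \<theta>
      = (CLINT x|PiM K \<rho>. iexp (\<theta> * (\<Sum>k\<in>K. x k)))"
    unfolding char_def by (intro integral_distr meas) simp
  also have "\<dots> = (CLINT x|PiM K \<rho>. (\<Prod>k\<in>K. iexp (\<theta> * x k)))"
    using fin by (intro Bochner_Integration.integral_cong) (simp_all add: exp_sum sum_distrib_left)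
  also have "\<dots> = (\<Prod>k\<in>K. CLINT y|\<rho> k. iexp (\<theta> * y))"
    using fin prob_space.integrable_iexp[OF prob]
    by (intro product_integral_prod) (auto intro!: prob_space.integrable_iexp[OF prob])
  finally show "char (distr (PiM K \<rho>) borel (\<lambda>x. \<Sum>k\<in>K. x k)) \<theta> = (\<Prod>k\<in>K. char (\<rho> k) \<theta>)"
    by (simp add: char_def)
qed

text \<open>An \<open>n\<close>-th convolution root.  By the uniqueness theorem the condition on characteristic functions
  says that \<open>\<mu>\<close> is the law of a sum of \<open>n\<close> independent copies; this form passes to limits directly.\<close>

definition conv_root :: "nat \<Rightarrow> real measure \<Rightarrow> real measure \<Rightarrow> bool" where
  "conv_root n \<mu> \<rho> \<longleftrightarrow> real_distribution \<rho> \<and> (\<forall>\<theta>. char \<rho> \<theta> ^ n = char \<mu> \<theta>)"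

lemma conv_root_sum:
  assumes "real_distribution \<mu>" "conv_root n \<mu> \<rho>"
  shows "\<mu> = distr (\<Pi>\<^sub>M i\<in>{..<n}. \<rho>) borel (\<lambda>x. \<Sum>i<n. x i)"
proof (rule Levy_uniqueness)
  show "real_distribution (distr (\<Pi>\<^sub>M i\<in>{..<n}. \<rho>) borel (\<lambda>x. \<Sum>i<n. x i))"
    using assms by (intro real_distribution_sum_PiM) (auto simp: conv_root_def)
  show "char \<mu> = char (distr (\<Pi>\<^sub>M i\<in>{..<n}. \<rho>) borel (\<lambda>x. \<Sum>i<n. x i))"
    using assms by (simp add: fun_eq_iff char_sum_PiM conv_root_def)
qed (use assms in auto)

lemma infinitely_divisibleI:
  assumes "real_distribution \<mu>" "\<And>n. 1 \<le> n \<Longrightarrow> \<exists>\<rho>. conv_root n \<mu> \<rho>"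
  shows "infinitely_divisible \<mu>"
  unfolding infinitely_divisible_def
proof (intro allI impI)
  fix n :: nat assume "1 \<le> n"
  then obtain \<rho> where \<rho>: "conv_root n \<mu> \<rho>" using assms(2) by blast
  then have "real_distribution \<rho>" by (simp add: conv_root_def)
  then show "\<exists>\<rho>. prob_space \<rho> \<and> sets \<rho> = sets borel \<and> \<mu> = distr (\<Pi>\<^sub>M i\<in>{..<n}. \<rho>) borel (\<lambda>x. \<Sum>i<n. x i)"
    using conv_root_sum[OF assms(1) \<rho>]
    by (auto simp: real_distribution_def real_distribution_axioms_def)
qed

text \<open>If all \<open>n\<close> independent summands lie in \<open>S\<close>, then their sum lies in \<open>T\<close>; this controls the tails
  of a convolution root by those of the law itself.\<close>

lemma conv_root_measure_power_le:
  assumes \<mu>: "real_distribution \<mu>" and \<rho>: "conv_root n \<mu> \<rho>"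
    and [measurable]: "S \<in> sets borel" "T \<in> sets borel"
    and ST: "\<And>x. (\<And>i. i < n \<Longrightarrow> x i \<in> S) \<Longrightarrow> (\<Sum>i<n. x i) \<in> T"
  shows "measure \<rho> S ^ n \<le> measure \<mu> T"
proof -
  have "real_distribution \<rho>" using \<rho> by (simp add: conv_root_def)
  then interpret R: real_distribution \<rho> .
  interpret P: product_prob_space "\<lambda>_::nat. \<rho>" "{..<n}"
    using R.prob_space_axioms
    by (simp add: product_prob_space_def product_prob_space_axioms_def product_sigma_finite_def
        prob_space_imp_sigma_finite)
  interpret F: finite_product_prob_space "\<lambda>_::nat. \<rho>" "{..<n}" by standard simp
  have Q: "prob_space (\<Pi>\<^sub>M i\<in>{..<n}. \<rho>)" by (rule prob_space_PiM) (rule R.prob_space_axioms)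
  have "measure \<rho> S ^ n = measure (\<Pi>\<^sub>M i\<in>{..<n}. \<rho>) (\<Pi>\<^sub>E i\<in>{..<n}. S)"
    by (subst F.finite_measure_PiM_emb) (auto simp: R.events_eq_borel)
  also have "\<dots> \<le> measure (\<Pi>\<^sub>M i\<in>{..<n}. \<rho>) ((\<lambda>x. \<Sum>i<n. x i) -` T \<inter> space (\<Pi>\<^sub>M i\<in>{..<n}. \<rho>))"
  proof (rule finite_measure.finite_measure_mono[OF prob_space.finite_measure[OF Q]])
    show "(\<Pi>\<^sub>E i\<in>{..<n}. S) \<subseteq> (\<lambda>x. \<Sum>i<n. x i) -` T \<inter> space (\<Pi>\<^sub>M i\<in>{..<n}. \<rho>)"
      using ST by (auto simp: space_PiM PiE_iff)
  qed measurable
  also have "\<dots> = measure (distr (\<Pi>\<^sub>M i\<in>{..<n}. \<rho>) borel (\<lambda>x. \<Sum>i<n. x i)) T"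
    by (intro measure_distr[symmetric]) measurable
  also have "\<dots> = measure \<mu> T" by (simp only: conv_root_sum[OF \<mu> \<rho>, symmetric])
  finally show ?thesis .
qed

lemma cmod_iexp_diff_le: "cmod (iexp a - iexp b) \<le> \<bar>a - b\<bar>"
proof -
  have "iexp a - iexp b = iexp b * (iexp (a - b) - 1)"
    by (simp add: algebra_simps flip: exp_add)
  then have "cmod (iexp a - iexp b) = cmod (iexp (a - b) - 1)" by (simp add: norm_mult)
  also have "\<dots> \<le> \<bar>a - b\<bar>" using iexp_approx1[of "a - b" 0] by simp
  finally show ?thesis .
qed

text \<open>Variables that are close in probability have close characteristic functions: where they differ by
  at most \<open>e\<close> the exponential is Lipschitz, and elsewhere it is bounded.\<close>

lemma (in prob_space) char_distr_diff_le:
  assumes [measurable]: "Z \<in> borel_measurable M" "Y \<in> borel_measurable M" and e: "0 \<le> e"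
  shows "cmod (char (distr M borel Z) \<theta> - char (distr M borel Y) \<theta>)
    \<le> \<bar>\<theta>\<bar> * e + 2 * prob {\<omega> \<in> space M. e < \<bar>Z \<omega> - Y \<omega>\<bar>}"
proof -
  define B where "B = {\<omega> \<in> space M. e < \<bar>Z \<omega> - Y \<omega>\<bar>}"
  have [measurable]: "B \<in> events" unfolding B_def by measurable
  have intB: "integrable M (indicator B :: _ \<Rightarrow> real)"
    by (intro integrable_real_indicator) (auto simp: less_top[symmetric])
  have int: "integrable M (\<lambda>\<omega>. iexp (\<theta> * Z \<omega>))" "integrable M (\<lambda>\<omega>. iexp (\<theta> * Y \<omega>))"
    by (intro integrable_iexp; simp)+
  have "char (distr M borel Z) \<theta> - char (distr M borel Y) \<theta> = (CLINT \<omega>|M. iexp (\<theta> * Z \<omega>) - iexp (\<theta> * Y \<omega>))"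
    using int by (simp add: char_def integral_distr)
  also have "cmod \<dots> \<le> (LINT \<omega>|M. cmod (iexp (\<theta> * Z \<omega>) - iexp (\<theta> * Y \<omega>)))"
    by (rule integral_norm_bound)
  also have "\<dots> \<le> (LINT \<omega>|M. \<bar>\<theta>\<bar> * e + 2 * indicator B \<omega>)"
  proof (intro integral_mono)
    fix \<omega> assume \<omega>: "\<omega> \<in> space M"
    show "cmod (iexp (\<theta> * Z \<omega>) - iexp (\<theta> * Y \<omega>)) \<le> \<bar>\<theta>\<bar> * e + 2 * indicator B \<omega>"
    proof (cases "e < \<bar>Z \<omega> - Y \<omega>\<bar>")
      case False
      then have "\<bar>\<theta> * Z \<omega> - \<theta> * Y \<omega>\<bar> \<le> \<bar>\<theta>\<bar> * e"
        by (simp add: abs_mult mult_left_mono flip: right_diff_distrib)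
      then show ?thesis using cmod_iexp_diff_le[of "\<theta> * Z \<omega>" "\<theta> * Y \<omega>"] False
        by (simp add: B_def)
    next
      case True
      have "cmod (iexp (\<theta> * Z \<omega>) - iexp (\<theta> * Y \<omega>)) \<le> 1 + 1"
        by (intro order_trans[OF norm_triangle_ineq4] add_mono) auto
      then show ?thesis using True \<omega> e by (simp add: B_def add_increasing)
    qed
  qed (use int intB in auto)
  also have "\<dots> = \<bar>\<theta>\<bar> * e + 2 * prob B" using intB by (simp add: prob_space)
  finally show ?thesis by (simp add: B_def)
qed

lemma (in prob_space) tail_small:
  fixes Z :: "'a \<Rightarrow> real"
  assumes [measurable]: "Z \<in> borel_measurable M" and "0 < (\<epsilon>::real)"
  shows "\<exists>K. \<forall>K'\<ge>K. prob {\<omega> \<in> space M. K' < \<bar>Z \<omega>\<bar>} < \<epsilon>"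
proof -
  have "(\<lambda>m::nat. prob {\<omega> \<in> space M. real m < \<bar>Z \<omega>\<bar>}) \<longlonglongrightarrow> prob (\<Inter>m::nat. {\<omega> \<in> space M. real m < \<bar>Z \<omega>\<bar>})"
    by (intro finite_Lim_measure_decseq) (auto simp: decseq_def)
  moreover have "(\<Inter>m::nat. {\<omega> \<in> space M. real m < \<bar>Z \<omega>\<bar>}) = {}"
    
  proof -
    have "\<exists>m::nat. \<not> real m < \<bar>Z \<omega>\<bar>" for \<omega>
      using reals_Archimedean2[of "\<bar>Z \<omega>\<bar>"] less_asym by blast
    then show ?thesis by blast
  qed
  ultimately have "(\<lambda>m::nat. prob {\<omega> \<in> space M. real m < \<bar>Z \<omega>\<bar>}) \<longlonglongrightarrow> 0" by simp
  then have "\<forall>\<^sub>F m in sequentially. prob {\<omega> \<in> space M. real m < \<bar>Z \<omega>\<bar>} < \<epsilon>"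
    using assms(2) by (rule order_tendstoD)
  then obtain m :: nat where m: "prob {\<omega> \<in> space M. real m < \<bar>Z \<omega>\<bar>} < \<epsilon>"
    using eventually_happens'[OF sequentially_bot] by blast
  have "prob {\<omega> \<in> space M. K' < \<bar>Z \<omega>\<bar>} \<le> prob {\<omega> \<in> space M. real m < \<bar>Z \<omega>\<bar>}" if "real m \<le> K'" for K'
    using that by (intro finite_measure_mono) auto
  then show ?thesis using m by (intro exI[of _ "real m"]) (auto intro: le_less_trans)
qed

text \<open>Laws with an \<open>n\<close>-th root are closed under convergence in probability.  The laws of the
  approximating variables are tight, hence so are their roots by the tail estimate above.  Helly's
  theorem yields a weak limit point of the roots, and the \<open>n\<close>-th power of its characteristic function
  is the limit of the given ones.  So no branch of the \<open>n\<close>-th root of a characteristic function has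
  to be followed along the sequence.\<close>

lemma (in prob_space) conv_root_limit:
  fixes Z :: "'a \<Rightarrow> real"
  assumes Z: "Z \<in> borel_measurable M"
    and approx: "\<And>e. 0 < e \<Longrightarrow> \<exists>Y \<rho>. Y \<in> borel_measurable M \<and> conv_root n (distr M borel Y) \<rho> \<and>
        prob {\<omega> \<in> space M. e < \<bar>Z \<omega> - Y \<omega>\<bar>} < e"
    and n: "1 \<le> n"
  shows "\<exists>\<rho>. conv_root n (distr M borel Z) \<rho>"
proof -
  define \<delta> where "\<delta> m = 1 / real (Suc m)" for m
  have \<delta>: "0 < \<delta> m" "\<delta> m \<le> 1" for m by (auto simp: \<delta>_def)
  have \<delta>0: "\<delta> \<longlonglongrightarrow> 0" unfolding \<delta>_def by (rule LIMSEQ_Suc[OF lim_1_over_n])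
  have "\<forall>m. \<exists>p. fst p \<in> borel_measurable M \<and> conv_root n (distr M borel (fst p)) (snd p) \<and>
        prob {\<omega> \<in> space M. \<delta> m < \<bar>Z \<omega> - fst p \<omega>\<bar>} < \<delta> m"
    using approx[OF \<delta>(1)] by simp
  from choice[OF this] obtain p where p: "\<And>m. fst (p m) \<in> borel_measurable M \<and>
      conv_root n (distr M borel (fst (p m))) (snd (p m)) \<and>
        prob {\<omega> \<in> space M. \<delta> m < \<bar>Z \<omega> - fst (p m) \<omega>\<bar>} < \<delta> m" by blast
  define Y where "Y m = fst (p m)" for m
  define \<rho> where "\<rho> m = snd (p m)" for m
  have Y: "\<And>m. Y m \<in> borel_measurable M" "\<And>m. conv_root n (distr M borel (Y m)) (\<rho> m)"
      "\<And>m. prob {\<omega> \<in> space M. \<delta> m < \<bar>Z \<omega> - Y m \<omega>\<bar>} < \<delta> m"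
    using p by (auto simp: Y_def \<rho>_def)
  note [measurable] = Z Y(1)
  have \<rho>: "real_distribution (\<rho> m)" "char (\<rho> m) \<theta> ^ n = char (distr M borel (Y m)) \<theta>" for m \<theta>
    using Y(2)[of m] by (auto simp: conv_root_def)
  have char_lim: "(\<lambda>m. char (distr M borel (Y m)) \<theta>) \<longlonglongrightarrow> char (distr M borel Z) \<theta>" for \<theta>
  proof (rule LIM_zero_cancel, rule Lim_null_comparison)
    have "cmod (char (distr M borel (Y m)) \<theta> - char (distr M borel Z) \<theta>) \<le> \<bar>\<theta>\<bar> * \<delta> m + 2 * \<delta> m" for m
      using char_distr_diff_le[OF Z Y(1)[of m], of "\<delta> m" \<theta>] \<delta>(1)[of m] Y(3)[of m]
      by (simp add: norm_minus_commute)
    then show "\<forall>\<^sub>F m in sequentially. cmod (char (distr M borel (Y m)) \<theta> - char (distr M borel Z) \<theta>)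
        \<le> \<bar>\<theta>\<bar> * \<delta> m + 2 * \<delta> m" by simp
    show "(\<lambda>m. \<bar>\<theta>\<bar> * \<delta> m + 2 * \<delta> m) \<longlonglongrightarrow> 0"
      using tendsto_add[OF tendsto_mult_left[OF \<delta>0, of "\<bar>\<theta>\<bar>"] tendsto_mult_left[OF \<delta>0, of 2]] by simp
  qed
  \<comment> \<open>The finitely many indices that are not yet close to \<open>Z\<close> are handled by a maximum.\<close>
  have uniform_tail: "\<exists>K>0. \<forall>m. prob {\<omega> \<in> space M. K < \<bar>Y m \<omega>\<bar>} < \<epsilon>" if \<epsilon>: "0 < \<epsilon>" for \<epsilon>
  proof -
    obtain K0 where K0: "\<And>K'. K0 \<le> K' \<Longrightarrow> prob {\<omega> \<in> space M. K' < \<bar>Z \<omega>\<bar>} < \<epsilon> / 2"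
      using tail_small[OF Z, of "\<epsilon> / 2"] \<epsilon> by auto
    obtain m0 where m0: "\<And>m. m0 \<le> m \<Longrightarrow> \<delta> m < \<epsilon> / 2"
      using order_tendstoD(2)[OF \<delta>0, of "\<epsilon> / 2"] \<epsilon> by (auto simp: eventually_sequentially)
    obtain k where k: "\<And>m K'. k m \<le> K' \<Longrightarrow> prob {\<omega> \<in> space M. K' < \<bar>Y m \<omega>\<bar>} < \<epsilon>"
      using tail_small[OF Y(1) \<epsilon>] by metis
    define K where "K = Max ({1, K0 + 1} \<union> k ` {..m0})"
    have K: "1 \<le> K" "K0 + 1 \<le> K" "\<And>m. m \<le> m0 \<Longrightarrow> k m \<le> K"
      unfolding K_def by (intro Max_ge; simp)+
    have "prob {\<omega> \<in> space M. K < \<bar>Y m \<omega>\<bar>} < \<epsilon>" for m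
    proof (cases "m \<le> m0")
      case True
      then show ?thesis using K(3) k by blast
    next
      case False
      have "prob {\<omega> \<in> space M. K < \<bar>Y m \<omega>\<bar>}
          \<le> prob ({\<omega> \<in> space M. K - 1 < \<bar>Z \<omega>\<bar>} \<union> {\<omega> \<in> space M. \<delta> m < \<bar>Z \<omega> - Y m \<omega>\<bar>})"
      proof (rule finite_measure_mono)
        have "K - 1 < \<bar>Z \<omega>\<bar>" if "K < \<bar>Y m \<omega>\<bar>" "\<not> \<delta> m < \<bar>Z \<omega> - Y m \<omega>\<bar>" for \<omega>
          using that \<delta>(2)[of m] by linarith
        then show "{\<omega> \<in> space M. K < \<bar>Y m \<omega>\<bar>}
            \<subseteq> {\<omega> \<in> space M. K - 1 < \<bar>Z \<omega>\<bar>} \<union> {\<omega> \<in> space M. \<delta> m < \<bar>Z \<omega> - Y m \<omega>\<bar>}" by auto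
      qed measurable
      also have "\<dots> \<le> prob {\<omega> \<in> space M. K - 1 < \<bar>Z \<omega>\<bar>} + prob {\<omega> \<in> space M. \<delta> m < \<bar>Z \<omega> - Y m \<omega>\<bar>}"
        by (intro measure_Un_le) measurable
      also have "\<dots> < \<epsilon> / 2 + \<epsilon> / 2"
        using K0[of "K - 1"] K(2) Y(3)[of m] m0[of m] False by (intro add_strict_mono) auto
      finally show ?thesis by simp
    qed
    then show ?thesis using K(1) by (intro exI[of _ K]) auto
  qed
  have "tight \<rho>"
    unfolding tight_def
  proof (intro conjI allI impI \<rho>(1))
    fix \<epsilon> :: real assume \<epsilon>: "0 < \<epsilon>"
    obtain K where K: "0 < K" "\<And>m. prob {\<omega> \<in> space M. K < \<bar>Y m \<omega>\<bar>} < (\<epsilon> / 2) ^ n"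
      using uniform_tail[of "(\<epsilon> / 2) ^ n"] \<epsilon> by auto
    \<comment> \<open>If each of \<open>n\<close> summands exceeds \<open>K / n\<close>, then the sum exceeds \<open>K\<close>.\<close>
    define a where "a = K / n"
    have a: "0 < a" "real n * a = K" using K(1) n by (auto simp: a_def)
    have "1 - \<epsilon> < measure (\<rho> m) {-a-1<..a}" for m
    proof -
      interpret R: real_distribution "\<rho> m" by (rule \<rho>(1))
      have tail: "measure (\<rho> m) S < \<epsilon> / 2"
        if [measurable]: "S \<in> sets borel"
          and S: "\<And>x. (\<And>i. i < n \<Longrightarrow> x i \<in> S) \<Longrightarrow> K < \<bar>\<Sum>i<n. x i\<bar>" for S
      proof -
        have "measure (\<rho> m) S ^ n \<le> measure (distr M borel (Y m)) {x. K < \<bar>x\<bar>}"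
          using S by (intro conv_root_measure_power_le[OF _ Y(2)]) (auto simp: real_distribution_distr)
        also have "\<dots> = prob {\<omega> \<in> space M. K < \<bar>Y m \<omega>\<bar>}"
          by (subst measure_distr) (auto simp: vimage_def Int_def conj_commute)
        also have "\<dots> < (\<epsilon> / 2) ^ n" by (rule K(2))
        finally have "measure (\<rho> m) S ^ n < (\<epsilon> / 2) ^ n" .
        moreover have "0 \<le> \<epsilon> / 2" using \<epsilon> by simp
        ultimately show ?thesis by (rule power_less_imp_less_base)
      qed
      have "measure (\<rho> m) {a<..} < \<epsilon> / 2"
      proof (rule tail)
        fix x :: "nat \<Rightarrow> real" assume "\<And>i. i < n \<Longrightarrow> x i \<in> {a<..}"
        then have "(\<Sum>i<n. a) < (\<Sum>i<n. x i)" using n by (intro sum_strict_mono) (auto simp: lessThan_empty_iff)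
        then show "K < \<bar>\<Sum>i<n. x i\<bar>" using a by simp
      qed simp
      moreover have "measure (\<rho> m) {..<-a} < \<epsilon> / 2"
      proof (rule tail)
        fix x :: "nat \<Rightarrow> real" assume "\<And>i. i < n \<Longrightarrow> x i \<in> {..<-a}"
        then have "(\<Sum>i<n. x i) < (\<Sum>i<n. - a)" using n by (intro sum_strict_mono) (auto simp: lessThan_empty_iff)
        then show "K < \<bar>\<Sum>i<n. x i\<bar>" using a by (simp add: sum_negf)
      qed simp
      moreover have "1 \<le> measure (\<rho> m) {a<..} + measure (\<rho> m) {..<-a} + measure (\<rho> m) {-a-1<..a}"
      proof -
        have "1 = measure (\<rho> m) UNIV" using R.prob_space by simp
        also have "UNIV = {a<..} \<union> {..<-a} \<union> {-a-1<..a}" using a by auto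
        also have "measure (\<rho> m) \<dots> \<le> measure (\<rho> m) ({a<..} \<union> {..<-a}) + measure (\<rho> m) {-a-1<..a}"
          by (intro measure_Un_le) auto
        also have "measure (\<rho> m) ({a<..} \<union> {..<-a}) \<le> measure (\<rho> m) {a<..} + measure (\<rho> m) {..<-a}"
          by (intro measure_Un_le) auto
        finally show ?thesis by simp
      qed
      ultimately show ?thesis by simp
    qed
    then show "\<exists>a b. a < b \<and> (\<forall>m. 1 - \<epsilon> < measure (\<rho> m) {a<..b})"
      using a by (intro exI[of _ "-a-1"] exI[of _ a]) auto
  qed
  then obtain r R where r: "strict_mono (r :: nat \<Rightarrow> nat)" and R: "real_distribution R"
    and w: "weak_conv_m (\<rho> \<circ> id \<circ> r) R"
    using tight_imp_convergent_subsubsequence[of \<rho> id] by (auto simp: strict_mono_id)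
  have "char R \<theta> ^ n = char (distr M borel Z) \<theta>" for \<theta>
  proof (rule LIMSEQ_unique)
    have "(\<lambda>m. char ((\<rho> \<circ> id \<circ> r) m) \<theta>) \<longlonglongrightarrow> char R \<theta>"
      by (rule levy_continuity1[OF _ R w]) (simp add: \<rho>(1))
    then show "(\<lambda>m. char (\<rho> (r m)) \<theta> ^ n) \<longlonglongrightarrow> char R \<theta> ^ n"
      by (intro tendsto_power) simp
    show "(\<lambda>m. char (\<rho> (r m)) \<theta> ^ n) \<longlonglongrightarrow> char (distr M borel Z) \<theta>"
      unfolding \<rho>(2) using LIMSEQ_subseq_LIMSEQ[OF char_lim r] by (simp add: comp_def)
  qed
  then show ?thesis using R by (auto simp: conv_root_def)
qed

section \<open>Limits of linear combinations of a Levy basis\<close>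

text \<open>The closure in probability of the linear span of the values of a random measure.  It contains the
  integrals of deterministic functions, it is stable under sums, multiples and limits, and for a Levy
  basis its members have infinitely divisible laws.  Membership of a mixture of such integrals thus
  takes the place of a Fubini theorem that would rewrite the mixture as one integral.\<close>

definition approx_linear :: "'w measure \<Rightarrow> 'z measure \<Rightarrow> ('z set \<Rightarrow> 'w \<Rightarrow> real) \<Rightarrow> ('w \<Rightarrow> real) \<Rightarrow> bool" where
  "approx_linear M N L Z \<longleftrightarrow> Z \<in> borel_measurable M \<and>
     (\<forall>e>0. \<exists>\<A> c. finite \<A> \<and> \<A> \<subseteq> fmeasurable N \<and>
        measure M {\<omega> \<in> space M. e < \<bar>Z \<omega> - (\<Sum>A\<in>\<A>. c A * L A \<omega>)\<bar>} < e)"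

lemma (in prob_space) prob_triangle_le:
  fixes f g h :: "'a \<Rightarrow> real"
  assumes [measurable]: "f \<in> borel_measurable M" "g \<in> borel_measurable M" "h \<in> borel_measurable M"
  shows "prob {\<omega> \<in> space M. a + b < \<bar>f \<omega> - h \<omega>\<bar>}
    \<le> prob {\<omega> \<in> space M. a < \<bar>f \<omega> - g \<omega>\<bar>} + prob {\<omega> \<in> space M. b < \<bar>g \<omega> - h \<omega>\<bar>}"
proof -
  have "prob {\<omega> \<in> space M. a + b < \<bar>f \<omega> - h \<omega>\<bar>}
    \<le> prob ({\<omega> \<in> space M. a < \<bar>f \<omega> - g \<omega>\<bar>} \<union> {\<omega> \<in> space M. b < \<bar>g \<omega> - h \<omega>\<bar>})"
  proof (rule finite_measure_mono)
    have "a < \<bar>f \<omega> - g \<omega>\<bar> \<or> b < \<bar>g \<omega> - h \<omega>\<bar>" if "a + b < \<bar>f \<omega> - h \<omega>\<bar>" for \<omega>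
      using that by linarith
    then show "{\<omega> \<in> space M. a + b < \<bar>f \<omega> - h \<omega>\<bar>}
        \<subseteq> {\<omega> \<in> space M. a < \<bar>f \<omega> - g \<omega>\<bar>} \<union> {\<omega> \<in> space M. b < \<bar>g \<omega> - h \<omega>\<bar>}" by auto
  qed measurable
  also have "\<dots> \<le> prob {\<omega> \<in> space M. a < \<bar>f \<omega> - g \<omega>\<bar>} + prob {\<omega> \<in> space M. b < \<bar>g \<omega> - h \<omega>\<bar>}"
    by (intro measure_Un_le) auto
  finally show ?thesis .
qed

lemma linear_combination_measurable:
  assumes "independently_scattered M N L" "\<A> \<subseteq> fmeasurable N"
  shows "(\<lambda>\<omega>. \<Sum>A\<in>\<A>. c A * L A \<omega>) \<in> borel_measurable M"
  using scattered_measurable[OF assms(1)] assms(2) by (intro borel_measurable_sum) auto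

lemma approx_linear_limit:
  assumes M: "prob_space M" and L: "independently_scattered M N L" and Z: "Z \<in> borel_measurable M"
    and approx: "\<And>e. 0 < e \<Longrightarrow> \<exists>Y. approx_linear M N L Y \<and> measure M {\<omega> \<in> space M. e < \<bar>Z \<omega> - Y \<omega>\<bar>} < e"
  shows "approx_linear M N L Z"
  unfolding approx_linear_def
proof (intro conjI allI impI Z)
  interpret prob_space M by fact
  fix e :: real assume e: "0 < e"
  obtain Y where Y: "approx_linear M N L Y" "prob {\<omega> \<in> space M. e / 2 < \<bar>Z \<omega> - Y \<omega>\<bar>} < e / 2"
    using approx[of "e / 2"] e by auto
  obtain \<A> c where A: "finite \<A>" "\<A> \<subseteq> fmeasurable N"
    "prob {\<omega> \<in> space M. e / 2 < \<bar>Y \<omega> - (\<Sum>A\<in>\<A>. c A * L A \<omega>)\<bar>} < e / 2"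
    using Y(1) e unfolding approx_linear_def by (meson half_gt_zero)
  have "prob {\<omega> \<in> space M. e / 2 + e / 2 < \<bar>Z \<omega> - (\<Sum>A\<in>\<A>. c A * L A \<omega>)\<bar>} < e / 2 + e / 2"
    using Y A Z linear_combination_measurable[OF L A(2)]
    by (intro le_less_trans[OF prob_triangle_le[of Z Y] add_strict_mono]) (auto simp: approx_linear_def)
  then show "\<exists>\<A> c. finite \<A> \<and> \<A> \<subseteq> fmeasurable N \<and>
        prob {\<omega> \<in> space M. e < \<bar>Z \<omega> - (\<Sum>A\<in>\<A>. c A * L A \<omega>)\<bar>} < e"
    using A by auto
qed

lemma approx_linear_zero:
  "prob_space M \<Longrightarrow> approx_linear M N L (\<lambda>_. 0)"
  unfolding approx_linear_def by (intro conjI allI impI exI[of _ "{}"]) auto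

lemma approx_linear_add:
  assumes M: "prob_space M" and L: "independently_scattered M N L"
    and Y: "approx_linear M N L Y" and Z: "approx_linear M N L Z"
  shows "approx_linear M N L (\<lambda>\<omega>. Y \<omega> + Z \<omega>)"
  unfolding approx_linear_def
proof (intro conjI allI impI)
  interpret prob_space M by fact
  have [measurable]: "Y \<in> borel_measurable M" "Z \<in> borel_measurable M"
    using Y Z by (auto simp: approx_linear_def)
  show "(\<lambda>\<omega>. Y \<omega> + Z \<omega>) \<in> borel_measurable M" by measurable
  fix e :: real assume e: "0 < e"
  then have e2: "0 < e / 2" by simp
  obtain \<A> c where A: "finite \<A>" "\<A> \<subseteq> fmeasurable N"
    "prob {\<omega> \<in> space M. e / 2 < \<bar>Y \<omega> - (\<Sum>A\<in>\<A>. c A * L A \<omega>)\<bar>} < e / 2"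
    using Y e2 unfolding approx_linear_def by blast
  obtain \<B> d where B: "finite \<B>" "\<B> \<subseteq> fmeasurable N"
    "prob {\<omega> \<in> space M. e / 2 < \<bar>Z \<omega> - (\<Sum>A\<in>\<B>. d A * L A \<omega>)\<bar>} < e / 2"
    using Z e2 unfolding approx_linear_def by blast
  define S where "S \<omega> = (\<Sum>A\<in>\<A>. c A * L A \<omega>)" for \<omega>
  define T where "T \<omega> = (\<Sum>A\<in>\<B>. d A * L A \<omega>)" for \<omega>
  have [measurable]: "S \<in> borel_measurable M" "T \<in> borel_measurable M"
    unfolding S_def T_def using A B L by (auto intro: linear_combination_measurable)
  define b where "b A = (if A \<in> \<A> then c A else 0) + (if A \<in> \<B> then d A else 0)" for A
  have b: "(\<Sum>A\<in>\<A> \<union> \<B>. b A * L A \<omega>) = S \<omega> + T \<omega>" for \<omega>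
  proof -
    have "(\<Sum>A\<in>\<A> \<union> \<B>. b A * L A \<omega>) = (\<Sum>A\<in>\<A> \<union> \<B>. if A \<in> \<A> then c A * L A \<omega> else 0)
        + (\<Sum>A\<in>\<A> \<union> \<B>. if A \<in> \<B> then d A * L A \<omega> else 0)"
      unfolding sum.distrib[symmetric] b_def by (intro sum.cong) (auto simp: distrib_right)
    also have "(\<Sum>A\<in>\<A> \<union> \<B>. if A \<in> \<A> then c A * L A \<omega> else 0) = S \<omega>"
      unfolding S_def using A B by (intro sum.mono_neutral_cong_right) auto
    also have "(\<Sum>A\<in>\<A> \<union> \<B>. if A \<in> \<B> then d A * L A \<omega> else 0) = T \<omega>"
      unfolding T_def using A B by (intro sum.mono_neutral_cong_right) auto
    finally show ?thesis .
  qed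
  have "prob {\<omega> \<in> space M. e / 2 + e / 2 < \<bar>(Y \<omega> + Z \<omega>) - (S \<omega> + T \<omega>)\<bar>}
    \<le> prob {\<omega> \<in> space M. e / 2 < \<bar>(Y \<omega> + Z \<omega>) - (S \<omega> + Z \<omega>)\<bar>}
      + prob {\<omega> \<in> space M. e / 2 < \<bar>(S \<omega> + Z \<omega>) - (S \<omega> + T \<omega>)\<bar>}"
    by (rule prob_triangle_le) measurable
  also have "\<dots> < e / 2 + e / 2"
    using A(3) B(3) by (intro add_strict_mono) (simp_all add: S_def T_def)
  finally show "\<exists>\<A> c. finite \<A> \<and> \<A> \<subseteq> fmeasurable N \<and>
        prob {\<omega> \<in> space M. e < \<bar>Y \<omega> + Z \<omega> - (\<Sum>A\<in>\<A>. c A * L A \<omega>)\<bar>} < e"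
    using A B by (intro exI[of _ "\<A> \<union> \<B>"] exI[of _ b]) (simp add: b)
qed

lemma approx_linear_scale:
  assumes M: "prob_space M" and L: "independently_scattered M N L" and Z: "approx_linear M N L Z"
  shows "approx_linear M N L (\<lambda>\<omega>. r * Z \<omega>)"
  unfolding approx_linear_def
proof (intro conjI allI impI)
  interpret prob_space M by fact
  show "(\<lambda>\<omega>. r * Z \<omega>) \<in> borel_measurable M" using Z by (auto simp: approx_linear_def)
  fix e :: real assume e: "0 < e"
  define \<delta> where "\<delta> = e / (1 + \<bar>r\<bar>)"
  have \<delta>: "0 < \<delta>" "\<delta> \<le> e" "\<bar>r\<bar> * \<delta> \<le> e"
    using e by (auto simp: \<delta>_def field_simps intro!: mult_nonneg_nonneg)
  obtain \<A> c where A: "finite \<A>" "\<A> \<subseteq> fmeasurable N"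
    "prob {\<omega> \<in> space M. \<delta> < \<bar>Z \<omega> - (\<Sum>A\<in>\<A>. c A * L A \<omega>)\<bar>} < \<delta>"
    using Z \<delta>(1) unfolding approx_linear_def by blast
  show "\<exists>\<A> c. finite \<A> \<and> \<A> \<subseteq> fmeasurable N \<and>
        prob {\<omega> \<in> space M. e < \<bar>r * Z \<omega> - (\<Sum>A\<in>\<A>. c A * L A \<omega>)\<bar>} < e"
  proof (intro exI[of _ \<A>] exI[of _ "\<lambda>A. r * c A"] conjI A)
    show "prob {\<omega> \<in> space M. e < \<bar>r * Z \<omega> - (\<Sum>A\<in>\<A>. r * c A * L A \<omega>)\<bar>} < e"
    proof (rule le_less_trans[OF finite_measure_mono])
      have "e < \<bar>r * Z \<omega> - (\<Sum>A\<in>\<A>. r * c A * L A \<omega>)\<bar> \<Longrightarrow> \<delta> < \<bar>Z \<omega> - (\<Sum>A\<in>\<A>. c A * L A \<omega>)\<bar>" for \<omega>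
      proof (rule ccontr)
        assume *: "e < \<bar>r * Z \<omega> - (\<Sum>A\<in>\<A>. r * c A * L A \<omega>)\<bar>" "\<not> \<delta> < \<bar>Z \<omega> - (\<Sum>A\<in>\<A>. c A * L A \<omega>)\<bar>"
        have "r * Z \<omega> - (\<Sum>A\<in>\<A>. r * c A * L A \<omega>) = r * (Z \<omega> - (\<Sum>A\<in>\<A>. c A * L A \<omega>))"
          by (simp add: right_diff_distrib sum_distrib_left mult.assoc)
        then have "\<bar>r * Z \<omega> - (\<Sum>A\<in>\<A>. r * c A * L A \<omega>)\<bar> \<le> \<bar>r\<bar> * \<delta>"
          using *(2) by (simp add: abs_mult mult_left_mono)
        then show False using \<delta>(3) *(1) by simp
      qed
      then show "{\<omega> \<in> space M. e < \<bar>r * Z \<omega> - (\<Sum>A\<in>\<A>. r * c A * L A \<omega>)\<bar>}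
          \<subseteq> {\<omega> \<in> space M. \<delta> < \<bar>Z \<omega> - (\<Sum>A\<in>\<A>. c A * L A \<omega>)\<bar>}" by auto
      have [measurable]: "Z \<in> borel_measurable M" "(\<lambda>\<omega>. \<Sum>A\<in>\<A>. c A * L A \<omega>) \<in> borel_measurable M"
        using Z linear_combination_measurable[OF L A(2)] by (auto simp: approx_linear_def)
      show "{\<omega> \<in> space M. \<delta> < \<bar>Z \<omega> - (\<Sum>A\<in>\<A>. c A * L A \<omega>)\<bar>} \<in> events" by measurable
      show "prob {\<omega> \<in> space M. \<delta> < \<bar>Z \<omega> - (\<Sum>A\<in>\<A>. c A * L A \<omega>)\<bar>} < e" using A(3) \<delta>(2) by simp
    qed
  qed
qed

lemma rr_integral_approx_linear:
  assumes M: "prob_space M" and L: "independently_scattered M N L" and I: "rr_integral M N L f I"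
  shows "approx_linear M N L I"
proof -
  interpret prob_space M by fact
  have I': "I \<in> borel_measurable M" using I by (simp add: rr_integral_def)
  obtain n :: "nat \<Rightarrow> nat" and c A
    where "\<forall>m. disjoint_family_on (A m) {..<n m} \<and> (\<forall>j<n m. A m j \<in> fmeasurable N)"
      and lim: "tendsto_in_probability M (\<lambda>m \<omega>. \<Sum>j<n m. c m j * L (A m j) \<omega>) I"
    using I unfolding rr_integral_def by (elim conjE exE) (rule that, assumption+)
  then have A: "\<And>m j. j < n m \<Longrightarrow> A m j \<in> fmeasurable N" by blast
  show ?thesis
    unfolding approx_linear_def
  proof (intro conjI allI impI I')
    fix e :: real assume e: "0 < e"
    then have "(\<lambda>m. prob {\<omega> \<in> space M. e < \<bar>(\<Sum>j<n m. c m j * L (A m j) \<omega>) - I \<omega>\<bar>}) \<longlonglongrightarrow> 0"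
      using lim by (auto simp: tendsto_in_probability_def)
    from order_tendstoD(2)[OF this e] obtain m
      where m: "prob {\<omega> \<in> space M. e < \<bar>(\<Sum>j<n m. c m j * L (A m j) \<omega>) - I \<omega>\<bar>} < e"
      using eventually_happens'[OF sequentially_bot] by blast
    \<comment> \<open>Several of the disjoint pieces may be empty and hence equal, so coefficients are collected.\<close>
    define b where "b B = (\<Sum>j\<in>{j\<in>{..<n m}. A m j = B}. c m j)" for B
    have "(\<Sum>j<n m. c m j * L (A m j) \<omega>) = (\<Sum>B\<in>A m ` {..<n m}. b B * L B \<omega>)" for \<omega>
    proof -
      have "(\<Sum>j<n m. c m j * L (A m j) \<omega>)
          = (\<Sum>B\<in>A m ` {..<n m}. \<Sum>j\<in>{j\<in>{..<n m}. A m j = B}. c m j * L (A m j) \<omega>)"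
        by (rule sum.image_gen) simp
      also have "\<dots> = (\<Sum>B\<in>A m ` {..<n m}. b B * L B \<omega>)"
        unfolding b_def sum_distrib_right by (intro sum.cong) auto
      finally show ?thesis .
    qed
    with m A show "\<exists>\<A> c. finite \<A> \<and> \<A> \<subseteq> fmeasurable N \<and>
        prob {\<omega> \<in> space M. e < \<bar>I \<omega> - (\<Sum>A\<in>\<A>. c A * L A \<omega>)\<bar>} < e"
      by (intro exI[of _ "A m ` {..<n m}"] exI[of _ b]) (auto simp: abs_minus_commute)
  qed
qed

text \<open>By homogeneity the law of \<open>L A\<close> depends on \<open>N A\<close> only, and its characteristic function is an
  exponential in \<open>N A\<close>.  So the values over a set of measure \<open>N A / n\<close> provide an \<open>n\<close>-th
  convolution root.\<close>

lemma levy_basis_conv_root: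
  assumes M: "prob_space M" and L: "levy_basis M N \<nu> L"
    and sets: "\<And>v. 0 \<le> v \<Longrightarrow> \<exists>D\<in>fmeasurable N. measure N D = v"
    and fin: "finite \<A>" and A: "\<A> \<subseteq> fmeasurable N" and n: "1 \<le> n"
  shows "\<exists>\<rho>. conv_root n (distr M borel (\<lambda>\<omega>. \<Sum>A\<in>\<A>. c A * L A \<omega>)) \<rho>"
proof -
  interpret prob_space M by fact
  have scat: "independently_scattered M N L" using L by (simp add: levy_basis_def)
  define \<Psi> where "\<Psi> \<theta> = (CLINT w|\<nu>. iexp (\<theta> * w) - 1)" for \<theta>
  have char_L: "char (distr M borel (L A)) \<theta> = exp (complex_of_real (measure N A) * \<Psi> \<theta>)"
    if "A \<in> fmeasurable N" for A \<theta>
    using L that by (simp add: levy_basis_def \<Psi>_def)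
  define d where "d S = (\<Sum>A\<in>S. c A)" for S
  have atom: "atom \<A> S \<in> fmeasurable N" if "S \<in> Pow \<A>" for S
    using that by (intro atom_fmeasurable fin A) auto
  have "\<forall>S. \<exists>D. D \<in> fmeasurable N \<and> measure N D = measure N (atom \<A> S) / n"
    using sets by (auto simp: Bex_def)
  from choice[OF this] obtain D where D: "\<And>S. D S \<in> fmeasurable N"
      "\<And>S. measure N (D S) = measure N (atom \<A> S) / n"
    by blast
  note [measurable] = scattered_measurable[OF scat D(1)]
  define \<rho> where "\<rho> S = distr M borel (\<lambda>\<omega>. d S * L (D S) \<omega>)" for S
  have \<rho>: "real_distribution (\<rho> S)" for S
    unfolding \<rho>_def by (rule real_distribution_distr) measurable
  have char_\<rho>: "char (\<rho> S) \<theta> = exp (complex_of_real (measure N (atom \<A> S) / n) * \<Psi> (d S * \<theta>))" for S \<theta>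
    unfolding \<rho>_def by (subst char_distr_scale) (simp_all add: char_L D)
  define R where "R = distr (PiM (Pow \<A>) \<rho>) borel (\<lambda>x. \<Sum>S\<in>Pow \<A>. x S)"
  have "conv_root n (distr M borel (\<lambda>\<omega>. \<Sum>A\<in>\<A>. c A * L A \<omega>)) R"
    unfolding conv_root_def
  proof (intro conjI allI)
    show "real_distribution R"
      unfolding R_def using fin \<rho> by (intro real_distribution_sum_PiM) auto
    fix \<theta>
    have "distr M borel (\<lambda>\<omega>. \<Sum>A\<in>\<A>. c A * L A \<omega>) = distr M borel (\<lambda>\<omega>. \<Sum>S\<in>Pow \<A>. d S * L (atom \<A> S) \<omega>)"
      using scattered_linear_combination_atoms[OF M scat fin A, of c] scattered_measurable[OF scat] atom A
      by (intro distr_cong_AE) (auto simp: d_def intro!: borel_measurable_sum)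
    also have "char \<dots> \<theta> = (\<Prod>S\<in>Pow \<A>. char (distr M borel (\<lambda>\<omega>. d S * L (atom \<A> S) \<omega>)) \<theta>)"
    proof (rule char_distr_sum)
      have "indep_vars (\<lambda>_. borel) (\<lambda>S. L (atom \<A> S)) (Pow \<A>)"
        using fin atom by (intro scattered_indep_vars[OF M scat] atom_disjoint) auto
      then show "indep_vars (\<lambda>_. borel) (\<lambda>S \<omega>. d S * L (atom \<A> S) \<omega>) (Pow \<A>)"
        by (rule indep_vars_compose2) simp
    qed
    also have "\<dots> = (\<Prod>S\<in>Pow \<A>. char (\<rho> S) \<theta> ^ n)"
    proof (rule prod.cong[OF refl])
      fix S assume S: "S \<in> Pow \<A>"
      have "char (distr M borel (\<lambda>\<omega>. d S * L (atom \<A> S) \<omega>)) \<theta>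
          = exp (complex_of_real (measure N (atom \<A> S)) * \<Psi> (d S * \<theta>))"
        using S scattered_measurable[OF scat] by (subst char_distr_scale) (simp_all add: char_L atom)
      also have "\<dots> = char (\<rho> S) \<theta> ^ n"
        using n by (simp add: char_\<rho> flip: exp_of_nat_mult)
      finally show "char (distr M borel (\<lambda>\<omega>. d S * L (atom \<A> S) \<omega>)) \<theta> = char (\<rho> S) \<theta> ^ n" .
    qed
    also have "\<dots> = char R \<theta> ^ n"
      unfolding R_def using fin \<rho> by (subst char_sum_PiM) (auto simp: prod_power_distrib)
    finally show "char R \<theta> ^ n = char (distr M borel (\<lambda>\<omega>. \<Sum>A\<in>\<A>. c A * L A \<omega>)) \<theta>" by simp
  qed
  then show ?thesis by blast
qed

lemma approx_linear_infinitely_divisible: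
  assumes M: "prob_space M" and L: "levy_basis M N \<nu> L"
    and sets: "\<And>v. 0 \<le> v \<Longrightarrow> \<exists>D\<in>fmeasurable N. measure N D = v"
    and Z: "approx_linear M N L Z"
  shows "infinitely_divisible (distr M borel Z)"
proof (rule infinitely_divisibleI)
  interpret prob_space M by fact
  have scat: "independently_scattered M N L" using L by (simp add: levy_basis_def)
  have Zm: "Z \<in> borel_measurable M" using Z by (simp add: approx_linear_def)
  then show "real_distribution (distr M borel Z)" by (rule real_distribution_distr)
  fix n :: nat assume n: "1 \<le> n"
  show "\<exists>\<rho>. conv_root n (distr M borel Z) \<rho>"
  proof (rule conv_root_limit[OF Zm _ n])
    fix e :: real assume e: "0 < e"
    obtain \<A> c where A: "finite \<A>" "\<A> \<subseteq> fmeasurable N"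
      "prob {\<omega> \<in> space M. e < \<bar>Z \<omega> - (\<Sum>A\<in>\<A>. c A * L A \<omega>)\<bar>} < e"
      using Z e unfolding approx_linear_def by blast
    then show "\<exists>Y \<rho>. Y \<in> borel_measurable M \<and> conv_root n (distr M borel Y) \<rho> \<and>
        prob {\<omega> \<in> space M. e < \<bar>Z \<omega> - Y \<omega>\<bar>} < e"
      using linear_combination_measurable[OF scat A(2)] levy_basis_conv_root[OF M L sets A(1,2) n]
      by blast
  qed
qed

text \<open>In the presence of Lebesgue measure, sets of every prescribed measure exist, as needed for the roots
  above.\<close>

lemma box_measure_exists:
  fixes p :: "'y measure" and i :: "'d::finite"
  assumes p: "prob_space p" and v: "0 \<le> v"
  shows "\<exists>D\<in>fmeasurable (p \<Otimes>\<^sub>M (lborel :: (real ^ 'd) measure)). measure (p \<Otimes>\<^sub>M lborel) D = v"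
proof -
  interpret prob_space p by fact
  define b :: "real ^ 'd" where "b = (\<chi> j. if j = i then v else 1)"
  have "emeasure (p \<Otimes>\<^sub>M lborel) (space p \<times> cbox 0 b) = emeasure p (space p) * emeasure lborel (cbox 0 b)"
    by (rule lborel.emeasure_pair_measure_Times) auto
  also have "emeasure lborel (cbox 0 b) = ennreal v"
  proof -
    have "measure lborel (cbox 0 b) = (\<Prod>j\<in>UNIV. b $ j)"
      using v by (subst content_cbox_cart) (auto simp: b_def interval_eq_empty_cart)
    also have "\<dots> = v" by (simp add: b_def)
    finally show ?thesis using emeasure_lborel_cbox_finite[of 0 b] by (subst emeasure_eq_ennreal_measure) auto
  qed
  finally have "emeasure (p \<Otimes>\<^sub>M lborel) (space p \<times> cbox 0 b) = ennreal v" by (simp add: emeasure_space_1)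
  then show ?thesis using v
    by (intro bexI[of _ "space p \<times> cbox 0 b"] fmeasurableI) (auto simp: measure_def)
qed

section \<open>Gaussian bases and the isometry of adapted integrals\<close>

lemma gaussian_basis_law:
  assumes M: "prob_space M" and W: "gaussian_basis M N W" and A: "A \<in> fmeasurable N"
  shows "distr M borel (W A) = distr std_normal_distribution borel (\<lambda>x. sqrt (measure N A) * x)"
proof (rule Levy_uniqueness)
  have WA: "W A \<in> borel_measurable M"
    using W A by (auto simp: gaussian_basis_def intro: scattered_measurable)
  show "real_distribution (distr M borel (W A))"
    using WA by (rule prob_space.real_distribution_distr[OF M])
  interpret S: real_distribution std_normal_distribution by (rule real_dist_normal_dist)
  show "real_distribution (distr std_normal_distribution borel (\<lambda>x. sqrt (measure N A) * x))"
    by (intro S.real_distribution_distr) simp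
  have "char (distr std_normal_distribution borel (\<lambda>x. sqrt (measure N A) * x)) \<theta>
      = exp (- ((sqrt (measure N A) * \<theta>)\<^sup>2) / 2)" for \<theta>
    by (subst char_distr_scale[where Z = "\<lambda>x. x"])
       (simp_all add: char_std_normal_distribution distr_id2)
  moreover have "char (distr M borel (W A)) \<theta> = exp (complex_of_real (- (\<theta>\<^sup>2 / 2) * measure N A))" for \<theta>
    using W A by (simp add: gaussian_basis_def)
  ultimately show "char (distr M borel (W A)) = char (distr std_normal_distribution borel (\<lambda>x. sqrt (measure N A) * x))"
    unfolding exp_of_real by (simp add: fun_eq_iff power_mult_distrib mult_ac)
qed

lemma gaussian_basis_moments:
  assumes M: "prob_space M" and W: "gaussian_basis M N W" and A: "A \<in> fmeasurable N"
  shows gaussian_integrable: "integrable M (W A)"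
    and gaussian_mean: "(LINT \<omega>|M. W A \<omega>) = 0"
    and gaussian_square_integrable: "integrable M (\<lambda>\<omega>. (W A \<omega>)\<^sup>2)"
    and gaussian_variance: "(LINT \<omega>|M. (W A \<omega>)\<^sup>2) = measure N A"
proof -
  have WA: "W A \<in> borel_measurable M"
    using W A by (auto simp: gaussian_basis_def intro: scattered_measurable)
  note law = gaussian_basis_law[OF M W A]
  have moment: "integrable M (\<lambda>\<omega>. W A \<omega> ^ k)"
      "(LINT \<omega>|M. W A \<omega> ^ k) = sqrt (measure N A) ^ k * (LINT x|std_normal_distribution. x ^ k)" for k
  proof -
    have "integrable (distr M borel (W A)) (\<lambda>x. x ^ k)"
      unfolding law by (subst integrable_distr_eq) (auto simp: power_mult_distrib integrable_std_normal_distribution_moment)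
    then show "integrable M (\<lambda>\<omega>. W A \<omega> ^ k)"
      using WA by (subst (asm) integrable_distr_eq) auto
    have "(LINT \<omega>|M. W A \<omega> ^ k) = (LINT x|distr M borel (W A). x ^ k)"
      using WA by (intro integral_distr[symmetric]) auto
    also have "\<dots> = sqrt (measure N A) ^ k * (LINT x|std_normal_distribution. x ^ k)"
      unfolding law by (subst integral_distr) (auto simp: power_mult_distrib)
    finally show "(LINT \<omega>|M. W A \<omega> ^ k) = sqrt (measure N A) ^ k * (LINT x|std_normal_distribution. x ^ k)" .
  qed
  show "integrable M (W A)" using moment(1)[of 1] by simp
  show "(LINT \<omega>|M. W A \<omega>) = 0"
    using moment(2)[of 1] integral_std_normal_distribution_moment_odd[of 1] by simp
  show "integrable M (\<lambda>\<omega>. (W A \<omega>)\<^sup>2)" by (rule moment(1))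
  show "(LINT \<omega>|M. (W A \<omega>)\<^sup>2) = measure N A"
    using moment(2)[of 2] std_normal_distribution_even_moments(1)[of 1] by simp
qed

lemma integrable_mult_of_squares:
  fixes f g :: "'a \<Rightarrow> real"
  assumes [measurable]: "f \<in> borel_measurable M" "g \<in> borel_measurable M"
    and "integrable M (\<lambda>x. (f x)\<^sup>2)" "integrable M (\<lambda>x. (g x)\<^sup>2)"
  shows "integrable M (\<lambda>x. f x * g x)"
proof (rule Bochner_Integration.integrable_bound)
  show "integrable M (\<lambda>x. (f x)\<^sup>2 + (g x)\<^sup>2)" using assms by simp
  have "norm (f x * g x) \<le> norm ((f x)\<^sup>2 + (g x)\<^sup>2)" for x
  proof -
    have "2 * \<bar>f x * g x\<bar> \<le> (f x)\<^sup>2 + (g x)\<^sup>2"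
      using sum_squares_bound[of "\<bar>f x\<bar>" "\<bar>g x\<bar>"] by (simp add: abs_mult)
    then show ?thesis by simp
  qed
  then show "AE x in M. norm (f x * g x) \<le> norm ((f x)\<^sup>2 + (g x)\<^sup>2)" by simp
qed measurable

text \<open>Split both sets along their intersection.  Of the four products only the square over the common
  part has a nonzero mean, since values over disjoint sets are independent and centred.\<close>

lemma gaussian_product:
  assumes M: "prob_space M" and W: "gaussian_basis M N W"
    and A: "A \<in> fmeasurable N" and B: "B \<in> fmeasurable N"
  shows gaussian_product_integrable: "integrable M (\<lambda>\<omega>. W A \<omega> * W B \<omega>)"
    and gaussian_covariance: "(LINT \<omega>|M. W A \<omega> * W B \<omega>) = measure N (A \<inter> B)"
proof -
  interpret prob_space M by fact
  have scat: "independently_scattered M N W" using W by (simp add: gaussian_basis_def)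
  note meas [measurable] = scattered_measurable[OF scat]
  have int: "integrable M (\<lambda>\<omega>. W A \<omega> * W B \<omega>)" if "A \<in> fmeasurable N" "B \<in> fmeasurable N" for A B
    using that gaussian_square_integrable[OF M W] meas by (intro integrable_mult_of_squares) auto
  then show "integrable M (\<lambda>\<omega>. W A \<omega> * W B \<omega>)" using A B by simp
  have orth: "(LINT \<omega>|M. W A \<omega> * W B \<omega>) = 0"
    if "A \<in> fmeasurable N" "B \<in> fmeasurable N" "A \<inter> B = {}" for A B
    using that by (subst indep_var_lebesgue_integral[OF scattered_indep_var[OF M scat]])
      (auto simp: gaussian_mean[OF M W] gaussian_integrable[OF M W])
  define C where "C = A \<inter> B"
  have C: "C \<in> fmeasurable N" "A - C \<in> fmeasurable N" "B - C \<in> fmeasurable N"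
    using A B by (auto simp: C_def intro: fmeasurable_Diff)
  have "AE \<omega> in M. W (C \<union> (A - C)) \<omega> = W C \<omega> + W (A - C) \<omega>"
    and "AE \<omega> in M. W (C \<union> (B - C)) \<omega> = W C \<omega> + W (B - C) \<omega>"
    using C by (intro scattered_add[OF M scat]; auto)+
  moreover have "C \<union> (A - C) = A" "C \<union> (B - C) = B" by (auto simp: C_def)
  ultimately have "AE \<omega> in M. W A \<omega> * W B \<omega> = (W C \<omega>)\<^sup>2 + W C \<omega> * W (B - C) \<omega> + W (A - C) \<omega> * W C \<omega> + W (A - C) \<omega> * W (B - C) \<omega>"
    by (auto simp: algebra_simps power2_eq_square)
  then have "(LINT \<omega>|M. W A \<omega> * W B \<omega>) = (LINT \<omega>|M. (W C \<omega>)\<^sup>2 + W C \<omega> * W (B - C) \<omega> + W (A - C) \<omega> * W C \<omega> + W (A - C) \<omega> * W (B - C) \<omega>)"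
    using A B C meas by (intro integral_cong_AE) auto
  also have "\<dots> = measure N C"
  proof -
    have "(LINT \<omega>|M. W C \<omega> * W (B - C) \<omega>) = 0" "(LINT \<omega>|M. W (A - C) \<omega> * W C \<omega>) = 0"
      "(LINT \<omega>|M. W (A - C) \<omega> * W (B - C) \<omega>) = 0"
      using C by (intro orth; auto simp: C_def)+
    then show ?thesis
      using C int gaussian_square_integrable[OF M W C(1)] by (simp add: gaussian_variance[OF M W])
  qed
  finally show "(LINT \<omega>|M. W A \<omega> * W B \<omega>) = measure N (A \<inter> B)" by (simp add: C_def)
qed

lemma (in prob_space) indep_var_of_indep_set:
  assumes ind: "indep_set (sets \<G>) (sets \<H>)"
    and sub: "subalgebra M \<G>" "subalgebra M \<H>"
    and Y: "Y \<in> measurable \<G> S" and Z: "Z \<in> measurable \<H> T"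
  shows "indep_var S Y T Z"
proof -
  have sp: "space \<G> = space M" "space \<H> = space M" using sub by (auto simp: subalgebra_def)
  have "Y \<in> measurable M S" "Z \<in> measurable M T"
    using Y Z sub by (auto intro: measurable_from_subalg)
  moreover have "sigma_sets (space M) {Y -` A \<inter> space M |A. A \<in> sets S} \<subseteq> sets \<G>"
    using measurable_sets[OF Y] by (auto simp: sp[symmetric] intro!: sets.sigma_sets_subset)
  moreover have "sigma_sets (space M) {Z -` A \<inter> space M |A. A \<in> sets T} \<subseteq> sets \<H>"
    unfolding sp(2)[symmetric] using measurable_sets[OF Z] by (auto intro!: sets.sigma_sets_subset)
  moreover have "indep_set (sigma_sets (space M) {Y -` A \<inter> space M |A. A \<in> sets S})
      (sigma_sets (space M) {Z -` A \<inter> space M |A. A \<in> sets T})"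
    unfolding indep_set_def
  proof (rule indep_sets_mono_sets[OF ind[unfolded indep_set_def]])
    fix b
    show "case_bool (sigma_sets (space M) {Y -` A \<inter> space M |A. A \<in> sets S})
        (sigma_sets (space M) {Z -` A \<inter> space M |A. A \<in> sets T}) b \<subseteq> case_bool (sets \<G>) (sets \<H>) b"
      using calculation(3,4) by (cases b) simp_all
  qed
  ultimately show ?thesis unfolding indep_var_eq by blast
qed

text \<open>The \<open>\<sigma>\<close>-algebra with the events \<open>generated_events\<close>, as a measure, so that measurability of
  functions can be stated.\<close>

definition generated_algebra :: "'w measure \<Rightarrow> 'i set \<Rightarrow> ('i \<Rightarrow> 'w \<Rightarrow> real) \<Rightarrow> 'w measure" where
  "generated_algebra M I Z = sigma (space M) {Z i -` B \<inter> space M | i B. i \<in> I \<and> B \<in> sets borel}"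

lemma sets_generated_algebra: "sets (generated_algebra M I Z) = generated_events M I Z"
  unfolding generated_algebra_def generated_events_def by (rule sets_measure_of) auto

lemma subalgebra_generated_algebra:
  assumes "\<And>i. i \<in> I \<Longrightarrow> Z i \<in> borel_measurable M"
  shows "subalgebra M (generated_algebra M I Z)"
  unfolding subalgebra_def
proof
  show "space (generated_algebra M I Z) = space M"
    unfolding generated_algebra_def by (rule space_measure_of) auto
  show "sets (generated_algebra M I Z) \<subseteq> sets M"
    unfolding sets_generated_algebra generated_events_def
    using assms by (intro sets.sigma_sets_subset) (auto intro: measurable_sets)
qed

lemma measurable_generated_algebra:
  assumes "i \<in> I" shows "Z i \<in> borel_measurable (generated_algebra M I Z)"
proof (rule measurableI)
  have sp: "space (generated_algebra M I Z) = space M"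
    unfolding generated_algebra_def by (rule space_measure_of) auto
  fix B :: "real set" assume "B \<in> sets borel"
  then show "Z i -` B \<inter> space (generated_algebra M I Z) \<in> sets (generated_algebra M I Z)"
    unfolding sets_generated_algebra generated_events_def sp using assms by (intro sigma_sets.Basic) auto
qed simp

lemma walsh_filtrationD:
  assumes "walsh_filtration i M N W F"
  shows "filtration (space M) F" "\<forall>r. subalgebra M (F r)"
    "\<forall>r. \<forall>A\<in>fmeasurable N. A \<subseteq> {(x, s). s $ i \<le> r} \<longrightarrow> W A \<in> borel_measurable (F r)"
    "\<forall>r. prob_space.indep_set M (sets (F r))
            (generated_events M {A \<in> fmeasurable N. A \<subseteq> {(x, s). r < s $ i}} W)"
proof -
  note * = assms[unfolded walsh_filtration_def]
  show "filtration (space M) F" by (rule *[THEN conjunct1])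
  show "\<forall>r. subalgebra M (F r)" by (rule *[THEN conjunct2, THEN conjunct1])
  show "\<forall>r. \<forall>A\<in>fmeasurable N. A \<subseteq> {(x, s). s $ i \<le> r} \<longrightarrow> W A \<in> borel_measurable (F r)"
    by (rule *[THEN conjunct2, THEN conjunct2, THEN conjunct2, THEN conjunct2, THEN conjunct1])
  show "\<forall>r. prob_space.indep_set M (sets (F r))
            (generated_events M {A \<in> fmeasurable N. A \<subseteq> {(x, s). r < s $ i}} W)"
    by (rule *[THEN conjunct2, THEN conjunct2, THEN conjunct2, THEN conjunct2, THEN conjunct2])
qed

text \<open>Measurability of the half spaces allows sets to be cut at a given time.\<close>

locale walsh_basis = prob_space M for M :: "'w measure" +
  fixes i :: "'d::finite" and N :: "('x \<times> (real ^ 'd)) measure" and W F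
  assumes W: "gaussian_basis M N W" and F: "walsh_filtration i M N W F"
    and past_sets: "\<And>r. {z \<in> space N. snd z $ i \<le> r} \<in> sets N"
begin

lemma scattered: "independently_scattered M N W"
  using W by (simp add: gaussian_basis_def)

lemma subalgebra_F: "subalgebra M (F r)"
  by (rule walsh_filtrationD(2)[OF F, rule_format])

lemma measurable_F_mono:
  assumes "a \<le> b" "f \<in> measurable (F a) S" shows "f \<in> measurable (F b) S"
proof (rule measurable_from_subalg[OF _ assms(2)])
  from filtration.sets_F_mono[OF walsh_filtrationD(1)[OF F] assms(1)] show "subalgebra (F b) (F a)"
    using subalgebra_F[of a] subalgebra_F[of b] by (simp add: subalgebra_def)
qed

lemma measurable_F_imp_measurable: "f \<in> measurable (F a) S \<Longrightarrow> f \<in> measurable M S"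
  by (rule measurable_from_subalg[OF subalgebra_F])

abbreviation future :: "real \<Rightarrow> ('x \<times> (real ^ 'd)) set" where
  "future r \<equiv> {(x, s). r < s $ i}"

lemma measurable_W_past:
  assumes "A \<in> fmeasurable N" "A \<subseteq> {(x, s). s $ i \<le> r}"
  shows "W A \<in> borel_measurable (F r)"
  using assms by (rule walsh_filtrationD(3)[OF F, rule_format])

lemma indep_var_future:
  fixes Y Z :: "'w \<Rightarrow> real"
  assumes Y: "Y \<in> borel_measurable (F r)"
    and Z: "Z \<in> borel_measurable (generated_algebra M {A \<in> fmeasurable N. A \<subseteq> future r} W)"
  shows "indep_var borel Y borel Z"
proof (rule indep_var_of_indep_set[OF _ subalgebra_F _ Y Z])
  show "indep_set (sets (F r)) (sets (generated_algebra M {A \<in> fmeasurable N. A \<subseteq> future r} W))"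
    unfolding sets_generated_algebra by (rule walsh_filtrationD(4)[OF F, rule_format])
  show "subalgebra M (generated_algebra M {A \<in> fmeasurable N. A \<subseteq> future r} W)"
    by (rule subalgebra_generated_algebra) (auto intro: scattered_measurable[OF scattered])
qed

lemma measurable_W_future:
  "A \<in> fmeasurable N \<Longrightarrow> A \<subseteq> future r \<Longrightarrow>
    W A \<in> borel_measurable (generated_algebra M {A \<in> fmeasurable N. A \<subseteq> future r} W)"
  by (rule measurable_generated_algebra) auto

text \<open>Split \<open>A\<close> at the later time \<open>b\<close>.  The part before \<open>b\<close> contributes nothing, since \<open>W B\<close> is centred
  and independent of the past of \<open>b\<close>; the part after \<open>b\<close> is independent of both coefficients.\<close>

lemma adapted_covariance_ordered:
  assumes A: "A \<in> fmeasurable N" "A \<subseteq> future a" and B: "B \<in> fmeasurable N" "B \<subseteq> future b"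
    and ab: "a \<le> b"
    and f: "f \<in> borel_measurable (F a)" "integrable M (\<lambda>\<omega>. (f \<omega>)\<^sup>2)"
    and g: "g \<in> borel_measurable (F b)" "integrable M (\<lambda>\<omega>. (g \<omega>)\<^sup>2)"
  shows "integrable M (\<lambda>\<omega>. (f \<omega> * W A \<omega>) * (g \<omega> * W B \<omega>)) \<and>
    (LINT \<omega>|M. (f \<omega> * W A \<omega>) * (g \<omega> * W B \<omega>)) = (LINT \<omega>|M. f \<omega> * g \<omega>) * measure N (A \<inter> B)"
proof -
  note M = prob_space_axioms
  define A1 where "A1 = A \<inter> {z \<in> space N. snd z $ i \<le> b}"
  define A2 where "A2 = A - A1"
  have A1: "A1 \<in> fmeasurable N" "A1 \<subseteq> {(x, s). s $ i \<le> b}" "A1 \<subseteq> future a"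
    using A past_sets by (auto simp: A1_def intro: fmeasurable_Int_fmeasurable)
  have A2: "A2 \<in> fmeasurable N" "A2 \<subseteq> future b"
    using A A1 fmeasurableD[OF A(1), THEN sets.sets_into_space]
    by (auto simp: A2_def A1_def intro: fmeasurable_Diff)
  have f_M: "f \<in> borel_measurable M" and g_M: "g \<in> borel_measurable M"
    using f g by (auto intro: measurable_F_imp_measurable)
  note W_M = scattered_measurable[OF scattered]
  have f_b: "f \<in> borel_measurable (F b)" using f(1) ab by (rule measurable_F_mono[rotated])
  have "integrable M (\<lambda>\<omega>. (f \<omega>)\<^sup>2 * (W A1 \<omega>)\<^sup>2)"
    using A1 f by (intro indep_var_integrable indep_var_future[of _ a] gaussian_square_integrable[OF M W]
      borel_measurable_power measurable_W_future)
  then have "integrable M (\<lambda>\<omega>. (f \<omega> * W A1 \<omega>) * g \<omega>)"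
    using f_M g_M W_M[OF A1(1)] g(2) by (intro integrable_mult_of_squares) (auto simp: power_mult_distrib)
  moreover have "indep_var borel (\<lambda>\<omega>. (f \<omega> * W A1 \<omega>) * g \<omega>) borel (W B)"
    using f_b g(1) measurable_W_past[OF A1(1,2)] B
    by (intro indep_var_future[of _ b] measurable_W_future borel_measurable_times)
  ultimately have past: "integrable M (\<lambda>\<omega>. (f \<omega> * W A1 \<omega>) * g \<omega> * W B \<omega>)"
      "(LINT \<omega>|M. (f \<omega> * W A1 \<omega>) * g \<omega> * W B \<omega>) = 0"
    using gaussian_integrable[OF M W B(1)]
    by (simp_all add: indep_var_integrable indep_var_lebesgue_integral gaussian_mean[OF M W B(1)])
  have "integrable M (\<lambda>\<omega>. f \<omega> * g \<omega>)"
    using f g f_M g_M by (intro integrable_mult_of_squares)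
  moreover have "indep_var borel (\<lambda>\<omega>. f \<omega> * g \<omega>) borel (\<lambda>\<omega>. W A2 \<omega> * W B \<omega>)"
    using f_b g(1) A2 B by (intro indep_var_future[of _ b] measurable_W_future borel_measurable_times)
  ultimately have fut: "integrable M (\<lambda>\<omega>. (f \<omega> * g \<omega>) * (W A2 \<omega> * W B \<omega>))"
      "(LINT \<omega>|M. (f \<omega> * g \<omega>) * (W A2 \<omega> * W B \<omega>)) = (LINT \<omega>|M. f \<omega> * g \<omega>) * measure N (A2 \<inter> B)"
    using gaussian_product_integrable[OF M W A2(1) B(1)]
    by (simp_all add: indep_var_integrable indep_var_lebesgue_integral gaussian_covariance[OF M W A2(1) B(1)])
  have AB: "A2 \<inter> B = A \<inter> B" using B(2) by (auto simp: A2_def A1_def)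
  have "AE \<omega> in M. W (A1 \<union> A2) \<omega> = W A1 \<omega> + W A2 \<omega>"
    using A1 A2 by (intro scattered_add[OF M scattered]) (auto simp: A2_def)
  moreover have "A1 \<union> A2 = A" by (auto simp: A1_def A2_def)
  ultimately have ae: "AE \<omega> in M. (f \<omega> * W A1 \<omega>) * g \<omega> * W B \<omega> + (f \<omega> * g \<omega>) * (W A2 \<omega> * W B \<omega>) = (f \<omega> * W A \<omega>) * (g \<omega> * W B \<omega>)"
    by (auto simp: algebra_simps)
  have meas: "(\<lambda>\<omega>. (f \<omega> * W A \<omega>) * (g \<omega> * W B \<omega>)) \<in> borel_measurable M"
    using f_M g_M W_M[OF A(1)] W_M[OF B(1)] by simp
  have sum: "integrable M (\<lambda>\<omega>. (f \<omega> * W A1 \<omega>) * g \<omega> * W B \<omega> + (f \<omega> * g \<omega>) * (W A2 \<omega> * W B \<omega>))"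
    using past fut by simp
  have "integrable M (\<lambda>\<omega>. (f \<omega> * W A \<omega>) * (g \<omega> * W B \<omega>))"
    using integrable_cong_AE_imp[OF sum meas] ae by (auto simp: eq_commute)
  moreover have "(LINT \<omega>|M. (f \<omega> * W A \<omega>) * (g \<omega> * W B \<omega>))
      = (LINT \<omega>|M. (f \<omega> * W A1 \<omega>) * g \<omega> * W B \<omega> + (f \<omega> * g \<omega>) * (W A2 \<omega> * W B \<omega>))"
    using ae by (intro integral_cong_AE meas borel_measurable_integrable[OF sum]) (auto simp: eq_commute)
  ultimately show ?thesis using past fut AB by simp
qed

lemma adapted_covariance:
  assumes A: "A \<in> fmeasurable N" "A \<subseteq> future a" and B: "B \<in> fmeasurable N" "B \<subseteq> future b"
    and f: "f \<in> borel_measurable (F a)" "integrable M (\<lambda>\<omega>. (f \<omega>)\<^sup>2)"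
    and g: "g \<in> borel_measurable (F b)" "integrable M (\<lambda>\<omega>. (g \<omega>)\<^sup>2)"
  shows "integrable M (\<lambda>\<omega>. (f \<omega> * W A \<omega>) * (g \<omega> * W B \<omega>))"
    and "(LINT \<omega>|M. (f \<omega> * W A \<omega>) * (g \<omega> * W B \<omega>)) = (LINT \<omega>|M. f \<omega> * g \<omega>) * measure N (A \<inter> B)"
  using adapted_covariance_ordered[OF A B _ f g] adapted_covariance_ordered[OF B A _ g f]
  by (cases "a \<le> b"; simp add: mult.commute Int_commute)+

end

context walsh_basis
begin

abbreviation step :: "'q set \<Rightarrow> ('q \<Rightarrow> 'w \<Rightarrow> real) \<Rightarrow> ('q \<Rightarrow> ('x \<times> (real ^ 'd)) set) \<Rightarrow> 'x \<times> (real ^ 'd) \<Rightarrow> 'w \<Rightarrow> real"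
  where "step K \<eta> C \<equiv> \<lambda>z \<omega>. \<Sum>k\<in>K. \<eta> k \<omega> * indicator (C k) z"

abbreviation step_integral :: "'q set \<Rightarrow> ('q \<Rightarrow> 'w \<Rightarrow> real) \<Rightarrow> ('q \<Rightarrow> ('x \<times> (real ^ 'd)) set) \<Rightarrow> 'w \<Rightarrow> real"
  where "step_integral K \<eta> C \<equiv> \<lambda>\<omega>. \<Sum>k\<in>K. \<eta> k \<omega> * W (C k) \<omega>"

text \<open>The data of an adapted simple integrand.  The sets may overlap and each has its own initial time,
  so that the difference of two such integrands is again of this form.\<close>

definition adapted_family :: "'q set \<Rightarrow> ('q \<Rightarrow> 'w \<Rightarrow> real) \<Rightarrow> ('q \<Rightarrow> ('x \<times> (real ^ 'd)) set) \<Rightarrow> bool" where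
  "adapted_family Q \<eta> C \<longleftrightarrow> finite Q \<and> (\<forall>q\<in>Q. C q \<in> fmeasurable N \<and> integrable M (\<lambda>\<omega>. (\<eta> q \<omega>)\<^sup>2) \<and>
     (\<exists>a. C q \<subseteq> future a \<and> \<eta> q \<in> borel_measurable (F a)))"

lemma adapted_familyD:
  assumes "adapted_family Q \<eta> C"
  shows "finite Q" "\<And>q. q \<in> Q \<Longrightarrow> C q \<in> fmeasurable N" "\<And>q. q \<in> Q \<Longrightarrow> integrable M (\<lambda>\<omega>. (\<eta> q \<omega>)\<^sup>2)"
    "\<And>q. q \<in> Q \<Longrightarrow> \<eta> q \<in> borel_measurable M"
  using assms unfolding adapted_family_def by (auto intro: measurable_F_imp_measurable)

text \<open>Both squares expand into double sums, whose terms agree by the covariance formula.\<close>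

lemma adapted_isometry:
  assumes Q: "adapted_family Q \<eta> C"
  shows "(\<integral>\<^sup>+\<omega>. ennreal ((step_integral Q \<eta> C \<omega>)\<^sup>2) \<partial>M)
    = (\<integral>\<^sup>+\<omega>. \<integral>\<^sup>+z. ennreal ((step Q \<eta> C z \<omega>)\<^sup>2) \<partial>N \<partial>M)"
proof -
  note fin = adapted_familyD(1)[OF Q] and C = adapted_familyD(2)[OF Q] and sq = adapted_familyD(3)[OF Q]
    and meas = adapted_familyD(4)[OF Q]
  define c where "c q r = measure N (C q \<inter> C r)" for q r
  define S where "S \<omega> = (\<Sum>q\<in>Q. \<Sum>r\<in>Q. \<eta> q \<omega> * \<eta> r \<omega> * c q r)" for \<omega>
  have expand: "(\<Sum>q\<in>Q. \<eta> q \<omega> * v q)\<^sup>2 = (\<Sum>q\<in>Q. \<Sum>r\<in>Q. (\<eta> q \<omega> * v q) * (\<eta> r \<omega> * v r))" for \<omega> v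
    by (simp add: power2_eq_square sum_product)
  have cov: "integrable M (\<lambda>\<omega>. (\<eta> q \<omega> * W (C q) \<omega>) * (\<eta> r \<omega> * W (C r) \<omega>))"
      "(LINT \<omega>|M. (\<eta> q \<omega> * W (C q) \<omega>) * (\<eta> r \<omega> * W (C r) \<omega>)) = (LINT \<omega>|M. \<eta> q \<omega> * \<eta> r \<omega>) * c q r"
    if qr: "q \<in> Q" "r \<in> Q" for q r
  proof -
    obtain a b where a: "C q \<subseteq> future a" "\<eta> q \<in> borel_measurable (F a)"
      and b: "C r \<subseteq> future b" "\<eta> r \<in> borel_measurable (F b)"
      using Q qr unfolding adapted_family_def by meson
    show "integrable M (\<lambda>\<omega>. (\<eta> q \<omega> * W (C q) \<omega>) * (\<eta> r \<omega> * W (C r) \<omega>))"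
      "(LINT \<omega>|M. (\<eta> q \<omega> * W (C q) \<omega>) * (\<eta> r \<omega> * W (C r) \<omega>)) = (LINT \<omega>|M. \<eta> q \<omega> * \<eta> r \<omega>) * c q r"
      using adapted_covariance[OF C[OF qr(1)] a(1) C[OF qr(2)] b(1) a(2) sq[OF qr(1)] b(2) sq[OF qr(2)]]
      by (auto simp: c_def)
  qed
  have int: "integrable M (\<lambda>\<omega>. \<eta> q \<omega> * \<eta> r \<omega>)" if "q \<in> Q" "r \<in> Q" for q r
    using that sq meas by (intro integrable_mult_of_squares) auto
  have inner: "(\<integral>\<^sup>+z. ennreal ((step Q \<eta> C z \<omega>)\<^sup>2) \<partial>N) = ennreal (S \<omega>)"
    and inner_nonneg: "0 \<le> S \<omega>" for \<omega>
  proof -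
    have eq: "(step Q \<eta> C z \<omega>)\<^sup>2 = (\<Sum>q\<in>Q. \<Sum>r\<in>Q. \<eta> q \<omega> * \<eta> r \<omega> * indicator (C q \<inter> C r) z)" for z
      unfolding expand by (intro sum.cong refl) (auto simp: indicator_def)
    have 1: "integrable N (\<lambda>z. \<eta> q \<omega> * \<eta> r \<omega> * indicator (C q \<inter> C r) z)"
      "(LINT z|N. \<eta> q \<omega> * \<eta> r \<omega> * indicator (C q \<inter> C r) z) = \<eta> q \<omega> * \<eta> r \<omega> * c q r"
      if "q \<in> Q" "r \<in> Q" for q r
    proof -
      have "C q \<inter> C r \<in> fmeasurable N" using C that by auto
      then have "integrable N (indicator (C q \<inter> C r) :: _ \<Rightarrow> real)"
        "(LINT z|N. indicator (C q \<inter> C r) z) = c q r"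
        using sets.sets_into_space[OF fmeasurableD]
        by (auto simp: fmeasurable_def c_def Int_absorb2 intro!: integrable_real_indicator)
      then show "integrable N (\<lambda>z. \<eta> q \<omega> * \<eta> r \<omega> * indicator (C q \<inter> C r) z)"
        "(LINT z|N. \<eta> q \<omega> * \<eta> r \<omega> * indicator (C q \<inter> C r) z) = \<eta> q \<omega> * \<eta> r \<omega> * c q r" by auto
    qed
    have 2: "integrable N (\<lambda>z. (step Q \<eta> C z \<omega>)\<^sup>2)"
      unfolding eq using 1 by auto
    have 3: "(LINT z|N. (step Q \<eta> C z \<omega>)\<^sup>2) = S \<omega>"
      unfolding eq S_def using 1 by (auto intro!: sum.cong)
    show "(\<integral>\<^sup>+z. ennreal ((step Q \<eta> C z \<omega>)\<^sup>2) \<partial>N) = ennreal (S \<omega>)"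
      unfolding 3[symmetric] by (rule nn_integral_eq_integral[OF 2]) simp
    show "0 \<le> S \<omega>"
      unfolding 3[symmetric] by simp
  qed
  have "(\<integral>\<^sup>+\<omega>. ennreal ((step_integral Q \<eta> C \<omega>)\<^sup>2) \<partial>M)
      = ennreal (LINT \<omega>|M. (step_integral Q \<eta> C \<omega>)\<^sup>2)"
  proof (rule nn_integral_eq_integral)
    show "integrable M (\<lambda>\<omega>. (step_integral Q \<eta> C \<omega>)\<^sup>2)" unfolding expand using cov(1) by auto
  qed simp
  also have "(LINT \<omega>|M. (step_integral Q \<eta> C \<omega>)\<^sup>2)
      = (LINT \<omega>|M. S \<omega>)"
    unfolding expand S_def using cov int by simp
  also have "ennreal \<dots> = (\<integral>\<^sup>+\<omega>. ennreal (S \<omega>) \<partial>M)"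
    using int inner_nonneg by (intro nn_integral_eq_integral[symmetric]) (auto simp: S_def)
  finally show ?thesis unfolding inner .
qed

lemma adapted_isometry_diff:
  assumes Q: "adapted_family Q \<eta> C" and R: "adapted_family R \<xi> D"
  shows "(\<integral>\<^sup>+\<omega>. ennreal ((step_integral Q \<eta> C \<omega> - step_integral R \<xi> D \<omega>)\<^sup>2) \<partial>M)
    = (\<integral>\<^sup>+\<omega>. \<integral>\<^sup>+z. ennreal ((step Q \<eta> C z \<omega> - step R \<xi> D z \<omega>)\<^sup>2) \<partial>N \<partial>M)"
proof -
  have fin: "finite Q" "finite R" using Q R by (auto dest: adapted_familyD)
  define \<zeta> where "\<zeta> = case_sum \<eta> (\<lambda>r \<omega>. - \<xi> r \<omega>)"
  have "adapted_family (Q <+> R) \<zeta> (case_sum C D)"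
    using Q R unfolding adapted_family_def \<zeta>_def by (fastforce intro: borel_measurable_uminus)
  from adapted_isometry[OF this]
  have "(\<integral>\<^sup>+\<omega>. ennreal ((\<Sum>q\<in>Q <+> R. \<zeta> q \<omega> * W (case_sum C D q) \<omega>)\<^sup>2) \<partial>M)
    = (\<integral>\<^sup>+\<omega>. \<integral>\<^sup>+z. ennreal ((\<Sum>q\<in>Q <+> R. \<zeta> q \<omega> * indicator (case_sum C D q) z)\<^sup>2) \<partial>N \<partial>M)" .
  moreover have "(\<Sum>q\<in>Q <+> R. \<zeta> q \<omega> * v (case_sum C D q)) = (\<Sum>q\<in>Q. \<eta> q \<omega> * v (C q)) - (\<Sum>r\<in>R. \<xi> r \<omega> * v (D r))"
    for \<omega> and v :: "('x \<times> (real ^ 'd)) set \<Rightarrow> real"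
    using fin by (simp add: sum.Plus \<zeta>_def comp_def sum_negf)
  from this[of _ "\<lambda>A. W A _"] this[of _ "\<lambda>A. indicator A _"]
  have "(\<Sum>q\<in>Q <+> R. \<zeta> q \<omega> * W (case_sum C D q) \<omega>) = step_integral Q \<eta> C \<omega> - step_integral R \<xi> D \<omega>"
    "(\<Sum>q\<in>Q <+> R. \<zeta> q \<omega> * indicator (case_sum C D q) z) = step Q \<eta> C z \<omega> - step R \<xi> D z \<omega>"
    for \<omega> z by blast+
  ultimately show ?thesis by (simp only:)
qed

end

text \<open>Freezing the first of two independent variables.\<close>

lemma (in prob_space) indep_var_integral_iterated:
  fixes \<phi> :: "'s \<times> 's \<Rightarrow> complex"
  assumes ind: "indep_var S X T Y" and [measurable]: "\<phi> \<in> borel_measurable (S \<Otimes>\<^sub>M T)"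
    and bound: "\<And>x. cmod (\<phi> x) \<le> 1"
  shows "(CLINT \<omega>|M. \<phi> (X \<omega>, Y \<omega>)) = (CLINT \<omega>|M. CLINT \<omega>'|M. \<phi> (X \<omega>, Y \<omega>'))"
proof -
  have X [measurable]: "X \<in> measurable M S" and Y [measurable]: "Y \<in> measurable M T"
    using ind by (auto dest: indep_var_rv1 indep_var_rv2)
  interpret DX: prob_space "distr M S X" by (rule prob_space_distr) (rule X)
  interpret DY: prob_space "distr M T Y" by (rule prob_space_distr) (rule Y)
  interpret P: pair_prob_space "distr M S X" "distr M T Y" ..
  have "(CLINT \<omega>|M. \<phi> (X \<omega>, Y \<omega>)) = (CLINT x|distr M (S \<Otimes>\<^sub>M T) (\<lambda>\<omega>. (X \<omega>, Y \<omega>)). \<phi> x)"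
    by (intro integral_distr[symmetric]) measurable
  also have "\<dots> = (CLINT x|distr M S X \<Otimes>\<^sub>M distr M T Y. \<phi> x)"
    using ind by (simp add: indep_var_distribution_eq)
  also have "\<dots> = (CLINT x|distr M S X. CLINT y|distr M T Y. \<phi> (x, y))"
    by (intro P.integral_fst'[symmetric] P.integrable_const_bound[of _ 1]) (auto simp: bound)
  also have "\<dots> = (CLINT x|distr M S X. CLINT \<omega>'|M. \<phi> (x, Y \<omega>'))"
    by (intro Bochner_Integration.integral_cong refl integral_distr) (auto simp: space_distr)
  also have "\<dots> = (CLINT \<omega>|M. CLINT \<omega>'|M. \<phi> (X \<omega>, Y \<omega>'))"
    by (intro integral_distr) measurable
  finally show ?thesis .
qed

text \<open>Coefficients that are jointly independent of the whole basis can be frozen.  What remains is a sum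
  of independent centred Gaussian variables; so conditionally on \<open>\<G>\<close> the simple integral is Gaussian
  with the variance in the exponent.\<close>

lemma gaussian_basis_conditional_char:
  fixes K :: "'k set"
  assumes M: "prob_space M" and W: "gaussian_basis M N W"
    and ind: "prob_space.indep_set M (sets \<G>) (generated_events M (fmeasurable N) W)"
    and \<G>: "subalgebra M \<G>" and fin: "finite K"
    and C: "\<And>k. k \<in> K \<Longrightarrow> C k \<in> fmeasurable N" "disjoint_family_on C K"
    and \<eta>: "\<And>k. k \<in> K \<Longrightarrow> \<eta> k \<in> borel_measurable \<G>"
  shows "char (distr M borel (\<lambda>\<omega>. \<Sum>k\<in>K. \<eta> k \<omega> * W (C k) \<omega>)) \<theta>
    = (CLINT \<omega>|M. exp (complex_of_real (- (\<theta>\<^sup>2 / 2) * (\<Sum>k\<in>K. (\<eta> k \<omega>)\<^sup>2 * measure N (C k)))))"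
proof -
  interpret prob_space M by fact
  have scat: "independently_scattered M N W" using W by (simp add: gaussian_basis_def)
  note W_M = scattered_measurable[OF scat C(1)]
  define X where "X \<omega> = (\<lambda>k\<in>K. \<eta> k \<omega>)" for \<omega>
  define Y where "Y \<omega> = (\<lambda>k\<in>K. W (C k) \<omega>)" for \<omega>
  define \<phi> where "\<phi> xy = iexp (\<theta> * (\<Sum>k\<in>K. fst xy k * snd xy k))" for xy :: "('k \<Rightarrow> real) \<times> ('k \<Rightarrow> real)"
  have "indep_var (\<Pi>\<^sub>M k\<in>K. borel) X (\<Pi>\<^sub>M k\<in>K. borel) Y"
  proof (rule indep_var_of_indep_set[OF _ \<G>])
    show "indep_set (sets \<G>) (sets (generated_algebra M (fmeasurable N) W))"
      using ind by (simp add: sets_generated_algebra)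
    show "subalgebra M (generated_algebra M (fmeasurable N) W)"
      by (rule subalgebra_generated_algebra) (rule scattered_measurable[OF scat])
    show "X \<in> \<G> \<rightarrow>\<^sub>M (\<Pi>\<^sub>M k\<in>K. borel)" unfolding X_def using \<eta> by (intro measurable_restrict) auto
    show "Y \<in> generated_algebra M (fmeasurable N) W \<rightarrow>\<^sub>M (\<Pi>\<^sub>M k\<in>K. borel)"
      unfolding Y_def using C(1) by (intro measurable_restrict measurable_generated_algebra)
  qed
  moreover have "\<phi> \<in> borel_measurable ((\<Pi>\<^sub>M k\<in>K. borel) \<Otimes>\<^sub>M (\<Pi>\<^sub>M k\<in>K. borel))"
    unfolding \<phi>_def by measurable
  ultimately have iter: "(CLINT \<omega>|M. \<phi> (X \<omega>, Y \<omega>)) = (CLINT \<omega>|M. CLINT \<omega>'|M. \<phi> (X \<omega>, Y \<omega>'))"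
    by (rule indep_var_integral_iterated) (simp add: \<phi>_def)
  have inner: "(CLINT \<omega>'|M. \<phi> (X \<omega>, Y \<omega>')) = exp (complex_of_real (- (\<theta>\<^sup>2 / 2) * (\<Sum>k\<in>K. (\<eta> k \<omega>)\<^sup>2 * measure N (C k))))" for \<omega>
  proof -
    define x where "x k = \<eta> k \<omega>" for k
    have "(CLINT \<omega>'|M. \<phi> (X \<omega>, Y \<omega>')) = (CLINT \<omega>'|M. iexp (\<theta> * (\<Sum>k\<in>K. x k * W (C k) \<omega>')))"
      by (intro Bochner_Integration.integral_cong) (simp_all add: \<phi>_def X_def Y_def x_def)
    also have "\<dots> = char (distr M borel (\<lambda>\<omega>'. \<Sum>k\<in>K. x k * W (C k) \<omega>')) \<theta>"
      unfolding char_def using W_M by (intro integral_distr[symmetric]) auto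
    also have "\<dots> = (\<Prod>k\<in>K. char (distr M borel (\<lambda>\<omega>'. x k * W (C k) \<omega>')) \<theta>)"
    proof (rule char_distr_sum)
      have "indep_vars (\<lambda>_. borel) (\<lambda>k. W (C k)) K"
        by (rule scattered_indep_vars[OF M scat fin C])
      then show "indep_vars (\<lambda>_. borel) (\<lambda>k \<omega>'. x k * W (C k) \<omega>') K"
        by (rule indep_vars_compose2) simp
    qed
    also have "\<dots> = (\<Prod>k\<in>K. exp (complex_of_real (- (\<theta>\<^sup>2 / 2) * ((x k)\<^sup>2 * measure N (C k)))))"
    proof (rule prod.cong[OF refl])
      fix k assume k: "k \<in> K"
      have "char (distr M borel (\<lambda>\<omega>'. x k * W (C k) \<omega>')) \<theta>
          = exp (complex_of_real (- ((x k * \<theta>)\<^sup>2 / 2) * measure N (C k)))"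
        using W C(1)[OF k] W_M[OF k] by (subst char_distr_scale) (simp_all add: gaussian_basis_def)
      then show "char (distr M borel (\<lambda>\<omega>'. x k * W (C k) \<omega>')) \<theta>
          = exp (complex_of_real (- (\<theta>\<^sup>2 / 2) * ((x k)\<^sup>2 * measure N (C k))))"
        by (simp add: power_mult_distrib mult_ac)
    qed
    also have "\<dots> = exp (complex_of_real (- (\<theta>\<^sup>2 / 2) * (\<Sum>k\<in>K. (x k)\<^sup>2 * measure N (C k))))"
      using fin by (simp only: exp_sum[symmetric] of_real_sum[symmetric] sum_distrib_left[symmetric])
    finally show ?thesis by (simp add: x_def)
  qed
  have "(CLINT \<omega>|M. \<phi> (X \<omega>, Y \<omega>)) = char (distr M borel (\<lambda>\<omega>. \<Sum>k\<in>K. \<eta> k \<omega> * W (C k) \<omega>)) \<theta>"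
  proof -
    have "(\<lambda>\<omega>. \<Sum>k\<in>K. \<eta> k \<omega> * W (C k) \<omega>) \<in> borel_measurable M"
      using W_M measurable_from_subalg[OF \<G> \<eta>] by auto
    then have "char (distr M borel (\<lambda>\<omega>. \<Sum>k\<in>K. \<eta> k \<omega> * W (C k) \<omega>)) \<theta>
      = (CLINT \<omega>|M. iexp (\<theta> * (\<Sum>k\<in>K. \<eta> k \<omega> * W (C k) \<omega>)))"
      unfolding char_def by (intro integral_distr) auto
    also have "\<dots> = (CLINT \<omega>|M. \<phi> (X \<omega>, Y \<omega>))"
      by (intro Bochner_Integration.integral_cong) (simp_all add: \<phi>_def X_def Y_def)
    finally show ?thesis by simp
  qed
  then show ?thesis using iter by (simp only: inner)
qed

section \<open>Sampling an integrand on the pieces of an approximating simple function\<close>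

definition sq_dist :: "'a measure \<Rightarrow> ('a \<Rightarrow> real) \<Rightarrow> ('a \<Rightarrow> real) \<Rightarrow> ennreal" where
  "sq_dist Q u v = (\<integral>\<^sup>+x. ennreal ((u x - v x)\<^sup>2) \<partial>Q)"

lemma sq_dist_triangle:
  assumes [measurable]: "u \<in> borel_measurable Q" "v \<in> borel_measurable Q" "w \<in> borel_measurable Q"
  shows "sq_dist Q u w \<le> 2 * sq_dist Q u v + 2 * sq_dist Q v w"
proof -
  have "(u x - w x)\<^sup>2 \<le> 2 * (u x - v x)\<^sup>2 + 2 * (v x - w x)\<^sup>2" for x
    using sum_squares_bound[of "u x - v x" "v x - w x"] by (simp add: power2_eq_square algebra_simps)
  then have "sq_dist Q u w \<le> (\<integral>\<^sup>+x. 2 * ennreal ((u x - v x)\<^sup>2) + 2 * ennreal ((v x - w x)\<^sup>2) \<partial>Q)"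
    unfolding sq_dist_def
    by (intro nn_integral_mono) (simp flip: ennreal_numeral ennreal_plus ennreal_mult' add: ennreal_leI)
  also have "\<dots> = 2 * sq_dist Q u v + 2 * sq_dist Q v w"
    unfolding sq_dist_def by (simp add: nn_integral_add nn_integral_cmult)
  finally show ?thesis .
qed

text \<open>Otherwise \<open>A\<close> would exceed its mean value everywhere on \<open>C\<close>.\<close>

lemma exists_le_average:
  fixes A :: "'z \<Rightarrow> ennreal"
  assumes [measurable]: "A \<in> borel_measurable N" "C \<in> sets N"
    and C: "emeasure N C < \<infinity>" "C \<noteq> {}"
  shows "\<exists>z\<in>C. A z * emeasure N C \<le> (\<integral>\<^sup>+z. A z * indicator C z \<partial>N)"
proof (cases "emeasure N C = 0")
  case False
  define T where "T = (\<integral>\<^sup>+z. A z * indicator C z \<partial>N)"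
  show ?thesis
  proof (rule ccontr)
    assume "\<not> ?thesis"
    then have less: "\<And>z. z \<in> C \<Longrightarrow> T < A z * emeasure N C" by (auto simp: T_def not_le)
    obtain z0 where "z0 \<in> C" using C(2) by blast
    then have T: "T < \<infinity>" using less[of z0] order_less_le_trans[OF _ top_greatest] by (simp add: infinity_ennreal_def)
    define a where "a = T / emeasure N C"
    have aC: "a * emeasure N C = T"
      using False C(1) by (simp add: a_def ennreal_divide_times ennreal_mult_divide_eq flip: less_top)
    have lt: "a < A z" if "z \<in> C" for z
    proof (rule ccontr)
      assume "\<not> a < A z"
      then have "A z * emeasure N C \<le> a * emeasure N C" by (intro mult_right_mono) auto
      then show False using less[OF that] aC by simp
    qed
    have "(\<integral>\<^sup>+z. a * indicator C z \<partial>N) < (\<integral>\<^sup>+z. A z * indicator C z \<partial>N)"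
    proof (rule nn_integral_less)
      show "(\<integral>\<^sup>+z. a * indicator C z \<partial>N) \<noteq> \<infinity>" using T aC by (simp add: nn_integral_cmult_indicator)
      show "AE z in N. a * indicator C z \<le> A z * indicator C z"
        using lt by (auto simp: indicator_def intro: less_imp_le)
      show "\<not> (AE z in N. A z * indicator C z \<le> a * indicator C z)"
      proof
        assume "AE z in N. A z * indicator C z \<le> a * indicator C z"
        then have "AE z in N. z \<notin> C"
        proof eventually_elim
          case (elim z)
          then show ?case using lt[of z] by (cases "z \<in> C") auto
        qed
        then show False using False by (subst (asm) AE_iff_null_sets[symmetric]) (auto simp: null_sets_def)
      qed
    qed measurable
    also have "\<dots> = T" by (simp add: T_def)
    finally show False using aC by (simp add: nn_integral_cmult_indicator)
  qed
qed (use C(2) in auto)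

text \<open>If \<open>h\<close> depends on \<open>z\<close> only through a finite \<open>key\<close>, then in every class of the key some value
  of \<open>f\<close> is no further from the constant value of \<open>h\<close> than \<open>f\<close> is on average.  So a sampled function
  is as close to \<open>h\<close> as \<open>f\<close> is.\<close>

lemma sampling:
  fixes M :: "'w measure" and f h :: "'z \<Rightarrow> 'w \<Rightarrow> real" and key :: "'z \<Rightarrow> 'k"
  defines "A \<equiv> \<lambda>z. \<integral>\<^sup>+\<omega>. ennreal ((f z \<omega> - h z \<omega>)\<^sup>2) \<partial>M"
  assumes A: "A \<in> borel_measurable N"
    and K: "finite (key ` U)" and C_def: "\<And>k. C k = {z \<in> U. key z = k}"
    and C: "\<And>k. k \<in> key ` U \<Longrightarrow> C k \<in> fmeasurable N"
    and const: "\<And>z z' \<omega>. z \<in> U \<Longrightarrow> z' \<in> U \<Longrightarrow> key z = key z' \<Longrightarrow> h z \<omega> = h z' \<omega>"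
    and zero: "\<And>z \<omega>. z \<notin> U \<Longrightarrow> h z \<omega> = 0"
  shows "\<exists>\<zeta>. (\<forall>k\<in>key ` U. \<zeta> k \<in> C k) \<and>
    (\<forall>k\<in>key ` U. A (\<zeta> k) * emeasure N (C k) \<le> (\<integral>\<^sup>+z. A z \<partial>N)) \<and>
    (\<forall>\<eta>. (\<forall>k\<in>key ` U. emeasure N (C k) \<noteq> 0 \<longrightarrow> \<eta> k = f (\<zeta> k)) \<longrightarrow>
      (\<integral>\<^sup>+z. (\<integral>\<^sup>+\<omega>. ennreal ((h z \<omega> - (\<Sum>k\<in>key ` U. \<eta> k \<omega> * indicator (C k) z))\<^sup>2) \<partial>M) \<partial>N) \<le> (\<integral>\<^sup>+z. A z \<partial>N))"
proof -
  have "\<forall>k\<in>key ` U. \<exists>z. z \<in> C k \<and> A z * emeasure N (C k) \<le> (\<integral>\<^sup>+z. A z * indicator (C k) z \<partial>N)"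
  proof
    fix k assume k: "k \<in> key ` U"
    then have "C k \<noteq> {}" by (auto simp: C_def)
    then show "\<exists>z. z \<in> C k \<and> A z * emeasure N (C k) \<le> (\<integral>\<^sup>+z. A z * indicator (C k) z \<partial>N)"
      using exists_le_average[OF A, of "C k"] C[OF k] by (auto simp: fmeasurable_def less_top)
  qed
  from bchoice[OF this] obtain \<zeta> where \<zeta>: "\<And>k. k \<in> key ` U \<Longrightarrow> \<zeta> k \<in> C k"
    "\<And>k. k \<in> key ` U \<Longrightarrow> A (\<zeta> k) * emeasure N (C k) \<le> (\<integral>\<^sup>+z. A z * indicator (C k) z \<partial>N)"
    by blast
  show ?thesis
  proof (intro exI[of _ \<zeta>] conjI ballI allI impI)
    show "\<zeta> k \<in> C k" if "k \<in> key ` U" for k using \<zeta>(1)[OF that] .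
    show "A (\<zeta> k) * emeasure N (C k) \<le> (\<integral>\<^sup>+z. A z \<partial>N)" if "k \<in> key ` U" for k
      by (rule order_trans[OF \<zeta>(2)[OF that] nn_integral_mono]) (auto simp: indicator_def)
    fix \<eta> assume "\<forall>k\<in>key ` U. emeasure N (C k) \<noteq> 0 \<longrightarrow> \<eta> k = f (\<zeta> k)"
    then have \<eta>: "\<And>k. k \<in> key ` U \<Longrightarrow> emeasure N (C k) \<noteq> 0 \<Longrightarrow> \<eta> k = f (\<zeta> k)" by blast
    define b where "b k = (\<integral>\<^sup>+\<omega>. ennreal ((h (\<zeta> k) \<omega> - \<eta> k \<omega>)\<^sup>2) \<partial>M)" for k
    have "(\<integral>\<^sup>+\<omega>. ennreal ((h z \<omega> - (\<Sum>k\<in>key ` U. \<eta> k \<omega> * indicator (C k) z))\<^sup>2) \<partial>M)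
        = (\<Sum>k\<in>key ` U. b k * indicator (C k) z)" for z
    proof (cases "z \<in> U")
      case True
      have ind: "indicator (C k) z = (if k = key z then 1 else 0)" for k
        using True by (auto simp: C_def indicator_def)
      have "h z \<omega> = h (\<zeta> (key z)) \<omega>" for \<omega>
        using \<zeta>(1)[of "key z"] True by (intro const) (auto simp: C_def)
      then show ?thesis using K True by (simp add: ind b_def if_distrib cong: if_cong)
    next
      case False
      then have "z \<notin> C k" for k by (auto simp: C_def)
      then show ?thesis using zero[OF False] by simp
    qed
    then have "(\<integral>\<^sup>+z. (\<integral>\<^sup>+\<omega>. ennreal ((h z \<omega> - (\<Sum>k\<in>key ` U. \<eta> k \<omega> * indicator (C k) z))\<^sup>2) \<partial>M) \<partial>N)
        = (\<Sum>k\<in>key ` U. b k * emeasure N (C k))"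
      using C fmeasurableD by (simp add: nn_integral_sum nn_integral_cmult_indicator)
    also have "\<dots> \<le> (\<Sum>k\<in>key ` U. \<integral>\<^sup>+z. A z * indicator (C k) z \<partial>N)"
    proof (rule sum_mono)
      fix k assume k: "k \<in> key ` U"
      show "b k * emeasure N (C k) \<le> (\<integral>\<^sup>+z. A z * indicator (C k) z \<partial>N)"
      proof (cases "emeasure N (C k) = 0")
        case False
        then have "b k = A (\<zeta> k)" using \<eta>[OF k] by (simp add: b_def A_def power2_commute)
        then show ?thesis using \<zeta>(2)[OF k] by simp
      qed simp
    qed
    also have "\<dots> = (\<integral>\<^sup>+z. (\<Sum>k\<in>key ` U. A z * indicator (C k) z) \<partial>N)"
      using C fmeasurableD A by (intro nn_integral_sum[symmetric]) auto
    also have "\<dots> \<le> (\<integral>\<^sup>+z. A z \<partial>N)"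
    proof (rule nn_integral_mono)
      fix z
      show "(\<Sum>k\<in>key ` U. A z * indicator (C k) z) \<le> A z"
      proof (cases "z \<in> U")
        case True
        have ind: "indicator (C k) z = (if k = key z then 1 else 0 :: ennreal)" for k
          using True by (auto simp: C_def indicator_def)
        show ?thesis using K True by (simp add: ind if_distrib cong: if_cong)
      next
        case False
        then have "indicator (C k) z = (0 :: ennreal)" for k by (auto simp: C_def indicator_def)
        then show ?thesis by simp
      qed
    qed
    finally show "(\<integral>\<^sup>+z. (\<integral>\<^sup>+\<omega>. ennreal ((h z \<omega> - (\<Sum>k\<in>key ` U. \<eta> k \<omega> * indicator (C k) z))\<^sup>2) \<partial>M) \<partial>N) \<le> (\<integral>\<^sup>+z. A z \<partial>N)" .
  qed
qed

section \<open>Translation in time\<close>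

definition time_shift :: "'d::finite \<Rightarrow> real \<Rightarrow> 'x \<times> (real ^ 'd) \<Rightarrow> 'x \<times> (real ^ 'd)" where
  "time_shift i \<delta> z = (fst z, snd z - axis i \<delta>)"

lemma time_shift_simps [simp]:
  "fst (time_shift i \<delta> z) = fst z" "snd (time_shift i \<delta> z) $ i = snd z $ i - \<delta>"
  "space_part i (snd (time_shift i \<delta> z)) = space_part i (snd z)"
  by (auto simp: time_shift_def space_part_def axis_def vec_eq_iff)

lemma space_pair_lborel: "z \<in> space (p \<Otimes>\<^sub>M lborel) \<longleftrightarrow> fst z \<in> space p"
  by (cases z) (simp add: space_pair_measure)

lemma time_shift_in_space [simp]:
  "time_shift i \<delta> z \<in> space (p \<Otimes>\<^sub>M lborel) \<longleftrightarrow> z \<in> space (p \<Otimes>\<^sub>M lborel)"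
  by (simp add: space_pair_lborel)

lemma measurable_time_shift [measurable]:
  "time_shift i \<delta> \<in> measurable (p \<Otimes>\<^sub>M lborel) (p \<Otimes>\<^sub>M lborel)"
  unfolding time_shift_def by measurable

lemma measurable_snd_nth:
  fixes i :: "'d::finite"
  shows "(\<lambda>z. snd z $ i) \<in> borel_measurable (p \<Otimes>\<^sub>M (lborel :: (real ^ 'd) measure))"
proof -
  have "(\<lambda>s :: real ^ 'd. s $ i) \<in> borel_measurable lborel"
    by (simp add: borel_measurable_continuous_onI continuous_on_component)
  from measurable_compose[OF measurable_snd this] show ?thesis .
qed

lemma distr_time_shift:
  fixes i :: "'d::finite"
  assumes p: "prob_space p"
  shows "distr (p \<Otimes>\<^sub>M lborel) (p \<Otimes>\<^sub>M lborel) (time_shift i \<delta>) = p \<Otimes>\<^sub>M (lborel :: (real ^ 'd) measure)"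
proof -
  have shift: "distr lborel lborel (\<lambda>s. s - axis i \<delta>) = (lborel :: (real ^ 'd) measure)"
  proof -
    have "distr lborel lborel (\<lambda>s. s - axis i \<delta>) = distr lborel borel ((+) (- axis i \<delta>) :: real ^ 'd \<Rightarrow> _)"
      by (intro distr_cong) auto
    then show ?thesis using lborel_distr_plus by metis
  qed
  interpret prob_space p by fact
  have "p \<Otimes>\<^sub>M (lborel :: (real ^ 'd) measure) = distr p p (\<lambda>x. x) \<Otimes>\<^sub>M distr lborel lborel (\<lambda>s. s - axis i \<delta>)"
    by (simp only: shift distr_id)
  also have "\<dots> = distr (p \<Otimes>\<^sub>M lborel) (p \<Otimes>\<^sub>M lborel) (\<lambda>(x, s). (x, s - axis i \<delta>))"
    by (intro pair_measure_distr) (auto simp: shift sigma_finite_lborel)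
  finally show ?thesis by (simp add: time_shift_def[abs_def] case_prod_beta')
qed

lemma nn_integral_time_shift:
  assumes "prob_space p" "u \<in> borel_measurable (p \<Otimes>\<^sub>M lborel)"
  shows "(\<integral>\<^sup>+z. u (time_shift i \<delta> z) \<partial>(p \<Otimes>\<^sub>M lborel)) = (\<integral>\<^sup>+z. u z \<partial>(p \<Otimes>\<^sub>M lborel))"
  by (subst (2) distr_time_shift[OF assms(1), of i \<delta>, symmetric]) (use assms(2) in \<open>simp add: nn_integral_distr\<close>)

lemma time_rectangle_iff:
  "z \<in> time_rectangle i N a b B \<longleftrightarrow>
    z \<in> space N \<and> a < snd z $ i \<and> snd z $ i \<le> b \<and> (fst z, space_part i (snd z)) \<in> B"
  by (cases z) (simp add: time_rectangle_def)

text \<open>Only the slice of a rectangle just after its initial time leaves the rectangle under a small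
  delay; as translations preserve the measure, equally much enters.\<close>

lemma time_rectangle_shift:
  fixes i :: "'d::finite" and p :: "'x measure"
  defines "N \<equiv> p \<Otimes>\<^sub>M (lborel :: (real ^ 'd) measure)"
  assumes p: "prob_space p" and R: "time_rectangle i N a b B \<in> fmeasurable N" (is "?R \<in> _")
  shows "(\<lambda>l. \<integral>\<^sup>+z. ennreal ((indicator ?R z - indicator ?R (time_shift i (1 / real (Suc l)) z))\<^sup>2) \<partial>N) \<longlonglongrightarrow> 0"
proof -
  define T where "T l = time_shift i (1 / real (Suc l)) -` ?R \<inter> space N" for l
  define D where "D l = ?R \<inter> {z \<in> space N. snd z $ i \<le> a + 1 / real (Suc l)}" for l
  have Rs [measurable]: "?R \<in> sets N" using R by auto
  have Ts [measurable]: "T l \<in> sets N" for l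
    unfolding T_def N_def by (rule measurable_sets[OF measurable_time_shift Rs[unfolded N_def]])
  have coord [measurable]: "(\<lambda>z. snd z $ i) \<in> borel_measurable N"
    unfolding N_def by (rule measurable_snd_nth)
  have Ds [measurable]: "D l \<in> sets N" for l unfolding D_def by measurable
  have eT: "emeasure N (T l) = emeasure N ?R" for l
  proof -
    have "time_shift i (1 / real (Suc l)) \<in> measurable N N" unfolding N_def by measurable
    then have "emeasure N (T l) = emeasure (distr N N (time_shift i (1 / real (Suc l)))) ?R"
      unfolding T_def by (intro emeasure_distr[symmetric] Rs)
    also have "distr N N (time_shift i (1 / real (Suc l))) = N"
      unfolding N_def by (rule distr_time_shift[OF p])
    finally show ?thesis .
  qed
  have Tf: "T l \<in> fmeasurable N" for l using R Ts eT by (simp add: fmeasurable_def)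
  have diff: "emeasure N (T l - ?R) = emeasure N (?R - T l)" for l
  proof -
    have "emeasure N (T l \<inter> ?R) + emeasure N (T l - ?R) = emeasure N (T l)"
      by (subst plus_emeasure) (auto intro!: arg_cong[of _ _ "emeasure N"])
    also have "\<dots> = emeasure N (T l \<inter> ?R) + emeasure N (?R - T l)"
      unfolding eT by (subst plus_emeasure) (auto intro!: arg_cong[of _ _ "emeasure N"])
    finally have "emeasure N (T l \<inter> ?R) + emeasure N (T l - ?R) = emeasure N (T l \<inter> ?R) + emeasure N (?R - T l)" .
    moreover have "emeasure N (T l \<inter> ?R) < \<infinity>"
      using emeasure_mono[of "T l \<inter> ?R" ?R N] R by (auto simp: fmeasurable_def)
    ultimately show ?thesis by (auto simp: ennreal_add_left_cancel)
  qed
  have bound: "(\<integral>\<^sup>+z. ennreal ((indicator ?R z - indicator ?R (time_shift i (1 / real (Suc l)) z))\<^sup>2) \<partial>N) \<le> 2 * emeasure N (D l)" for l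
  proof -
    have "(\<integral>\<^sup>+z. ennreal ((indicator ?R z - indicator ?R (time_shift i (1 / real (Suc l)) z))\<^sup>2) \<partial>N)
        = (\<integral>\<^sup>+z. indicator ((?R - T l) \<union> (T l - ?R)) z \<partial>N)"
      by (intro nn_integral_cong) (auto simp: T_def indicator_def)
    also have "\<dots> = emeasure N ((?R - T l) \<union> (T l - ?R))" by (rule nn_integral_indicator) measurable
    also have "\<dots> = 2 * emeasure N (?R - T l)"
      by (subst plus_emeasure[symmetric]) (auto simp: diff mult_2)
    also have "\<dots> \<le> 2 * emeasure N (D l)"
    proof (intro mult_left_mono emeasure_mono)
      show "?R - T l \<subseteq> D l"
      proof
        fix z assume z: "z \<in> ?R - T l"
        have "time_shift i (1 / real (Suc l)) z \<notin> ?R" using z by (auto simp: T_def time_rectangle_def)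
        moreover have "0 \<le> 1 / real (Suc l)" by simp
        moreover have "z \<in> ?R" using z by simp
        ultimately have "snd z $ i - 1 / real (Suc l) \<le> a"
          unfolding N_def time_rectangle_iff time_shift_simps time_shift_in_space by linarith
        then show "z \<in> D l" using z by (auto simp: D_def time_rectangle_def)
      qed
    qed auto
    finally show ?thesis .
  qed
  have "(\<lambda>l. emeasure N (D l)) \<longlonglongrightarrow> emeasure N (\<Inter>l. D l)"
  proof (rule Lim_emeasure_decseq)
    show "decseq D"
      unfolding decseq_def D_def by (auto intro: order_trans simp: frac_le)
    show "emeasure N (D l) \<noteq> \<infinity>" for l
      using emeasure_mono[of "D l" ?R N] R by (auto simp: D_def fmeasurable_def top_unique)
  qed auto
  moreover have "(\<Inter>l. D l) = {}"
  proof -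
    have "\<exists>l. \<not> snd z $ i \<le> a + 1 / real (Suc l)" if "z \<in> ?R" for z
    proof -
      have "0 < snd z $ i - a" using that by (auto simp: time_rectangle_def)
      from nat_approx_posE[OF this] obtain l where "1 / real (Suc l) < snd z $ i - a" by blast
      then show ?thesis by (intro exI[of _ l]) simp
    qed
    then show ?thesis by (auto simp: D_def)
  qed
  ultimately have "(\<lambda>l. 2 * emeasure N (D l)) \<longlonglongrightarrow> 2 * 0"
    by (intro ennreal_tendsto_cmult) auto
  then have lim: "(\<lambda>l. 2 * emeasure N (D l)) \<longlonglongrightarrow> 0" by simp
  show ?thesis
    by (rule tendsto_sandwich[OF _ _ tendsto_const lim]) (intro always_eventually allI zero_le bound)+
qed

section \<open>Approximating Walsh integrals by sampled integrands\<close>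

text \<open>The coefficients are bounded, so the claim reduces to the rectangles.\<close>

lemma walsh_simple_fun_time_shift:
  fixes i :: "'d::finite" and p :: "'x measure"
  defines "N \<equiv> p \<Otimes>\<^sub>M (lborel :: (real ^ 'd) measure)"
  assumes M: "prob_space M" and p: "prob_space p"
    and F: "\<And>r. subalgebra M (F r)" and simple: "walsh_simple i N F n \<xi> a b B"
  shows "(\<lambda>l. \<integral>\<^sup>+\<omega>. \<integral>\<^sup>+z. ennreal ((walsh_simple_fun i N n \<xi> a b B z \<omega> -
      walsh_simple_fun i N n \<xi> a b B (time_shift i (1 / real (Suc l)) z) \<omega>)\<^sup>2) \<partial>N \<partial>M) \<longlonglongrightarrow> 0"
proof -
  interpret prob_space M by fact
  define R where "R j = time_rectangle i N (a j) (b j) (B j)" for j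
  define T :: "nat \<Rightarrow> 'x \<times> (real ^ 'd) \<Rightarrow> 'x \<times> (real ^ 'd)" where "T l = time_shift i (1 / real (Suc l))" for l
  define E where "E l j = (\<integral>\<^sup>+z. ennreal ((indicator (R j) z - indicator (R j) (T l z))\<^sup>2) \<partial>N)" for l j
  have R: "R j \<in> fmeasurable N" if "j < n" for j
    using simple that by (simp add: walsh_simple_def R_def)
  have T [measurable]: "T l \<in> measurable N N" for l unfolding N_def T_def by measurable
  have "\<forall>j. \<exists>c. j < n \<longrightarrow> (\<forall>\<omega>\<in>space M. \<bar>\<xi> j \<omega>\<bar> \<le> c)"
    using simple F unfolding walsh_simple_def bounded_real subalgebra_def by fastforce
  from choice[OF this] obtain c where c: "\<And>j \<omega>. j < n \<Longrightarrow> \<omega> \<in> space M \<Longrightarrow> \<bar>\<xi> j \<omega>\<bar> \<le> c j"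
    by blast
  define Z where "Z l = (\<Sum>j<n. ennreal (real n * (c j)\<^sup>2) * E l j)" for l
  have bound: "(\<integral>\<^sup>+\<omega>. \<integral>\<^sup>+z. ennreal ((walsh_simple_fun i N n \<xi> a b B z \<omega> -
      walsh_simple_fun i N n \<xi> a b B (T l z) \<omega>)\<^sup>2) \<partial>N \<partial>M) \<le> Z l" for l
  proof -
    have "(\<integral>\<^sup>+z. ennreal ((walsh_simple_fun i N n \<xi> a b B z \<omega> -
      walsh_simple_fun i N n \<xi> a b B (T l z) \<omega>)\<^sup>2) \<partial>N) \<le> Z l" if \<omega>: "\<omega> \<in> space M" for \<omega>
    proof -
      have "(walsh_simple_fun i N n \<xi> a b B z \<omega> - walsh_simple_fun i N n \<xi> a b B (T l z) \<omega>)\<^sup>2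
          \<le> (\<Sum>j<n. real n * (c j)\<^sup>2 * (indicator (R j) z - indicator (R j) (T l z))\<^sup>2)" for z
      proof -
        have "(walsh_simple_fun i N n \<xi> a b B z \<omega> - walsh_simple_fun i N n \<xi> a b B (T l z) \<omega>)\<^sup>2
            = (\<Sum>j<n. \<xi> j \<omega> * (indicator (R j) z - indicator (R j) (T l z)))\<^sup>2"
          by (simp only: walsh_simple_fun_def R_def sum_subtractf right_diff_distrib)
        also have "\<dots> \<le> (\<Sum>j<n. (\<xi> j \<omega> * (indicator (R j) z - indicator (R j) (T l z)))\<^sup>2) * card {..<n}"
          by (rule sum_squared_le_sum_of_squares)
        also have "\<dots> = (\<Sum>j<n. real n * (\<xi> j \<omega>)\<^sup>2 * (indicator (R j) z - indicator (R j) (T l z))\<^sup>2)"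
          by (simp add: sum_distrib_left sum_distrib_right power_mult_distrib mult_ac)
        also have "\<dots> \<le> (\<Sum>j<n. real n * (c j)\<^sup>2 * (indicator (R j) z - indicator (R j) (T l z))\<^sup>2)"
          using c[OF _ \<omega>] by (intro sum_mono mult_right_mono mult_left_mono abs_le_square_iff[THEN iffD1])
            (auto intro: order_trans[OF _ abs_ge_self])
        finally show ?thesis .
      qed
      then have "(\<integral>\<^sup>+z. ennreal ((walsh_simple_fun i N n \<xi> a b B z \<omega> - walsh_simple_fun i N n \<xi> a b B (T l z) \<omega>)\<^sup>2) \<partial>N)
          \<le> (\<integral>\<^sup>+z. (\<Sum>j<n. ennreal (real n * (c j)\<^sup>2) * ennreal ((indicator (R j) z - indicator (R j) (T l z))\<^sup>2)) \<partial>N)"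
        by (intro nn_integral_mono) (simp add: sum_ennreal ennreal_leI flip: ennreal_mult)
      also have "\<dots> = Z l"
      proof -
        have [measurable]: "R j \<in> sets N" if "j < n" for j using R[OF that] by auto
        show ?thesis unfolding Z_def E_def
          by (subst nn_integral_sum) (auto intro!: sum.cong nn_integral_cmult)
      qed
      finally show ?thesis .
    qed
    then have "(\<integral>\<^sup>+\<omega>. \<integral>\<^sup>+z. ennreal ((walsh_simple_fun i N n \<xi> a b B z \<omega> -
        walsh_simple_fun i N n \<xi> a b B (T l z) \<omega>)\<^sup>2) \<partial>N \<partial>M) \<le> (\<integral>\<^sup>+\<omega>. Z l \<partial>M)"
      by (intro nn_integral_mono)
    then show ?thesis by (simp add: emeasure_space_1)
  qed
  have "(\<lambda>l. E l j) \<longlonglongrightarrow> 0" if "j < n" for j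
    unfolding E_def R_def T_def N_def
    by (rule time_rectangle_shift[OF p]) (use R[OF that] in \<open>simp add: R_def N_def\<close>)
  then have "(\<lambda>l. ennreal (real n * (c j)\<^sup>2) * E l j) \<longlonglongrightarrow> ennreal (real n * (c j)\<^sup>2) * 0" if "j < n" for j
    using that by (intro ennreal_tendsto_cmult) auto
  then have "Z \<longlonglongrightarrow> (\<Sum>j<n. ennreal (real n * (c j)\<^sup>2) * 0)"
    unfolding Z_def by (intro tendsto_sum) auto
  then have lim: "Z \<longlonglongrightarrow> 0" by simp
  show ?thesis
    unfolding T_def[symmetric]
    by (rule tendsto_sandwich[OF _ _ tendsto_const lim]) (intro always_eventually allI zero_le bound)+
qed

lemma integrable_square_add:
  fixes f g :: "'a \<Rightarrow> real"
  assumes [measurable]: "f \<in> borel_measurable M" "g \<in> borel_measurable M"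
    and "integrable M (\<lambda>x. (f x)\<^sup>2)" "integrable M (\<lambda>x. (g x)\<^sup>2)"
  shows "integrable M (\<lambda>x. (f x + g x)\<^sup>2)"
  using assms integrable_mult_of_squares[OF assms(1,2,3,4)] by (simp add: power2_sum mult.assoc)

lemma integrable_square_sum:
  fixes f :: "'q \<Rightarrow> 'a \<Rightarrow> real"
  assumes "finite Q" "\<And>q. q \<in> Q \<Longrightarrow> f q \<in> borel_measurable M" "\<And>q. q \<in> Q \<Longrightarrow> integrable M (\<lambda>x. (f q x)\<^sup>2)"
  shows "integrable M (\<lambda>x. (\<Sum>q\<in>Q. f q x)\<^sup>2)"
  using assms by (induction Q) (auto intro!: integrable_square_add borel_measurable_sum)

locale walsh_product = walsh_basis M i "p \<Otimes>\<^sub>M lborel" W F + p: prob_space p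
  for M :: "'w measure" and i :: "'d::finite" and p :: "'x measure" and W F
begin

abbreviation N :: "('x \<times> (real ^ 'd)) measure" where "N \<equiv> p \<Otimes>\<^sub>M lborel"

abbreviation mean_sq :: "('x \<times> (real ^ 'd) \<Rightarrow> 'w \<Rightarrow> real) \<Rightarrow> ('x \<times> (real ^ 'd) \<Rightarrow> 'w \<Rightarrow> real) \<Rightarrow> ennreal" where
  "mean_sq u v \<equiv> sq_dist (N \<Otimes>\<^sub>M M) (case_prod u) (case_prod v)"

lemma sigma_finite_N: "sigma_finite_measure N"
proof -
  interpret pair_sigma_finite p lborel ..
  show ?thesis by (rule sigma_finite_measure_axioms)
qed

lemma pair_sigma_finite_N: "pair_sigma_finite N M"
  using sigma_finite_N sigma_finite_measure_axioms by (simp add: pair_sigma_finite_def)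

lemma walsh_simple_adapted_family:
  assumes simple: "walsh_simple i N F n \<xi> a b B"
  shows "adapted_family {..<n} \<xi> (\<lambda>j. time_rectangle i N (a j) (b j) (B j))"
  unfolding adapted_family_def
proof (intro conjI ballI)
  fix j assume j: "j \<in> {..<n}"
  then have \<xi>: "\<xi> j \<in> borel_measurable (F (a j))" "bounded (\<xi> j ` space (F (a j)))"
    and R: "time_rectangle i N (a j) (b j) (B j) \<in> fmeasurable N"
    using simple by (auto simp: walsh_simple_def)
  show "time_rectangle i N (a j) (b j) (B j) \<in> fmeasurable N" by fact
  show "\<exists>r. time_rectangle i N (a j) (b j) (B j) \<subseteq> future r \<and> \<xi> j \<in> borel_measurable (F r)"
    using \<xi>(1) by (intro exI[of _ "a j"]) (auto simp: time_rectangle_def)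
  obtain c where c: "\<And>\<omega>. \<omega> \<in> space M \<Longrightarrow> \<bar>\<xi> j \<omega>\<bar> \<le> c"
    using \<xi>(2) subalgebra_F[of "a j"] by (auto simp: bounded_real subalgebra_def)
  show "integrable M (\<lambda>\<omega>. (\<xi> j \<omega>)\<^sup>2)"
  proof (rule integrable_const_bound[of _ "c\<^sup>2"])
    have "\<xi> j \<in> borel_measurable M" using \<xi>(1) by (rule measurable_F_imp_measurable)
    then show "(\<lambda>\<omega>. (\<xi> j \<omega>)\<^sup>2) \<in> borel_measurable M" by measurable
    show "AE \<omega> in M. norm ((\<xi> j \<omega>)\<^sup>2) \<le> c\<^sup>2"
      using power_mono[OF c abs_ge_zero, of _ 2] by (intro AE_I2) simp
  qed
qed simp

lemma measurable_simple_sum: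
  fixes \<eta> :: "'q \<Rightarrow> 'w \<Rightarrow> real"
  assumes "\<And>q. q \<in> Q \<Longrightarrow> C q \<in> fmeasurable N" "\<And>q. q \<in> Q \<Longrightarrow> \<eta> q \<in> borel_measurable M"
  shows "case_prod (step Q \<eta> C) \<in> borel_measurable (N \<Otimes>\<^sub>M M)"
proof -
  have "(\<lambda>x. \<eta> q (snd x) * indicator (C q) (fst x)) \<in> borel_measurable (N \<Otimes>\<^sub>M M)" if "q \<in> Q" for q
  proof (rule borel_measurable_times)
    have "(indicator (C q) :: _ \<Rightarrow> real) \<in> borel_measurable N" using assms(1)[OF that] by auto
    from measurable_compose[OF measurable_fst this]
    show "(\<lambda>x. indicator (C q) (fst x) :: real) \<in> borel_measurable (N \<Otimes>\<^sub>M M)" .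
    show "(\<lambda>x. \<eta> q (snd x)) \<in> borel_measurable (N \<Otimes>\<^sub>M M)"
      by (rule measurable_compose[OF measurable_snd assms(2)[OF that]])
  qed
  then show ?thesis by (simp add: case_prod_beta' borel_measurable_sum)
qed

lemma sq_dist_swap:
  assumes "case_prod u \<in> borel_measurable (N \<Otimes>\<^sub>M M)" "case_prod v \<in> borel_measurable (N \<Otimes>\<^sub>M M)"
  shows "mean_sq u v = (\<integral>\<^sup>+\<omega>. \<integral>\<^sup>+z. ennreal ((u z \<omega> - v z \<omega>)\<^sup>2) \<partial>N \<partial>M)"
    and "mean_sq u v = (\<integral>\<^sup>+z. \<integral>\<^sup>+\<omega>. ennreal ((u z \<omega> - v z \<omega>)\<^sup>2) \<partial>M \<partial>N)"
proof -
  interpret PS: pair_sigma_finite N M by (rule pair_sigma_finite_N)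
  have m: "(\<lambda>x. ennreal ((case_prod u x - case_prod v x)\<^sup>2)) \<in> borel_measurable (N \<Otimes>\<^sub>M M)"
    using assms by measurable
  show "mean_sq u v = (\<integral>\<^sup>+\<omega>. \<integral>\<^sup>+z. ennreal ((u z \<omega> - v z \<omega>)\<^sup>2) \<partial>N \<partial>M)"
    using PS.nn_integral_snd[OF m] by (simp add: sq_dist_def)
  show "mean_sq u v = (\<integral>\<^sup>+z. \<integral>\<^sup>+\<omega>. ennreal ((u z \<omega> - v z \<omega>)\<^sup>2) \<partial>M \<partial>N)"
    using nn_integral_fst[OF m] by (simp add: sq_dist_def)
qed

text \<open>The coefficients of simple functions that approximate \<open>f\<close> may depend on the past of \<open>W\<close>, even if
  \<open>f\<close> itself is independent of \<open>W\<close>.  They are therefore replaced by sampled values of \<open>f\<close>, at a point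
  of each cell on which the simple function is constant.  Such a value is known only at the time of
  the sample point, which lies within the cell.  So time is cut into steps of length \<open>\<delta>\<close> and every
  cell is delayed by \<open>\<delta>\<close>, which makes the sampled value adapted; by continuity of translations the
  delay costs little.  By the isometry the corresponding integrals remain close to \<open>I\<close>.\<close>

lemma walsh_integral_sampled:
  fixes f :: "'x \<times> (real ^ 'd) \<Rightarrow> 'w \<Rightarrow> real"
  assumes f: "case_prod f \<in> borel_measurable (N \<Otimes>\<^sub>M M)"
    and adapted: "\<And>z. z \<in> space N \<Longrightarrow> f z \<in> borel_measurable (F (snd z $ i))"
    and I: "walsh_integral i M N W F f I" and e: "0 < (e::real)"
  shows "\<exists>(K :: (nat set \<times> int) set) \<eta> C. adapted_family K \<eta> C \<and> disjoint_family_on C K \<and>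
    (\<forall>k\<in>K. \<eta> k = (\<lambda>_. 0) \<or> (\<exists>z\<in>space N. \<eta> k = f z)) \<and>
    mean_sq f (step K \<eta> C) < ennreal e \<and>
    sq_dist M I (step_integral K \<eta> C) < ennreal e"
proof -
  \<comment> \<open>Two successive uses of the quasi-triangle inequality cost a factor \<open>10\<close>.\<close>
  define \<epsilon> where "\<epsilon> = ennreal (e / 11)"
  have \<epsilon>: "0 < \<epsilon>" "\<epsilon> < \<infinity>" "10 * \<epsilon> < ennreal e"
    using e by (auto simp: \<epsilon>_def ennreal_lessI simp flip: ennreal_numeral ennreal_mult')
  have I_M: "I \<in> borel_measurable M" using I by (simp add: walsh_integral_def)
  obtain n \<xi> a b B where simple: "\<forall>m. walsh_simple i N F (n m) (\<xi> m) (a m) (b m) (B m)"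
    and lim1: "(\<lambda>m. \<integral>\<^sup>+(z, \<omega>). ennreal ((f z \<omega> - walsh_simple_fun i N (n m) (\<xi> m) (a m) (b m) (B m) z \<omega>)\<^sup>2)
          \<partial>(N \<Otimes>\<^sub>M M)) \<longlonglongrightarrow> 0"
    and lim2: "(\<lambda>m. \<integral>\<^sup>+\<omega>. ennreal ((I \<omega> - walsh_simple_integral i N W (n m) (\<xi> m) (a m) (b m) (B m) \<omega>)\<^sup>2) \<partial>M) \<longlonglongrightarrow> 0"
    using I unfolding walsh_integral_def by (elim conjE exE) (rule that, assumption+)
  obtain m where
    m1: "(\<integral>\<^sup>+(z, \<omega>). ennreal ((f z \<omega> - walsh_simple_fun i N (n m) (\<xi> m) (a m) (b m) (B m) z \<omega>)\<^sup>2) \<partial>(N \<Otimes>\<^sub>M M)) < \<epsilon>"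
    and m2: "(\<integral>\<^sup>+\<omega>. ennreal ((I \<omega> - walsh_simple_integral i N W (n m) (\<xi> m) (a m) (b m) (B m) \<omega>)\<^sup>2) \<partial>M) < \<epsilon>"
    using eventually_happens'[OF sequentially_bot
        eventually_conj[OF order_tendstoD(2)[OF lim1 \<epsilon>(1)] order_tendstoD(2)[OF lim2 \<epsilon>(1)]]] by blast
  define R where "R j = time_rectangle i N (a m j) (b m j) (B m j)" for j
  define h where "h z \<omega> = (\<Sum>j<n m. \<xi> m j \<omega> * indicator (R j) z)" for z \<omega>
  have h_eq: "walsh_simple_fun i N (n m) (\<xi> m) (a m) (b m) (B m) = h"
    by (simp add: fun_eq_iff h_def walsh_simple_fun_def R_def)
  define J where "J \<omega> = (\<Sum>j<n m. \<xi> m j \<omega> * W (R j) \<omega>)" for \<omega>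
  have J_eq: "walsh_simple_integral i N W (n m) (\<xi> m) (a m) (b m) (B m) = J"
    by (simp add: fun_eq_iff J_def walsh_simple_integral_def R_def)
  have fam_h: "adapted_family {..<n m} (\<xi> m) R"
    using walsh_simple_adapted_family[OF simple[rule_format, of m]] unfolding R_def .
  have h_meas: "case_prod h \<in> borel_measurable (N \<Otimes>\<^sub>M M)"
    unfolding h_def by (rule measurable_simple_sum) (rule adapted_familyD[OF fam_h], assumption)+
  have fh: "mean_sq f h < \<epsilon>"
    using m1 by (simp add: h_eq sq_dist_def case_prod_beta')
  have IJ: "sq_dist M I J < \<epsilon>" using m2 by (simp add: J_eq sq_dist_def)
  obtain l where l: "(\<integral>\<^sup>+\<omega>. \<integral>\<^sup>+z. ennreal ((h z \<omega> - h (time_shift i (1 / real (Suc l)) z) \<omega>)\<^sup>2) \<partial>N \<partial>M) < \<epsilon>"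
    using eventually_happens'[OF sequentially_bot order_tendstoD(2)[OF walsh_simple_fun_time_shift[
        OF prob_space_axioms p.prob_space_axioms subalgebra_F simple[rule_format, of m]] \<epsilon>(1)]]
    unfolding h_eq by blast
  define \<delta> where "\<delta> = 1 / real (Suc l)"
  have \<delta>: "0 < \<delta>" by (simp add: \<delta>_def)
  define T :: "'x \<times> (real ^ 'd) \<Rightarrow> 'x \<times> (real ^ 'd)" where "T = time_shift i \<delta>"
  have T [measurable]: "T \<in> measurable N N" unfolding T_def by measurable
  have hT_meas: "case_prod (\<lambda>z. h (T z)) \<in> borel_measurable (N \<Otimes>\<^sub>M M)"
  proof -
    have "(\<lambda>x. (T (fst x), snd x)) \<in> measurable (N \<Otimes>\<^sub>M M) (N \<Otimes>\<^sub>M M)" by measurable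
    from measurable_compose[OF this h_meas] show ?thesis by (simp add: case_prod_beta')
  qed
  have hT: "mean_sq h (\<lambda>z. h (T z)) < \<epsilon>"
    using l unfolding sq_dist_swap(1)[OF h_meas hT_meas] by (simp add: T_def \<delta>_def)

  \<comment> \<open>The key records the rectangles containing the point and its time up to the mesh size.\<close>
  define U where "U = (\<Union>j<n m. R j)"
  define key where "key z = ({j. j < n m \<and> z \<in> R j}, \<lceil>snd z $ i / \<delta>\<rceil>)" for z
  define C where "C k = {z \<in> U. key z = k}" for k
  define K where "K = key ` U"
  have Rf: "R j \<in> fmeasurable N" if "j < n m" for j using adapted_familyD(2)[OF fam_h] that by simp
  have Uf: "U \<in> fmeasurable N" unfolding U_def using Rf by (intro fmeasurable.finite_UN) auto
  have U_sp: "U \<subseteq> space N" using Uf fmeasurableD sets.sets_into_space by blast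
  have K_fin: "finite K"
  proof -
    have fst: "fst ` K \<subseteq> Pow {..<n m}" by (auto simp: K_def key_def)
    have "\<exists>q. snd ` K \<subseteq> {-q..q}"
    proof -
      define c where "c = (\<Sum>j<n m. \<bar>a m j\<bar> + \<bar>b m j\<bar>) / \<delta>"
      have "\<bar>\<lceil>snd z $ i / \<delta>\<rceil>\<bar> \<le> \<lceil>c\<rceil> + 1" if zU: "z \<in> U" for z
      proof -
        obtain j where j: "j < n m" "z \<in> R j" using zU by (auto simp: U_def)
        have "\<bar>snd z $ i\<bar> \<le> \<bar>a m j\<bar> + \<bar>b m j\<bar>"
          using j(2) by (auto simp: R_def time_rectangle_iff)
        also have "\<dots> \<le> (\<Sum>j<n m. \<bar>a m j\<bar> + \<bar>b m j\<bar>)"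
          using j(1) by (intro member_le_sum) auto
        finally have "\<bar>snd z $ i / \<delta>\<bar> \<le> c" using \<delta> by (simp add: c_def divide_right_mono abs_divide)
        then show ?thesis by linarith
      qed
      then have "snd ` K \<subseteq> {-(\<lceil>c\<rceil> + 1)..\<lceil>c\<rceil> + 1}" by (fastforce simp: K_def key_def abs_le_iff)
      then show ?thesis by blast
    qed
    then have "finite (snd ` K)" using finite_subset by blast
    moreover have "finite (fst ` K)" using fst by (rule finite_subset) simp
    moreover have "K \<subseteq> fst ` K \<times> snd ` K" by force
    ultimately show ?thesis by (meson finite_SigmaI finite_subset)
  qed
  have Cf: "C k \<in> fmeasurable N" for k
  proof (rule fmeasurableI2[OF Uf])
    have [measurable]: "U \<in> sets N" "(\<lambda>z. snd z $ i) \<in> borel_measurable N"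
      using Uf by (auto intro: measurable_snd_nth)
    have [measurable]: "R j \<in> sets N" if "j < n m" for j using Rf[OF that] by auto
    have "C k = {z \<in> space N. z \<in> U \<and> fst k \<subseteq> {..<n m} \<and> (\<forall>j\<in>{..<n m}. z \<in> R j \<longleftrightarrow> j \<in> fst k) \<and> \<lceil>snd z $ i / \<delta>\<rceil> = snd k}"
      using U_sp by (cases k) (auto simp: C_def key_def)
    also have "\<dots> \<in> sets N" by measurable
    finally show "C k \<in> sets N" .
  qed (auto simp: C_def)
  have h_const: "h z \<omega> = h z' \<omega>" if "key z = key z'" for z z' \<omega>
  proof -
    have "{j. j < n m \<and> z \<in> R j} = {j. j < n m \<and> z' \<in> R j}" using that by (simp add: key_def)
    then have "\<And>j. j < n m \<Longrightarrow> z \<in> R j \<longleftrightarrow> z' \<in> R j" by blast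
    then show ?thesis unfolding h_def by (intro sum.cong) (auto simp: indicator_def)
  qed
  have h_zero: "h z \<omega> = 0" if "z \<notin> U" for z \<omega>
    using that unfolding h_def by (intro sum.neutral) (auto simp: U_def)
  define A where "A z = (\<integral>\<^sup>+\<omega>. ennreal ((f z \<omega> - h z \<omega>)\<^sup>2) \<partial>M)" for z
  have A_meas: "A \<in> borel_measurable N"
  proof -
    have "(\<lambda>x. ennreal (((case_prod f) x - (case_prod h) x)\<^sup>2)) \<in> borel_measurable (N \<Otimes>\<^sub>M M)"
      using f h_meas by measurable
    from borel_measurable_nn_integral_fst[OF this] show ?thesis by (simp add: A_def[abs_def])
  qed
  have A_int: "(\<integral>\<^sup>+z. A z \<partial>N) < \<epsilon>"
    using fh unfolding sq_dist_swap(2)[OF f h_meas] A_def .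
  have h_const': "z \<in> U \<Longrightarrow> z' \<in> U \<Longrightarrow> key z = key z' \<Longrightarrow> h z \<omega> = h z' \<omega>" for z z' \<omega>
    by (rule h_const)
  obtain \<zeta> where samp: "(\<forall>k\<in>K. \<zeta> k \<in> C k) \<and>
    (\<forall>k\<in>K. A (\<zeta> k) * emeasure N (C k) \<le> (\<integral>\<^sup>+z. A z \<partial>N)) \<and>
    (\<forall>\<eta>. (\<forall>k\<in>K. emeasure N (C k) \<noteq> 0 \<longrightarrow> \<eta> k = f (\<zeta> k)) \<longrightarrow>
      (\<integral>\<^sup>+z. (\<integral>\<^sup>+\<omega>. ennreal ((h z \<omega> - step K \<eta> C z \<omega>)\<^sup>2) \<partial>M) \<partial>N) \<le> (\<integral>\<^sup>+z. A z \<partial>N))"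
    using sampling[OF A_meas[unfolded A_def[abs_def]] K_fin[unfolded K_def] C_def Cf h_const' h_zero]
    unfolding K_def[symmetric] A_def[symmetric] by (rule exE)
  note \<zeta> = samp[THEN conjunct1, rule_format]
    and \<zeta>A = samp[THEN conjunct2, THEN conjunct1, rule_format]
    and \<zeta>h = samp[THEN conjunct2, THEN conjunct2, rule_format]
  \<comment> \<open>On a null cell the sampled value need not be square integrable; there it is replaced by \<open>0\<close>.\<close>
  define \<eta> where "\<eta> k = (if emeasure N (C k) = 0 then (\<lambda>_. 0) else f (\<zeta> k))" for k
  define C' where "C' k = T -` C k \<inter> space N" for k
  have \<eta>_M: "\<eta> k \<in> borel_measurable M" if "k \<in> K" for k
    using adapted[of "\<zeta> k"] \<zeta>[OF that] U_sp by (auto simp: \<eta>_def C_def intro: measurable_F_imp_measurable)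
  have \<eta>_sq: "integrable M (\<lambda>\<omega>. (\<eta> k \<omega>)\<^sup>2)" if k: "k \<in> K" for k
  proof (cases "emeasure N (C k) = 0")
    case False
    have f_M: "f (\<zeta> k) \<in> borel_measurable M" using \<eta>_M[OF k] False by (simp add: \<eta>_def)
    have \<xi>: "(\<lambda>\<omega>. \<xi> m j \<omega> * indicator (R j) (\<zeta> k)) \<in> borel_measurable M"
      "integrable M (\<lambda>\<omega>. (\<xi> m j \<omega> * indicator (R j) (\<zeta> k))\<^sup>2)" if "j < n m" for j
      using adapted_familyD(3,4)[OF fam_h, of j] that by (simp_all add: power_mult_distrib)
    have h_M: "h (\<zeta> k) \<in> borel_measurable M"
      unfolding h_def by (rule borel_measurable_sum) (rule \<xi>(1), simp)
    have h_sq: "integrable M (\<lambda>\<omega>. (h (\<zeta> k) \<omega>)\<^sup>2)"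
      unfolding h_def by (rule integrable_square_sum) (simp, (rule \<xi>, simp)+)
    have "A (\<zeta> k) * emeasure N (C k) < \<infinity>"
      using \<zeta>A[OF k] A_int \<epsilon>(2) by (auto intro: le_less_trans less_trans)
    then have "A (\<zeta> k) < \<infinity>" using False by (auto simp: ennreal_mult_less_top)
    then have "integrable M (\<lambda>\<omega>. (f (\<zeta> k) \<omega> - h (\<zeta> k) \<omega>)\<^sup>2)"
      unfolding A_def using f_M h_M by (intro integrableI_nonneg) auto
    from integrable_square_add[OF _ h_M this h_sq] f_M h_M show ?thesis using False by (simp add: \<eta>_def)
  qed (simp add: \<eta>_def)
  have C'_emeasure: "emeasure N (C' k) = emeasure N (C k)" for k
  proof -
    have "emeasure N (C' k) = emeasure (distr N N T) (C k)"
      unfolding C'_def using Cf[of k] by (intro emeasure_distr[symmetric] T) auto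
    also have "distr N N T = N" unfolding T_def by (rule distr_time_shift[OF p.prob_space_axioms])
    finally show ?thesis .
  qed
  have C'f: "C' k \<in> fmeasurable N" for k
    using Cf[of k] measurable_sets[OF T, of "C k"] C'_emeasure[of k] by (simp add: fmeasurable_def C'_def)
  have fam: "adapted_family K \<eta> C'"
    unfolding adapted_family_def
  proof (intro conjI ballI K_fin C'f \<eta>_sq)
    fix k assume k: "k \<in> K"
    show "\<exists>r. C' k \<subseteq> future r \<and> \<eta> k \<in> borel_measurable (F r)"
    proof (intro exI conjI)
      show "C' k \<subseteq> future (\<delta> * snd k)"
      proof
        fix z assume "z \<in> C' k"
        then have "key (T z) = k" by (simp add: C'_def C_def)
        from arg_cong[OF this, of snd] have "\<lceil>(snd z $ i - \<delta>) / \<delta>\<rceil> = snd k" by (simp add: key_def T_def)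
        then have "snd k - 1 < (snd z $ i - \<delta>) / \<delta>" by linarith
        then show "z \<in> future (\<delta> * snd k)" using \<delta> by (simp add: field_simps case_prod_beta')
      qed
      have "key (\<zeta> k) = k" using \<zeta>[OF k] by (simp add: C_def)
      from arg_cong[OF this, of snd] have "\<lceil>snd (\<zeta> k) $ i / \<delta>\<rceil> = snd k" by (simp add: key_def)
      then have "snd (\<zeta> k) $ i / \<delta> \<le> snd k" by linarith
      then have "snd (\<zeta> k) $ i \<le> \<delta> * snd k" using \<delta> by (simp add: field_simps)
      moreover have "f (\<zeta> k) \<in> borel_measurable (F (snd (\<zeta> k) $ i))"
        using \<zeta>[OF k] U_sp by (intro adapted) (auto simp: C_def)
      ultimately have "f (\<zeta> k) \<in> borel_measurable (F (\<delta> * snd k))" by (rule measurable_F_mono)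
      then show "\<eta> k \<in> borel_measurable (F (\<delta> * snd k))" by (simp add: \<eta>_def)
    qed
  qed
  have f'_meas: "case_prod (step K \<eta> C') \<in> borel_measurable (N \<Otimes>\<^sub>M M)"
    using C'f \<eta>_M by (intro measurable_simple_sum)
  have g_meas: "case_prod (step K \<eta> C) \<in> borel_measurable (N \<Otimes>\<^sub>M M)"
    using Cf \<eta>_M by (intro measurable_simple_sum)
  have hT_f': "mean_sq (\<lambda>z. h (T z)) (step K \<eta> C') \<le> \<epsilon>"
  proof -
    have "mean_sq (\<lambda>z. h (T z)) (step K \<eta> C')
        = (\<integral>\<^sup>+\<omega>. \<integral>\<^sup>+z. ennreal ((h (T z) \<omega> - step K \<eta> C' z \<omega>)\<^sup>2) \<partial>N \<partial>M)"
      by (rule sq_dist_swap(1)[OF hT_meas f'_meas])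
    also have "\<dots> = (\<integral>\<^sup>+\<omega>. \<integral>\<^sup>+z. ennreal ((h (T z) \<omega> - (\<Sum>k\<in>K. \<eta> k \<omega> * indicator (C k) (T z)))\<^sup>2) \<partial>N \<partial>M)"
      by (intro nn_integral_cong) (simp add: C'_def indicator_def)
    also have "\<dots> = (\<integral>\<^sup>+\<omega>. \<integral>\<^sup>+z. ennreal ((h z \<omega> - step K \<eta> C z \<omega>)\<^sup>2) \<partial>N \<partial>M)"
    proof (rule nn_integral_cong)
      fix \<omega> assume \<omega>: "\<omega> \<in> space M"
      have "(\<lambda>z. ennreal ((h z \<omega> - step K \<eta> C z \<omega>)\<^sup>2)) \<in> borel_measurable N"
      proof -
        have "(\<lambda>z. (z, \<omega>)) \<in> measurable N (N \<Otimes>\<^sub>M M)" using \<omega> by simp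
        from measurable_compose[OF this h_meas] measurable_compose[OF this g_meas] show ?thesis by simp
      qed
      from nn_integral_time_shift[OF p.prob_space_axioms this, of i \<delta>]
      show "(\<integral>\<^sup>+z. ennreal ((h (T z) \<omega> - (\<Sum>k\<in>K. \<eta> k \<omega> * indicator (C k) (T z)))\<^sup>2) \<partial>N)
        = (\<integral>\<^sup>+z. ennreal ((h z \<omega> - step K \<eta> C z \<omega>)\<^sup>2) \<partial>N)"
        by (simp only: T_def)
    qed
    also have "\<dots> = (\<integral>\<^sup>+z. \<integral>\<^sup>+\<omega>. ennreal ((h z \<omega> - step K \<eta> C z \<omega>)\<^sup>2) \<partial>M \<partial>N)"
      using sq_dist_swap[OF h_meas g_meas] by simp
    also have "\<dots> \<le> (\<integral>\<^sup>+z. A z \<partial>N)" by (rule \<zeta>h) (simp add: \<eta>_def)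
    finally show ?thesis using A_int by simp
  qed
  have h_f': "mean_sq h (step K \<eta> C') \<le> 2 * \<epsilon> + 2 * \<epsilon>"
    by (rule order_trans[OF sq_dist_triangle[OF h_meas hT_meas f'_meas]])
      (intro add_mono mult_left_mono less_imp_le[OF hT] hT_f' zero_le)
  have sum10: "2 * \<epsilon> + 2 * (2 * \<epsilon> + 2 * \<epsilon>) = 10 * \<epsilon>"
    by (simp flip: distrib_right mult.assoc)
  show ?thesis
  proof (intro exI[of _ K] exI[of _ \<eta>] exI[of _ C'] conjI ballI)
    show "adapted_family K \<eta> C'" by (rule fam)
    show "disjoint_family_on C' K" by (auto simp: disjoint_family_on_def C'_def C_def)
    show "\<eta> k = (\<lambda>_. 0) \<or> (\<exists>z\<in>space N. \<eta> k = f z)" if "k \<in> K" for k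
      using \<zeta>[OF that] U_sp by (auto simp: \<eta>_def C_def)
    show "mean_sq f (step K \<eta> C') < ennreal e"
    proof (rule le_less_trans[OF _ \<epsilon>(3)])
      show "mean_sq f (step K \<eta> C') \<le> 10 * \<epsilon>"
        unfolding sum10[symmetric]
        by (rule order_trans[OF sq_dist_triangle[OF f h_meas f'_meas]])
          (intro add_mono mult_left_mono less_imp_le[OF fh] h_f' zero_le)
    qed
    have W_M: "W A \<in> borel_measurable M" if "A \<in> fmeasurable N" for A
      using that by (rule scattered_measurable[OF scattered])
    have J_M: "J \<in> borel_measurable M"
      unfolding J_def using adapted_familyD(2,4)[OF fam_h] W_M by (auto intro!: borel_measurable_sum)
    have I'_M: "step_integral K \<eta> C' \<in> borel_measurable M"
      using C'f \<eta>_M W_M by (auto intro!: borel_measurable_sum)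
    have "sq_dist M J (step_integral K \<eta> C')
        = mean_sq h (step K \<eta> C')"
      unfolding sq_dist_swap(1)[OF h_meas f'_meas]
      using adapted_isometry_diff[OF fam_h fam] by (simp only: sq_dist_def J_def h_def)
    then have JI': "sq_dist M J (step_integral K \<eta> C') \<le> 2 * \<epsilon> + 2 * \<epsilon>"
      using h_f' by simp
    show "sq_dist M I (step_integral K \<eta> C') < ennreal e"
    proof (rule le_less_trans[OF _ \<epsilon>(3)])
      show "sq_dist M I (step_integral K \<eta> C') \<le> 10 * \<epsilon>"
        unfolding sum10[symmetric]
        by (rule order_trans[OF sq_dist_triangle[OF I_M J_M I'_M]])
          (intro add_mono mult_left_mono less_imp_le[OF IJ] JI' zero_le)
    qed
  qed
qed

end

section \<open>Variance mixtures\<close>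

text \<open>The product of the law of \<open>U\<close> and the standard normal law carries the two independent variables.
  Integrating out the normal one gives the characteristic function in the hypothesis.\<close>

lemma type_GI:
  assumes M: "prob_space M" and Y: "Y \<in> borel_measurable M" and U [measurable]: "U \<in> borel_measurable M"
    and U_nonneg: "\<And>\<omega>. \<omega> \<in> space M \<Longrightarrow> 0 \<le> U \<omega>"
    and id: "infinitely_divisible (distr M borel U)"
    and char: "\<And>\<theta>. char (distr M borel Y) \<theta> = (CLINT \<omega>|M. exp (complex_of_real (- (\<theta>\<^sup>2 / 2) * U \<omega>)))"
  shows "type_G (distr M borel Y)"
proof -
  interpret prob_space M by fact
  interpret DU: real_distribution "distr M borel U" by (rule real_distribution_distr) (rule U)
  interpret S: real_distribution std_normal_distribution by (rule real_dist_normal_dist)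
  define P where "P = distr M borel U \<Otimes>\<^sub>M std_normal_distribution"
  interpret PP: pair_prob_space "distr M borel U" std_normal_distribution ..
  have P: "prob_space P" unfolding P_def by (rule PP.prob_space_axioms)
  have sets_P [measurable_cong]: "sets P = sets (borel \<Otimes>\<^sub>M borel)"
    unfolding P_def by (intro sets_pair_measure_cong) auto
  have fst: "distr P borel fst = distr M borel U"
  proof -
    have "distr P borel fst = distr P (distr M borel U) fst" by (intro distr_cong) auto
    then show ?thesis unfolding P_def by (simp add: S.distr_pair_fst)
  qed
  have snd: "distr P lborel snd = std_normal_distribution"
  proof (rule measure_eqI)
    fix A assume A: "A \<in> sets (distr P lborel snd)"
    have "snd -` A = (UNIV :: real set) \<times> A" by auto
    with A have "emeasure (distr P lborel snd) A = emeasure P (UNIV \<times> A)"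
      by (subst emeasure_distr) (auto simp: P_def space_pair_measure)
    also have "\<dots> = emeasure std_normal_distribution A"
      unfolding P_def using A DU.emeasure_space_1 by (subst S.emeasure_pair_measure_Times) auto
    finally show "emeasure (distr P lborel snd) A = emeasure std_normal_distribution A" .
  qed simp
  have indep: "prob_space.indep_var P borel fst borel snd"
  proof -
    have "distr P borel snd = std_normal_distribution"
      unfolding snd[symmetric] by (intro distr_cong) auto
    then have "distr P borel fst \<Otimes>\<^sub>M distr P borel snd = P" by (simp only: fst) (simp only: P_def)
    also have "P = distr P (borel \<Otimes>\<^sub>M borel) (\<lambda>x. (fst x, snd x))"
      by (simp add: distr_id2 sets_P)
    finally show ?thesis
      unfolding prob_space.indep_var_distribution_eq[OF P] by simp
  qed
  have "distr M borel Y = distr P borel (\<lambda>x. sqrt (fst x) * snd x)"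
  proof (rule Levy_uniqueness)
    show "real_distribution (distr M borel Y)" using Y by (rule real_distribution_distr)
    show "real_distribution (distr P borel (\<lambda>x. sqrt (fst x) * snd x))"
      by (intro prob_space.real_distribution_distr P) measurable
    show "char (distr M borel Y) = char (distr P borel (\<lambda>x. sqrt (fst x) * snd x))"
    proof
      fix \<theta>
      have "char (distr P borel (\<lambda>x. sqrt (fst x) * snd x)) \<theta>
          = (CLINT x|P. iexp (\<theta> * (sqrt (fst x) * snd x)))"
        unfolding char_def by (intro integral_distr) measurable
      also have "\<dots> = (CLINT u|distr M borel U. CLINT e|std_normal_distribution. iexp (\<theta> * (sqrt u * e)))"
      proof -
        have "integrable P (\<lambda>x. iexp (\<theta> * (sqrt (fst x) * snd x)))"
          by (intro prob_space.integrable_iexp P) measurable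
        from PP.integral_fst'[OF this[unfolded P_def]] show ?thesis by (simp add: P_def)
      qed
      also have "\<dots> = (CLINT u|distr M borel U. char std_normal_distribution (\<theta> * sqrt u))"
        by (simp add: char_def mult.assoc)
      also have "\<dots> = (CLINT \<omega>|M. char std_normal_distribution (\<theta> * sqrt (U \<omega>)))"
        by (intro integral_distr U) (simp add: char_std_normal_distribution)
      also have "\<dots> = (CLINT \<omega>|M. exp (complex_of_real (- (\<theta>\<^sup>2 / 2) * U \<omega>)))"
      proof (intro Bochner_Integration.integral_cong refl)
        fix \<omega> assume "\<omega> \<in> space M"
        then have "- ((\<theta> * sqrt (U \<omega>))\<^sup>2) / 2 = - (\<theta>\<^sup>2 / 2) * U \<omega>"
          using U_nonneg by (simp add: power_mult_distrib)
        then show "char std_normal_distribution (\<theta> * sqrt (U \<omega>)) = exp (complex_of_real (- (\<theta>\<^sup>2 / 2) * U \<omega>))"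
          by (simp only: char_std_normal_distribution exp_of_real)
      qed
      finally show "char (distr M borel Y) \<theta> = char (distr P borel (\<lambda>x. sqrt (fst x) * snd x)) \<theta>"
        by (simp add: char)
    qed
  qed
  moreover have "AE x in P. 0 \<le> fst x"
  proof -
    have "AE u in distr M borel U. 0 \<le> u" using U_nonneg by (subst AE_distr_iff) auto
    then have "AE u in distr P borel fst. 0 \<le> u" unfolding fst .
    then show ?thesis by (subst (asm) AE_distr_iff) auto
  qed
  moreover have "distributed P lborel snd (\<lambda>x. ennreal (std_normal_density x))"
    unfolding distributed_def snd by auto
  ultimately show ?thesis
    unfolding type_G_def using P indep id fst by (intro exI[of _ P] exI[of _ fst] exI[of _ snd]) auto
qed

section \<open>Predictable fields are adapted\<close>

lemma predictable_generators_subset: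
  assumes "\<And>r. subalgebra M (F r)"
  shows "{{(s, \<omega>). a < s $ i \<and> s $ i \<le> b \<and> space_part i s \<in> B \<and> \<omega> \<in> G} | a b B G.
          B \<in> sets borel \<and> G \<in> sets (F a)} \<subseteq> Pow (UNIV \<times> space M)"
proof -
  have "G \<subseteq> space M" if "G \<in> sets (F a)" for a G
    using sets.sets_into_space[OF that] assms[of a] by (simp add: subalgebra_def)
  then show ?thesis by blast
qed

lemma sets_predictable_algebra:
  assumes "\<And>r. subalgebra M (F r)"
  shows "sets (predictable_algebra i M F) = sigma_sets (UNIV \<times> space M)
       {{(s, \<omega>). a < s $ i \<and> s $ i \<le> b \<and> space_part i s \<in> B \<and> \<omega> \<in> G} | a b B G.
          B \<in> sets borel \<and> G \<in> sets (F a)}"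
  unfolding predictable_algebra_def by (rule sets_measure_of[OF predictable_generators_subset[OF assms]])

text \<open>At a fixed \<open>s\<close> the section of a generator is either empty or an event known at a time \<open>a\<close> before
  \<open>s $ i\<close>.\<close>

lemma predictable_adapted:
  fixes \<sigma> :: "real ^ 'd::finite \<Rightarrow> 'w \<Rightarrow> real"
  assumes \<sigma>: "case_prod \<sigma> \<in> borel_measurable (predictable_algebra i M F)"
    and sub: "\<And>r. subalgebra M (F r)" and filt: "filtration (space M) F"
  shows "\<sigma> s \<in> borel_measurable (F (s $ i))"
proof -
  have "(\<lambda>\<omega>. (s, \<omega>)) \<in> measurable (F (s $ i)) (predictable_algebra i M F)"
  proof (rule measurable_sigma_sets[OF sets_predictable_algebra[OF sub]])
    show "{{(s, \<omega>). a < s $ i \<and> s $ i \<le> b \<and> space_part i s \<in> B \<and> \<omega> \<in> G} | a b B G.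
          B \<in> sets borel \<and> G \<in> sets (F a)} \<subseteq> Pow (UNIV \<times> space M)"
      by (rule predictable_generators_subset[OF sub])
    show "(\<lambda>\<omega>. (s, \<omega>)) \<in> space (F (s $ i)) \<rightarrow> UNIV \<times> space M"
      using sub by (auto simp: subalgebra_def)
    fix E assume "E \<in> {{(s, \<omega>). a < s $ i \<and> s $ i \<le> b \<and> space_part i s \<in> B \<and> \<omega> \<in> G} | a b B G.
          B \<in> sets borel \<and> G \<in> sets (F a)}"
    then obtain a b B G where E: "E = {(s, \<omega>). a < s $ i \<and> s $ i \<le> b \<and> space_part i s \<in> B \<and> \<omega> \<in> G}"
      and G: "G \<in> sets (F a)" by blast
    show "(\<lambda>\<omega>. (s, \<omega>)) -` E \<inter> space (F (s $ i)) \<in> sets (F (s $ i))"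
    proof (cases "a < s $ i \<and> s $ i \<le> b \<and> space_part i s \<in> B")
      case True
      then have "G \<in> sets (F (s $ i))" using G filtration.sets_F_mono[OF filt, of a "s $ i"] by auto
      moreover have "(\<lambda>\<omega>. (s, \<omega>)) -` E = G" using True by (auto simp: E)
      ultimately show ?thesis by auto
    next
      case False
      then have "(\<lambda>\<omega>. (s, \<omega>)) -` E = {}" by (auto simp: E)
      then show ?thesis by simp
    qed
  qed
  from measurable_compose[OF this \<sigma>] show ?thesis by simp
qed

lemma measurable_space_part: "space_part i \<in> measurable borel borel"
proof -
  have "continuous_on UNIV (\<lambda>s :: real ^ 'd. if j = i then 0 else s $ j)" for j i :: "'d::finite"
    by (cases "j = i") (auto intro: continuous_intros)
  then have "continuous_on UNIV (space_part i :: real ^ 'd \<Rightarrow> _)" for i :: "'d::finite"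
    unfolding space_part_def[abs_def] by (intro continuous_on_vec_lambda)
  then show ?thesis by (rule borel_measurable_continuous_onI)
qed

lemma predictable_jointly_measurable:
  fixes \<sigma> :: "real ^ 'd::finite \<Rightarrow> 'w \<Rightarrow> real"
  assumes \<sigma>: "case_prod \<sigma> \<in> borel_measurable (predictable_algebra i M F)"
    and sub: "\<And>r. subalgebra M (F r)"
  shows "case_prod \<sigma> \<in> borel_measurable (lborel \<Otimes>\<^sub>M M)"
proof -
  have "(\<lambda>x. x) \<in> measurable (lborel \<Otimes>\<^sub>M M) (predictable_algebra i M F)"
  proof (rule measurable_sigma_sets[OF sets_predictable_algebra[OF sub]])
    show "{{(s, \<omega>). a < s $ i \<and> s $ i \<le> b \<and> space_part i s \<in> B \<and> \<omega> \<in> G} | a b B G.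
          B \<in> sets borel \<and> G \<in> sets (F a)} \<subseteq> Pow (UNIV \<times> space M)"
      by (rule predictable_generators_subset[OF sub])
    show "(\<lambda>x. x) \<in> space (lborel \<Otimes>\<^sub>M M) \<rightarrow> (UNIV :: (real ^ 'd) set) \<times> space M"
      by (auto simp: space_pair_measure)
    fix E assume "E \<in> {{(s :: real ^ 'd, \<omega>). a < s $ i \<and> s $ i \<le> b \<and> space_part i s \<in> B \<and> \<omega> \<in> G} | a b B G.
          B \<in> sets borel \<and> G \<in> sets (F a)}"
    then obtain a b B G where E: "E = {(s, \<omega>). a < s $ i \<and> s $ i \<le> b \<and> space_part i s \<in> B \<and> \<omega> \<in> G}"
      and B: "B \<in> sets borel" and G: "G \<in> sets (F a)" by blast
    have "G \<in> sets M" using G sub[of a] by (auto simp: subalgebra_def)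
    moreover have "{s :: real ^ 'd. a < s $ i \<and> s $ i \<le> b \<and> space_part i s \<in> B} \<in> sets lborel"
    proof -
      have [measurable]: "(\<lambda>s :: real ^ 'd. s $ i) \<in> borel_measurable borel"
        by (simp add: borel_measurable_continuous_onI continuous_on_component)
      note [measurable] = measurable_space_part B
      have "{s \<in> space borel. a < s $ i \<and> s $ i \<le> b \<and> space_part i s \<in> B} \<in> sets (borel :: (real ^ 'd) measure)"
        by measurable
      then show ?thesis by simp
    qed
    ultimately have "{s :: real ^ 'd. a < s $ i \<and> s $ i \<le> b \<and> space_part i s \<in> B} \<times> G \<in> sets (lborel \<Otimes>\<^sub>M M)"
      by (intro pair_measureI)
    moreover have "E = {s :: real ^ 'd. a < s $ i \<and> s $ i \<le> b \<and> space_part i s \<in> B} \<times> G"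
      by (auto simp: E)
    ultimately show "(\<lambda>x. x) -` E \<inter> space (lborel \<Otimes>\<^sub>M M) \<in> sets (lborel \<Otimes>\<^sub>M M)" by auto
  qed
  from measurable_compose[OF this \<sigma>] show ?thesis by simp
qed

section \<open>Stability of quadratic functionals\<close>

lemma (in prob_space) prob_less_of_nn_integral:
  assumes [measurable]: "u \<in> borel_measurable M" and a: "0 < a"
    and le: "(\<integral>\<^sup>+\<omega>. ennreal (u \<omega>) \<partial>M) < ennreal (a * b)"
  shows "prob {\<omega> \<in> space M. a < u \<omega>} < b"
proof -
  define B where "B = {\<omega> \<in> space M. a < u \<omega>}"
  have [measurable]: "B \<in> events" unfolding B_def by measurable
  have "ennreal (a * prob B) = (\<integral>\<^sup>+\<omega>. ennreal a * indicator B \<omega> \<partial>M)"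
    using a by (subst nn_integral_cmult_indicator) (auto simp: emeasure_eq_measure ennreal_mult)
  also have "\<dots> \<le> (\<integral>\<^sup>+\<omega>. ennreal (u \<omega>) \<partial>M)"
    by (intro nn_integral_mono) (auto simp: B_def indicator_def intro!: ennreal_leI)
  also note le
  finally have "a * prob B < a * b" using a by (subst (asm) ennreal_less_iff) auto
  then show ?thesis using a by (simp add: B_def)
qed

text \<open>Young's inequality; the free weight \<open>c\<close> makes both terms small when \<open>u\<close> is close to \<open>v\<close>.\<close>

lemma abs_diff_squares_le:
  fixes u v :: real
  assumes "0 < c"
  shows "\<bar>u\<^sup>2 - v\<^sup>2\<bar> \<le> (1 + 1 / c) * (u - v)\<^sup>2 + c * u\<^sup>2"
proof -
  define d where "d = u - v"
  have "2 * \<bar>u\<bar> * \<bar>d\<bar> \<le> c * u\<^sup>2 + d\<^sup>2 / c"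
  proof -
    have "0 \<le> (c * \<bar>u\<bar> - \<bar>d\<bar>)\<^sup>2 / c" using assms by simp
    also have "\<dots> = c * u\<^sup>2 + d\<^sup>2 / c - 2 * \<bar>u\<bar> * \<bar>d\<bar>"
      using assms by (simp add: power2_eq_square field_simps)
    finally show ?thesis by simp
  qed
  moreover have eq: "u\<^sup>2 - v\<^sup>2 = 2 * u * d - d\<^sup>2" by (simp add: d_def power2_eq_square algebra_simps)
  moreover have "\<bar>2 * u * d - d\<^sup>2\<bar> \<le> 2 * \<bar>u\<bar> * \<bar>d\<bar> + d\<^sup>2"
    by (rule order_trans[OF abs_triangle_ineq4]) (simp add: abs_mult)
  moreover have "(1 + 1 / c) * d\<^sup>2 = d\<^sup>2 + d\<^sup>2 / c" by (simp add: distrib_right)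
  ultimately show ?thesis unfolding eq d_def[symmetric] by linarith
qed

lemma abs_exp_minus_diff_le:
  fixes x y :: real
  assumes "0 \<le> x" "0 \<le> y"
  shows "\<bar>exp (- x) - exp (- y)\<bar> \<le> \<bar>x - y\<bar>"
proof -
  have *: "exp (- x) - exp (- y) \<le> y - x" if "x \<le> y" "0 \<le> x" for x y :: real
  proof -
    have "exp (- x) - exp (- y) = exp (- x) * (1 - exp (- (y - x)))"
      by (simp add: right_diff_distrib flip: exp_add)
    also have "\<dots> \<le> 1 * (1 - exp (- (y - x)))"
      using that by (intro mult_right_mono) auto
    also have "\<dots> \<le> y - x" using exp_ge_add_one_self[of "- (y - x)"] unfolding mult_1 by linarith
    finally show ?thesis .
  qed
  show ?thesis using *[of x y] *[of y x] assms by (cases "x \<le> y") auto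
qed

lemma sum_indicator_squared_integral:
  fixes r :: "'k \<Rightarrow> real"
  assumes fin: "finite K" and C: "\<And>k. k \<in> K \<Longrightarrow> C k \<in> fmeasurable N" and dis: "disjoint_family_on C K"
  shows "integrable N (\<lambda>z. (\<Sum>k\<in>K. r k * indicator (C k) z)\<^sup>2)"
    and "(LINT z|N. (\<Sum>k\<in>K. r k * indicator (C k) z)\<^sup>2) = (\<Sum>k\<in>K. (r k)\<^sup>2 * measure N (C k))"
proof -
  have eq: "(\<Sum>k\<in>K. r k * indicator (C k) z)\<^sup>2 = (\<Sum>k\<in>K. (r k)\<^sup>2 * indicator (C k) z)" for z
  proof (cases "\<exists>k\<in>K. z \<in> C k")
    case True
    then obtain k0 where k0: "k0 \<in> K" "z \<in> C k0" by blast
    have "{k \<in> K. z \<in> C k} = {k0}"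
      using k0 dis by (auto simp: disjoint_family_on_def)
    then have "(\<Sum>k\<in>K. s k * indicator (C k) z) = s k0" for s :: "'k \<Rightarrow> real"
      using fin by simp
    then show ?thesis by simp
  next
    case False
    then have "(\<Sum>k\<in>K. s k * indicator (C k) z) = 0" for s :: "'k \<Rightarrow> real"
      by (intro sum.neutral) auto
    then show ?thesis by simp
  qed
  have int: "integrable N (\<lambda>z. (r k)\<^sup>2 * indicator (C k) z)"
    and val: "(LINT z|N. (r k)\<^sup>2 * indicator (C k) z) = (r k)\<^sup>2 * measure N (C k)" if "k \<in> K" for k
    using C[OF that] sets.sets_into_space[OF fmeasurableD[OF C[OF that]]]
    by (auto simp: fmeasurable_def Int_absorb2 intro!: integrable_real_indicator)
  show "integrable N (\<lambda>z. (\<Sum>k\<in>K. r k * indicator (C k) z)\<^sup>2)"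
    unfolding eq using int by (rule Bochner_Integration.integrable_sum)
  show "(LINT z|N. (\<Sum>k\<in>K. r k * indicator (C k) z)\<^sup>2) = (\<Sum>k\<in>K. (r k)\<^sup>2 * measure N (C k))"
    unfolding eq by (subst Bochner_Integration.integral_sum[OF int]) (assumption, rule sum.cong[OF refl val])
qed

context walsh_product
begin

abbreviation step_variance :: "'q set \<Rightarrow> ('q \<Rightarrow> 'w \<Rightarrow> real) \<Rightarrow> ('q \<Rightarrow> ('x \<times> (real ^ 'd)) set) \<Rightarrow> 'w \<Rightarrow> real"
  where "step_variance K \<eta> C \<equiv> \<lambda>\<omega>. \<Sum>k\<in>K. (\<eta> k \<omega>)\<^sup>2 * measure N (C k)"

text \<open>The variance of the Wiener integral of \<open>f\<close> with the volatility frozen.\<close>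

definition conditional_variance :: "('x \<times> (real ^ 'd) \<Rightarrow> 'w \<Rightarrow> real) \<Rightarrow> 'w \<Rightarrow> real" where
  "conditional_variance f \<omega> = (LINT z|N. (f z \<omega>)\<^sup>2)"

lemma conditional_variance_nonneg: "0 \<le> conditional_variance f \<omega>"
  by (simp add: conditional_variance_def)

lemma measurable_conditional_variance:
  assumes "case_prod f \<in> borel_measurable (N \<Otimes>\<^sub>M M)"
  shows "conditional_variance f \<in> borel_measurable M"
proof -
  interpret N: sigma_finite_measure N by (rule sigma_finite_N)
  have "(\<lambda>(\<omega>, z). (f z \<omega>)\<^sup>2) \<in> borel_measurable (M \<Otimes>\<^sub>M N)"
    using measurable_compose[OF measurable_pair_swap' assms] by (simp add: case_prod_beta')
  then show ?thesis
    unfolding conditional_variance_def[abs_def] by (rule N.borel_measurable_lebesgue_integral)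
qed

lemma conditional_variance_diff_le:
  assumes f: "case_prod f \<in> borel_measurable (N \<Otimes>\<^sub>M M)"
    and v: "case_prod v \<in> borel_measurable (N \<Otimes>\<^sub>M M)"
    and v_int: "\<And>\<omega>. \<omega> \<in> space M \<Longrightarrow> integrable N (\<lambda>z. (v z \<omega>)\<^sup>2)"
    and fin: "mean_sq f (\<lambda>_ _. 0) < \<infinity>" and c: "0 < (c::real)"
  shows "(\<integral>\<^sup>+\<omega>. ennreal \<bar>conditional_variance f \<omega> - conditional_variance v \<omega>\<bar> \<partial>M)
    \<le> ennreal (1 + 1 / c) * mean_sq f v
      + ennreal c * mean_sq f (\<lambda>_ _. 0)"
proof -
  define a where "a \<omega> = (\<integral>\<^sup>+z. ennreal ((f z \<omega> - v z \<omega>)\<^sup>2) \<partial>N)" for \<omega>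
  define b where "b \<omega> = (\<integral>\<^sup>+z. ennreal ((f z \<omega>)\<^sup>2) \<partial>N)" for \<omega>
  have 0: "(\<lambda>(z, \<omega>). 0 :: real) \<in> borel_measurable (N \<Otimes>\<^sub>M M)" by (simp add: case_prod_beta')
  have fs: "(\<lambda>z. f z \<omega>) \<in> borel_measurable N" and vs: "(\<lambda>z. v z \<omega>) \<in> borel_measurable N" if "\<omega> \<in> space M" for \<omega>
  proof -
    have "(\<lambda>z. (z, \<omega>)) \<in> measurable N (N \<Otimes>\<^sub>M M)" using that by simp
    from measurable_compose[OF this f] measurable_compose[OF this v]
    show "(\<lambda>z. f z \<omega>) \<in> borel_measurable N" "(\<lambda>z. v z \<omega>) \<in> borel_measurable N" by simp_all
  qed
  have m2: "(\<lambda>(\<omega>, z). ennreal ((f z \<omega>)\<^sup>2)) \<in> borel_measurable (M \<Otimes>\<^sub>M N)"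
    "(\<lambda>(\<omega>, z). ennreal ((f z \<omega> - v z \<omega>)\<^sup>2)) \<in> borel_measurable (M \<Otimes>\<^sub>M N)"
    using measurable_compose[OF measurable_pair_swap' f] measurable_compose[OF measurable_pair_swap' v]
    by (simp_all add: case_prod_beta')
  have ab_M [measurable]: "a \<in> borel_measurable M" "b \<in> borel_measurable M"
    unfolding a_def[abs_def] b_def[abs_def]
    using sigma_finite_measure.borel_measurable_nn_integral_fst[OF sigma_finite_N m2(1)]
      sigma_finite_measure.borel_measurable_nn_integral_fst[OF sigma_finite_N m2(2)] by simp_all
  have a_int: "(\<integral>\<^sup>+\<omega>. a \<omega> \<partial>M) = mean_sq f v"
    by (simp add: a_def sq_dist_swap(1)[OF f v])
  have b_int: "(\<integral>\<^sup>+\<omega>. b \<omega> \<partial>M) = mean_sq f (\<lambda>_ _. 0)"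
    by (simp add: b_def sq_dist_swap(1)[OF f 0])
  have "AE \<omega> in M. b \<omega> \<noteq> \<infinity>"
    using fin b_int by (intro nn_integral_noteq_infinite) auto
  then have "AE \<omega> in M. ennreal \<bar>conditional_variance f \<omega> - conditional_variance v \<omega>\<bar>
      \<le> ennreal (1 + 1 / c) * a \<omega> + ennreal c * b \<omega>"
  proof (rule AE_mp, intro AE_I2 impI)
    fix \<omega> assume \<omega>: "\<omega> \<in> space M" and b: "b \<omega> \<noteq> \<infinity>"
    have f_int: "integrable N (\<lambda>z. (f z \<omega>)\<^sup>2)"
      using b fs[OF \<omega>] by (intro integrableI_nonneg) (auto simp: b_def less_top)
    have "ennreal \<bar>conditional_variance f \<omega> - conditional_variance v \<omega>\<bar>
        = ennreal (norm (LINT z|N. (f z \<omega>)\<^sup>2 - (v z \<omega>)\<^sup>2))"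
      using f_int v_int[OF \<omega>] by (simp add: conditional_variance_def)
    also have "\<dots> \<le> (\<integral>\<^sup>+z. ennreal (norm ((f z \<omega>)\<^sup>2 - (v z \<omega>)\<^sup>2)) \<partial>N)"
      using f_int v_int[OF \<omega>] by (intro integral_norm_bound_ennreal) auto
    also have "\<dots> \<le> (\<integral>\<^sup>+z. ennreal (1 + 1 / c) * ennreal ((f z \<omega> - v z \<omega>)\<^sup>2) + ennreal c * ennreal ((f z \<omega>)\<^sup>2) \<partial>N)"
    proof (rule nn_integral_mono)
      fix z
      have "ennreal (norm ((f z \<omega>)\<^sup>2 - (v z \<omega>)\<^sup>2)) \<le> ennreal ((1 + 1 / c) * (f z \<omega> - v z \<omega>)\<^sup>2 + c * (f z \<omega>)\<^sup>2)"
        using abs_diff_squares_le[OF c] by (intro ennreal_leI) simp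
      also have "\<dots> = ennreal (1 + 1 / c) * ennreal ((f z \<omega> - v z \<omega>)\<^sup>2) + ennreal c * ennreal ((f z \<omega>)\<^sup>2)"
        using c by (simp add: ennreal_plus ennreal_mult)
      finally show "ennreal (norm ((f z \<omega>)\<^sup>2 - (v z \<omega>)\<^sup>2))
        \<le> ennreal (1 + 1 / c) * ennreal ((f z \<omega> - v z \<omega>)\<^sup>2) + ennreal c * ennreal ((f z \<omega>)\<^sup>2)" .
    qed
    also have "\<dots> = ennreal (1 + 1 / c) * a \<omega> + ennreal c * b \<omega>"
      using fs[OF \<omega>] vs[OF \<omega>] by (simp add: nn_integral_add nn_integral_cmult a_def b_def)
    finally show "ennreal \<bar>conditional_variance f \<omega> - conditional_variance v \<omega>\<bar>
      \<le> ennreal (1 + 1 / c) * a \<omega> + ennreal c * b \<omega>" .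
  qed
  then have "(\<integral>\<^sup>+\<omega>. ennreal \<bar>conditional_variance f \<omega> - conditional_variance v \<omega>\<bar> \<partial>M)
      \<le> (\<integral>\<^sup>+\<omega>. ennreal (1 + 1 / c) * a \<omega> + ennreal c * b \<omega> \<partial>M)"
    by (rule nn_integral_mono_AE)
  also have "\<dots> = ennreal (1 + 1 / c) * (\<integral>\<^sup>+\<omega>. a \<omega> \<partial>M) + ennreal c * (\<integral>\<^sup>+\<omega>. b \<omega> \<partial>M)"
    by (simp add: nn_integral_add nn_integral_cmult)
  finally show ?thesis by (simp only: a_int b_int)
qed

lemma walsh_integral_sampled_variance:
  fixes f :: "'x \<times> (real ^ 'd) \<Rightarrow> 'w \<Rightarrow> real"
  assumes f: "case_prod f \<in> borel_measurable (N \<Otimes>\<^sub>M M)"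
    and adapted: "\<And>z. z \<in> space N \<Longrightarrow> f z \<in> borel_measurable (F (snd z $ i))"
    and I: "walsh_integral i M N W F f I"
    and fin: "mean_sq f (\<lambda>_ _. 0) < \<infinity>" and e: "0 < (e::real)"
  shows "\<exists>(K :: (nat set \<times> int) set) \<eta> C. adapted_family K \<eta> C \<and> disjoint_family_on C K \<and>
    (\<forall>k\<in>K. \<eta> k = (\<lambda>_. 0) \<or> (\<exists>z\<in>space N. \<eta> k = f z)) \<and>
    (\<integral>\<^sup>+\<omega>. ennreal \<bar>conditional_variance f \<omega> - step_variance K \<eta> C \<omega>\<bar> \<partial>M) < ennreal e \<and>
    (\<integral>\<^sup>+\<omega>. ennreal ((I \<omega> - step_integral K \<eta> C \<omega>)\<^sup>2) \<partial>M) < ennreal e"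
proof -
  obtain s where s: "0 \<le> s" "mean_sq f (\<lambda>_ _. 0) = ennreal s"
    using fin by (cases "mean_sq f (\<lambda>_ _. 0)") auto
  define c where "c = e / (2 * (s + 1))"
  have c: "0 < c" "c * s < e / 2"
    using e s(1) by (auto simp: c_def field_simps)
  define d where "d = min e (e / (2 * (1 + 1 / c)))"
  have c1: "0 < 1 + 1 / c" using c(1) by (simp add: add_pos_pos)
  have d: "0 < d" "d \<le> e" "(1 + 1 / c) * d \<le> e / 2"
  proof -
    show "0 < d" "d \<le> e" using e c1 by (auto simp: d_def)
    have "(1 + 1 / c) * d \<le> (1 + 1 / c) * (e / (2 * (1 + 1 / c)))"
      using c1 by (intro mult_left_mono) (auto simp: d_def)
    also have "b * (e / (2 * b)) = e / 2" if "0 < b" for b using that by simp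
    note this[OF c1]
    finally show "(1 + 1 / c) * d \<le> e / 2" .
  qed
  obtain K :: "(nat set \<times> int) set" and \<eta> C where K: "adapted_family K \<eta> C" "disjoint_family_on C K"
    "\<forall>k\<in>K. \<eta> k = (\<lambda>_. 0) \<or> (\<exists>z\<in>space N. \<eta> k = f z)"
    and near: "mean_sq f (step K \<eta> C) < ennreal d"
    and I_near: "sq_dist M I (step_integral K \<eta> C) < ennreal d"
    using walsh_integral_sampled[OF f adapted I d(1)] by blast
  note C = adapted_familyD(2)[OF K(1)]
  define v where "v z \<omega> = step K \<eta> C z \<omega>" for z \<omega>
  have v_M: "case_prod v \<in> borel_measurable (N \<Otimes>\<^sub>M M)"
    unfolding v_def using adapted_familyD[OF K(1)] by (intro measurable_simple_sum)
  note v_sq = sum_indicator_squared_integral[OF adapted_familyD(1)[OF K(1)] C K(2)]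
  have v_var: "conditional_variance v \<omega> = step_variance K \<eta> C \<omega>" for \<omega>
    unfolding conditional_variance_def v_def by (rule v_sq(2))
  have "(\<integral>\<^sup>+\<omega>. ennreal \<bar>conditional_variance f \<omega> - conditional_variance v \<omega>\<bar> \<partial>M)
      \<le> ennreal (1 + 1 / c) * mean_sq f v + ennreal c * ennreal s"
    unfolding s(2)[symmetric]
    by (rule conditional_variance_diff_le[OF f v_M _ fin c(1)]) (simp only: v_def v_sq(1))
  also have "\<dots> \<le> ennreal (1 + 1 / c) * ennreal d + ennreal c * ennreal s"
    using near by (intro add_mono mult_left_mono order_refl) (auto simp: v_def[abs_def])
  also have "\<dots> = ennreal ((1 + 1 / c) * d + c * s)"
    using c1 c(1) d(1) s(1) by (simp add: ennreal_plus ennreal_mult)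
  also have "\<dots> < ennreal e"
  proof (rule ennreal_lessI[OF e])
    show "(1 + 1 / c) * d + c * s < e" using d(3) c(2) by linarith
  qed
  finally have var: "(\<integral>\<^sup>+\<omega>. ennreal \<bar>conditional_variance f \<omega> - step_variance K \<eta> C \<omega>\<bar> \<partial>M) < ennreal e"
    by (simp only: v_var)
  have int: "(\<integral>\<^sup>+\<omega>. ennreal ((I \<omega> - step_integral K \<eta> C \<omega>)\<^sup>2) \<partial>M) < ennreal e"
    using less_le_trans[OF I_near ennreal_leI[OF d(2)]] by (simp add: sq_dist_def)
  show ?thesis using K var int by blast
qed

text \<open>For a sampled integrand the coefficients are values of \<open>f\<close>, hence independent of \<open>W\<close>, and the
  conditional Gaussian formula applies.  Both sides are continuous along the approximation: the left
  side since the integrals converge in mean square, the right side since the conditional variances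
  converge in mean.\<close>

lemma walsh_integral_char:
  fixes f :: "'x \<times> (real ^ 'd) \<Rightarrow> 'w \<Rightarrow> real"
  assumes f: "case_prod f \<in> borel_measurable (N \<Otimes>\<^sub>M M)"
    and adapted: "\<And>z. z \<in> space N \<Longrightarrow> f z \<in> borel_measurable (F (snd z $ i))"
    and I: "walsh_integral i M N W F f I"
    and fin: "mean_sq f (\<lambda>_ _. 0) < \<infinity>"
    and \<G>: "subalgebra M \<G>" and f_\<G>: "\<And>z. z \<in> space N \<Longrightarrow> f z \<in> borel_measurable \<G>"
    and indep: "indep_set (sets \<G>) (generated_events M (fmeasurable N) W)"
  shows "char (distr M borel I) \<theta>
    = (CLINT \<omega>|M. exp (complex_of_real (- (\<theta>\<^sup>2 / 2) * conditional_variance f \<omega>)))"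
    (is "_ = ?R")
proof -
  have I_M: "I \<in> borel_measurable M" using I by (simp add: walsh_integral_def)
  note V_M = measurable_conditional_variance[OF f]
  define q where "q = \<theta>\<^sup>2 / 2"
  have q: "0 \<le> q" by (simp add: q_def)
  have bound: "cmod (char (distr M borel I) \<theta> - ?R) \<le> (\<bar>\<theta>\<bar> + 2 + q) * e" if e: "0 < e" "e < 1" for e
  proof -
    \<comment> \<open>Precision \<open>e ^ 3\<close> in mean square gives distance \<open>e\<close> up to probability \<open>e\<close>.\<close>
    obtain K :: "(nat set \<times> int) set" and \<eta> C where K: "adapted_family K \<eta> C" "disjoint_family_on C K"
      and \<eta>: "\<forall>k\<in>K. \<eta> k = (\<lambda>_. 0) \<or> (\<exists>z\<in>space N. \<eta> k = f z)"
      and var: "(\<integral>\<^sup>+\<omega>. ennreal \<bar>conditional_variance f \<omega> - step_variance K \<eta> C \<omega>\<bar> \<partial>M) < ennreal (e ^ 3)"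
      and int: "(\<integral>\<^sup>+\<omega>. ennreal ((I \<omega> - step_integral K \<eta> C \<omega>)\<^sup>2) \<partial>M) < ennreal (e ^ 3)"
      using walsh_integral_sampled_variance[OF f adapted I fin, of "e ^ 3"] zero_less_power[OF e(1)] by blast
    have C: "C k \<in> fmeasurable N" and \<eta>_M: "\<eta> k \<in> borel_measurable M" if "k \<in> K" for k
      using adapted_familyD[OF K(1)] that by auto
    define J where "J \<omega> = step_integral K \<eta> C \<omega>" for \<omega>
    define V' where "V' \<omega> = step_variance K \<eta> C \<omega>" for \<omega>
    have J_M: "J \<in> borel_measurable M"
      unfolding J_def[abs_def] using C \<eta>_M scattered_measurable[OF scattered] by (intro borel_measurable_sum) auto
    have V'_M: "V' \<in> borel_measurable M"
      unfolding V'_def[abs_def] using \<eta>_M by (intro borel_measurable_sum) auto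
    have V'_nonneg: "0 \<le> V' \<omega>" for \<omega> unfolding V'_def by (intro sum_nonneg) auto
    have char_J: "char (distr M borel J) \<theta> = (CLINT \<omega>|M. exp (complex_of_real (- q * V' \<omega>)))"
      unfolding J_def[abs_def] V'_def q_def
      using \<eta> f_\<G> by (intro gaussian_basis_conditional_char[OF prob_space_axioms W indep \<G> adapted_familyD(1)[OF K(1)] C K(2)])
        (fastforce)+
    have "(\<integral>\<^sup>+\<omega>. ennreal ((I \<omega> - J \<omega>)\<^sup>2) \<partial>M) < ennreal (e\<^sup>2 * e)"
      using int by (simp add: J_def power2_eq_square power3_eq_cube mult.assoc)
    then have "prob {\<omega> \<in> space M. e\<^sup>2 < (I \<omega> - J \<omega>)\<^sup>2} < e"
      using e(1) I_M J_M by (intro prob_less_of_nn_integral) auto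
    then have "prob {\<omega> \<in> space M. e < \<bar>I \<omega> - J \<omega>\<bar>} < e"
    proof -
      have "e\<^sup>2 < x\<^sup>2 \<longleftrightarrow> e < \<bar>x\<bar>" for x
        using abs_le_square_iff[of x e] e(1) by (auto simp: not_le[symmetric])
      then show "prob {\<omega> \<in> space M. e\<^sup>2 < (I \<omega> - J \<omega>)\<^sup>2} < e \<Longrightarrow> ?thesis" by simp
    qed
    then have 1: "cmod (char (distr M borel I) \<theta> - char (distr M borel J) \<theta>) \<le> \<bar>\<theta>\<bar> * e + 2 * e"
      using char_distr_diff_le[OF I_M J_M less_imp_le[OF e(1)], of \<theta>] by linarith
    have 2: "cmod (char (distr M borel J) \<theta> - ?R) \<le> q * e"
    proof -
      have int1: "integrable M (\<lambda>\<omega>. exp (complex_of_real (- q * U \<omega>)))"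
        if "U \<in> borel_measurable M" "\<And>\<omega>. 0 \<le> U \<omega>" for U
        using that q by (intro integrable_const_bound[of _ 1]) auto
      define \<Delta> where "\<Delta> \<omega> = exp (complex_of_real (- q * V' \<omega>)) - exp (complex_of_real (- q * conditional_variance f \<omega>))" for \<omega>
      have i: "integrable M \<Delta>"
        unfolding \<Delta>_def by (intro Bochner_Integration.integrable_diff int1 V'_M V_M V'_nonneg conditional_variance_nonneg)
      have "char (distr M borel J) \<theta> - ?R
          = (CLINT \<omega>|M. \<Delta> \<omega>)"
        unfolding char_J q_def[symmetric] \<Delta>_def
        by (intro Bochner_Integration.integral_diff[symmetric] int1 V'_M V_M V'_nonneg conditional_variance_nonneg)
      then have "ennreal (cmod (char (distr M borel J) \<theta> - ?R))
          \<le> (\<integral>\<^sup>+\<omega>. ennreal (cmod (\<Delta> \<omega>)) \<partial>M)"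
        using integral_norm_bound_ennreal[OF i] by simp
      also have "\<dots> \<le> (\<integral>\<^sup>+\<omega>. ennreal q * ennreal \<bar>conditional_variance f \<omega> - V' \<omega>\<bar> \<partial>M)"
      proof (rule nn_integral_mono)
        fix \<omega>
        have "cmod (\<Delta> \<omega>)
            = \<bar>exp (- (q * V' \<omega>)) - exp (- (q * conditional_variance f \<omega>))\<bar>"
          unfolding \<Delta>_def exp_of_real of_real_diff[symmetric] norm_of_real by simp
        also have "\<dots> \<le> \<bar>q * V' \<omega> - q * conditional_variance f \<omega>\<bar>"
          using q V'_nonneg conditional_variance_nonneg by (intro abs_exp_minus_diff_le) auto
        also have "\<dots> = q * \<bar>conditional_variance f \<omega> - V' \<omega>\<bar>"
          using q by (simp add: abs_mult abs_minus_commute flip: right_diff_distrib)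
        finally show "ennreal (cmod (\<Delta> \<omega>))
            \<le> ennreal q * ennreal \<bar>conditional_variance f \<omega> - V' \<omega>\<bar>"
          using q by (simp add: ennreal_leI flip: ennreal_mult)
      qed
      also have "\<dots> = ennreal q * (\<integral>\<^sup>+\<omega>. ennreal \<bar>conditional_variance f \<omega> - V' \<omega>\<bar> \<partial>M)"
        using V_M V'_M by (intro nn_integral_cmult) auto
      also have "\<dots> \<le> ennreal q * ennreal (e ^ 3)"
        using var by (intro mult_left_mono) (auto simp: V'_def)
      also have "\<dots> \<le> ennreal q * ennreal e"
        using e by (intro mult_left_mono ennreal_leI) (auto simp: power_le_one power3_eq_cube mult_le_one intro: mult_left_le)
      also have "\<dots> = ennreal (q * e)" using q e by (simp add: ennreal_mult)
      finally show ?thesis using q e by (subst (asm) ennreal_le_iff) auto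
    qed
    have "cmod (char (distr M borel I) \<theta> - ?R) \<le> (\<bar>\<theta>\<bar> * e + 2 * e) + q * e"
      using norm_triangle_mono[OF 1 2] by simp
    then show ?thesis by (simp add: algebra_simps)
  qed
  define B where "B = \<bar>\<theta>\<bar> + 2 + q"
  have B: "0 < B" using q by (simp add: B_def add_pos_nonneg add_nonneg_pos)
  have "cmod (char (distr M borel I) \<theta> - ?R) \<le> x" if x: "0 < x" for x
  proof -
    define e where "e = min (1 / 2) (x / B)"
    have e: "0 < e" "e < 1" using x B by (auto simp: e_def)
    have "cmod (char (distr M borel I) \<theta> - ?R) \<le> B * e" unfolding B_def by (rule bound[OF e])
    also have "\<dots> \<le> B * (x / B)" using B by (intro mult_left_mono) (auto simp: e_def)
    also have "\<dots> = x" using B by simp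
    finally show ?thesis .
  qed
  then have "cmod (char (distr M borel I) \<theta> - ?R) \<le> 0" by (rule dense_ge)
  then show ?thesis by simp
qed

text \<open>The conditional variance of a sampled integrand is a finite linear combination of squared values
  of \<open>f\<close>, and these lie in the closed span.\<close>

lemma conditional_variance_approx_linear:
  fixes f :: "'x \<times> (real ^ 'd) \<Rightarrow> 'w \<Rightarrow> real"
  assumes f: "case_prod f \<in> borel_measurable (N \<Otimes>\<^sub>M M)"
    and adapted: "\<And>z. z \<in> space N \<Longrightarrow> f z \<in> borel_measurable (F (snd z $ i))"
    and I: "walsh_integral i M N W F f I"
    and fin: "mean_sq f (\<lambda>_ _. 0) < \<infinity>"
    and L: "independently_scattered M N' L"
    and sq: "\<And>z. z \<in> space N \<Longrightarrow> approx_linear M N' L (\<lambda>\<omega>. (f z \<omega>)\<^sup>2)"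
  shows "approx_linear M N' L (conditional_variance f)"
proof (rule approx_linear_limit[OF prob_space_axioms L measurable_conditional_variance[OF f]])
  fix e :: real assume e: "0 < e"
  then have ee: "0 < e * e" by simp
  obtain K :: "(nat set \<times> int) set" and \<eta> C where K: "adapted_family K \<eta> C"
    and \<eta>: "\<forall>k\<in>K. \<eta> k = (\<lambda>_. 0) \<or> (\<exists>z\<in>space N. \<eta> k = f z)"
    and var: "(\<integral>\<^sup>+\<omega>. ennreal \<bar>conditional_variance f \<omega> - step_variance K \<eta> C \<omega>\<bar> \<partial>M) < ennreal (e * e)"
    using walsh_integral_sampled_variance[OF f adapted I fin ee] by blast
  have "approx_linear M N' L (\<lambda>\<omega>. \<Sum>k\<in>K'. (\<eta> k \<omega>)\<^sup>2 * measure N (C k))" if "finite K'" "K' \<subseteq> K" for K'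
    using that
  proof (induction K')
    case empty
    then show ?case by (simp add: approx_linear_zero[OF prob_space_axioms])
  next
    case (insert k K')
    have "approx_linear M N' L (\<lambda>\<omega>. (\<eta> k \<omega>)\<^sup>2)"
      using \<eta> insert.prems sq by (auto simp: approx_linear_zero[OF prob_space_axioms])
    from approx_linear_scale[OF prob_space_axioms L this, of "measure N (C k)"]
    have "approx_linear M N' L (\<lambda>\<omega>. (\<eta> k \<omega>)\<^sup>2 * measure N (C k))" by (simp add: mult.commute)
    from approx_linear_add[OF prob_space_axioms L this] insert show ?case by simp
  qed
  from this[OF adapted_familyD(1)[OF K]]
  have *: "approx_linear M N' L (step_variance K \<eta> C)" by simp
  then have "step_variance K \<eta> C \<in> borel_measurable M" by (simp add: approx_linear_def)
  then have "prob {\<omega> \<in> space M. e < \<bar>conditional_variance f \<omega> - step_variance K \<eta> C \<omega>\<bar>} < e"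
    using measurable_conditional_variance[OF f] by (intro prob_less_of_nn_integral[OF _ e var]) simp
  with * show "\<exists>Y. approx_linear M N' L Y \<and> prob {\<omega> \<in> space M. e < \<bar>conditional_variance f \<omega> - Y \<omega>\<bar>} < e"
    by (intro exI conjI)
qed

end

section \<open>The volatility modulated field\<close>

theorem proposition8:
  fixes M :: "'w measure"
    and \<X> :: "'x::euclidean_space set" and \<X>\<sigma> :: "'y::euclidean_space set"
    and p :: "'x measure" and p\<sigma> :: "'y measure"
    and \<nu> :: "real measure"
    and g :: "'x \<Rightarrow> real ^ 'd::finite \<Rightarrow> real"
    and h k :: "'y \<Rightarrow> real ^ 'd \<Rightarrow> real"
    and i :: 'd
    and W :: "('x \<times> (real ^ 'd)) set \<Rightarrow> 'w \<Rightarrow> real"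
    and L :: "('y \<times> (real ^ 'd)) set \<Rightarrow> 'w \<Rightarrow> real"
    and F :: "real \<Rightarrow> 'w measure"
    and \<sigma> X :: "real ^ 'd \<Rightarrow> 'w \<Rightarrow> real"
    and H :: "real ^ 'd"
  assumes M: "prob_space M"
    and \<X>: "\<X> \<in> sets borel" and p: "prob_space p" "sets p = sets (restrict_space borel \<X>)"
    and \<X>\<sigma>: "\<X>\<sigma> \<in> sets borel" and p\<sigma>: "prob_space p\<sigma>" "sets p\<sigma> = sets (restrict_space borel \<X>\<sigma>)"
    and g_meas: "case_prod g \<in> borel_measurable (p \<Otimes>\<^sub>M lborel)"
    and W: "gaussian_basis M (p \<Otimes>\<^sub>M lborel) W"
    and \<sigma>_stationary: "strictly_stationary M \<sigma>"
    and \<sigma>_indep_W: "prob_space.indep_set M (generated_events M UNIV \<sigma>)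
                      (generated_events M (fmeasurable (p \<Otimes>\<^sub>M lborel)) W)"
    and F: "walsh_filtration i M (p \<Otimes>\<^sub>M lborel) W F"
    and \<sigma>_predictable: "case_prod \<sigma> \<in> borel_measurable (predictable_algebra i M F)"
    and g\<sigma>_finite: "\<And>t. (\<integral>\<^sup>+(x, s). ennreal ((g x (t - s))\<^sup>2) * (\<integral>\<^sup>+\<omega>. ennreal ((\<sigma> s \<omega>)\<^sup>2) \<partial>M)
                        \<partial>(p \<Otimes>\<^sub>M lborel)) < \<infinity>"
    and X: "\<And>t. walsh_integral i M (p \<Otimes>\<^sub>M lborel) W F (\<lambda>(x, s) \<omega>. g x (t - s) * \<sigma> s \<omega>) (X t)"
    and \<nu>: "sets \<nu> = sets (restrict_space borel {0<..})"
    and \<nu>_min: "(\<integral>\<^sup>+w. ennreal (min 1 w) \<partial>\<nu>) < \<infinity>"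
    and \<nu>_sq: "(\<integral>\<^sup>+w. ennreal (w\<^sup>2 * indicator {1..} w) \<partial>\<nu>) < \<infinity>"
    and L: "levy_basis M (p\<sigma> \<Otimes>\<^sub>M lborel) \<nu> L"
    and h_meas: "case_prod h \<in> borel_measurable (p\<sigma> \<Otimes>\<^sub>M lborel)"
    and h_nonneg: "\<And>y z. y \<in> \<X>\<sigma> \<Longrightarrow> 0 \<le> h y z"
    and h_int: "integrability_conditions (p\<sigma> \<Otimes>\<^sub>M lborel) \<nu> (case_prod h)"
    and \<sigma>_sq: "\<And>s. rr_integral M (p\<sigma> \<Otimes>\<^sub>M lborel) L (\<lambda>(y, u). h y (s - u)) (\<lambda>\<omega>. (\<sigma> s \<omega>)\<^sup>2)"
    and k_nonneg: "\<And>y z. y \<in> \<X>\<sigma> \<Longrightarrow> 0 \<le> k y z"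
    and k: "\<And>y t u. y \<in> \<X>\<sigma> \<Longrightarrow>
              (\<integral>\<^sup>+(x, s). ennreal ((g x (t - s))\<^sup>2 * h y (s - u)) \<partial>(p \<Otimes>\<^sub>M lborel)) = ennreal (k y (t - u))"
    and k_int: "integrability_conditions (p\<sigma> \<Otimes>\<^sub>M lborel) \<nu> (case_prod k)"
    and H: "\<And>j. 0 < H $ j"
  shows "\<forall>t :: real ^ 'd. (\<forall>j. 0 < t $ j) \<longrightarrow> type_G (distr M borel (lamperti H X t))"
proof (intro allI impI)
  fix t :: "real ^ 'd"
  interpret prob_space M by (rule M)
  interpret p: prob_space p by (rule p(1))
  have past: "{z \<in> space (p \<Otimes>\<^sub>M lborel). snd z $ i \<le> r} \<in> sets (p \<Otimes>\<^sub>M (lborel :: (real ^ 'd) measure))" for r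
    by (rule borel_measurable_le[OF measurable_snd_nth borel_measurable_const])
  interpret walsh_product M i p W F
    by (intro walsh_product.intro walsh_basis.intro walsh_basis_axioms.intro M p(1) W F past)
  define \<tau> where "\<tau> = (\<chi> j. ln (t $ j))"
  define c where "c = (\<Prod>j\<in>UNIV. (t $ j) powr (H $ j))"
  define f where "f z \<omega> = g (fst z) (\<tau> - snd z) * \<sigma> (snd z) \<omega>" for z \<omega>
  note adapted_\<sigma> = predictable_adapted[OF \<sigma>_predictable subalgebra_F walsh_filtrationD(1)[OF F]]
  have f_meas: "case_prod f \<in> borel_measurable (N \<Otimes>\<^sub>M M)"
  proof -
    have "(\<lambda>x. (fst (fst x), \<tau> - snd (fst x))) \<in> measurable (N \<Otimes>\<^sub>M M) (p \<Otimes>\<^sub>M lborel)"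
      by measurable
    from measurable_compose[OF this g_meas]
    have [measurable]: "(\<lambda>x. g (fst (fst x)) (\<tau> - snd (fst x))) \<in> borel_measurable (N \<Otimes>\<^sub>M M)" by simp
    have "(\<lambda>x. (snd (fst x), snd x)) \<in> measurable (N \<Otimes>\<^sub>M M) (lborel \<Otimes>\<^sub>M M)" by measurable
    from measurable_compose[OF this predictable_jointly_measurable[OF \<sigma>_predictable subalgebra_F]]
    have [measurable]: "(\<lambda>x. \<sigma> (snd (fst x)) (snd x)) \<in> borel_measurable (N \<Otimes>\<^sub>M M)" by simp
    show ?thesis unfolding f_def case_prod_beta' by measurable
  qed
  have f_adapted: "f z \<in> borel_measurable (F (snd z $ i))" for z
    unfolding f_def[abs_def] using adapted_\<sigma>[of "snd z"] by simp
  have I: "walsh_integral i M N W F f (X \<tau>)"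
  proof -
    have "(\<lambda>(x, s) \<omega>. g x (\<tau> - s) * \<sigma> s \<omega>) = f" by (simp add: fun_eq_iff f_def)
    then show ?thesis using X[of \<tau>] by simp
  qed
  have \<sigma>_M: "\<sigma> s \<in> borel_measurable M" for s using adapted_\<sigma> by (rule measurable_F_imp_measurable)
  have fin: "mean_sq f (\<lambda>_ _. 0) < \<infinity>"
  proof -
    have "(\<lambda>(z, \<omega>). 0 :: real) \<in> borel_measurable (N \<Otimes>\<^sub>M M)" by (simp add: case_prod_beta')
    from sq_dist_swap(2)[OF f_meas this]
    have "mean_sq f (\<lambda>_ _. 0) = (\<integral>\<^sup>+z. \<integral>\<^sup>+\<omega>. ennreal ((f z \<omega>)\<^sup>2) \<partial>M \<partial>N)"
      by simp
    also have "\<dots> = (\<integral>\<^sup>+(x, s). ennreal ((g x (\<tau> - s))\<^sup>2) * (\<integral>\<^sup>+\<omega>. ennreal ((\<sigma> s \<omega>)\<^sup>2) \<partial>M) \<partial>N)"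
      using \<sigma>_M by (simp add: f_def power_mult_distrib ennreal_mult nn_integral_cmult case_prod_beta')
    also have "\<dots> < \<infinity>" by (rule g\<sigma>_finite)
    finally show ?thesis .
  qed
  \<comment> \<open>Freezing the volatility means conditioning on the events that it generates.\<close>
  define \<G> where "\<G> = generated_algebra M UNIV \<sigma>"
  have \<G>: "subalgebra M \<G>" unfolding \<G>_def by (rule subalgebra_generated_algebra) (rule \<sigma>_M)
  have f_\<G>: "f z \<in> borel_measurable \<G>" for z
    unfolding f_def[abs_def] \<G>_def using measurable_generated_algebra[of "snd z" UNIV \<sigma> M] by simp
  have indep: "indep_set (sets \<G>) (generated_events M (fmeasurable N) W)"
    using \<sigma>_indep_W by (simp add: \<G>_def sets_generated_algebra)
  define V where "V = conditional_variance f"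
  note char_X = walsh_integral_char[OF f_meas f_adapted I fin \<G> f_\<G> indep, folded V_def]
  have L_scat: "independently_scattered M (p\<sigma> \<Otimes>\<^sub>M lborel) L" using L by (simp add: levy_basis_def)
  have "approx_linear M (p\<sigma> \<Otimes>\<^sub>M lborel) L (\<lambda>\<omega>. (f z \<omega>)\<^sup>2)" for z
    using approx_linear_scale[OF M L_scat rr_integral_approx_linear[OF M L_scat \<sigma>_sq[of "snd z"]], of "(g (fst z) (\<tau> - snd z))\<^sup>2"]
    by (simp add: f_def power_mult_distrib)
  then have V_lin: "approx_linear M (p\<sigma> \<Otimes>\<^sub>M lborel) L V"
    unfolding V_def by (intro conditional_variance_approx_linear[OF f_meas f_adapted I fin L_scat])
  have V_M: "V \<in> borel_measurable M" using V_lin by (simp add: approx_linear_def)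
  have X_M: "X \<tau> \<in> borel_measurable M" using I by (simp add: walsh_integral_def)
  have "type_G (distr M borel (\<lambda>\<omega>. c * X \<tau> \<omega>))"
  proof (rule type_GI[where U = "\<lambda>\<omega>. c\<^sup>2 * V \<omega>"])
    show "(\<lambda>\<omega>. c * X \<tau> \<omega>) \<in> borel_measurable M" "(\<lambda>\<omega>. c\<^sup>2 * V \<omega>) \<in> borel_measurable M"
      using X_M V_M by simp_all
    show "0 \<le> c\<^sup>2 * V \<omega>" for \<omega> by (simp add: V_def conditional_variance_nonneg)
    show "infinitely_divisible (distr M borel (\<lambda>\<omega>. c\<^sup>2 * V \<omega>))"
      by (rule approx_linear_infinitely_divisible[OF M L box_measure_exists[OF p\<sigma>(1)] approx_linear_scale[OF M L_scat V_lin]])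
    show "char (distr M borel (\<lambda>\<omega>. c * X \<tau> \<omega>)) \<theta> = (CLINT \<omega>|M. exp (complex_of_real (- (\<theta>\<^sup>2 / 2) * (c\<^sup>2 * V \<omega>))))" for \<theta>
      by (subst char_distr_scale[OF X_M]) (simp add: char_X power_mult_distrib mult_ac)
  qed (rule M)
  then show "type_G (distr M borel (lamperti H X t))"
    by (simp add: lamperti_def[abs_def] c_def \<tau>_def)
qed

end
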